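(* Let $D\ge 2$, $x\in\mathbb R^D$, $\tau>0$, $R>0$, $p\ge1$, let $1\le d\le D-1$ be an integer, and let $\alpha\ge0$, $\beta>0$. If $L>0$ and $f_{\max}$ are large enough and $f_{\min}\ge0$ is small enough (with thresholds depending on $\tau$), then $$\liminf_{n\to\infty}\ n^{\beta/(2\beta+d)}\ \inf_{\widehat f(x)}\ \sup_{P\in\Sigma^d_{\alpha,\beta}}\mathbb E_{P^{\otimes n}}\big[|\widehat f(x)-f_P(x)|^p\big]^{1/p}\ \ge\ C_*>0,$$ where $C_*$ depends only on $\tau$ and $R$, the infimum is over all estimators (real-valued measurable functions of $(X_1,\dots,X_n)$), and $\Sigma^d_{\alpha,\beta}=\Sigma^d_{\alpha,\beta}(\tau,L,f_{\min},f_{\max},R)$ is the class of probability measures defined in the context.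
   Context: $\|\cdot\|$ is the Euclidean norm of $\mathbb R^D$; for a linear subspace $H$, $B_H(v,r)$ is the open ball of $H$. $\|\cdot\|_{\mathrm{op}}$ is the operator norm of multilinear maps. For a compact smooth submanifold $M\subset\mathbb R^D$ and $z\in M$, $\exp_z:T_zM\to M\subset\mathbb R^D$ is the Riemannian exponential map (for the induced metric) and $\mathrm{inj}_M(z)$ is the injectivity radius at $z$, the supremum of all $\varepsilon$ such that $\exp_z$ is a smooth parametrization of $M$ on $B_{T_zM}(0,\varepsilon)$. $\mu_M$ is the volume measure on $M$ (restriction to $M$ of the $d$-dimensional Hausdorff measure, $d=\dim M$). Reach: $\tau_M=\sup\{r\ge0:\ \forall y\in\mathbb R^D,\ d(y,M)\le r\Rightarrow\exists!\,z\in M,\ d(y,M)=\|y-z\|\}$. Hölder functions: for $\gamma>0$ put $k=\lceil\gamma-1\rceil$, $\delta=\gamma-k>0$. A map $f:M\to\mathbb R^m$ is $\gamma$-Hölder ($f\in\mathcal H^\gamma(M,\mathbb R^m)$) if for all $z\in M$, $f\circ\exp_z$ is $k$ times differentiable on $B_{T_zM}(0,\mathrm{inj}_M(z))$ with $d^k(f\circ\exp_z)$ $\delta$-Hölder there, and $$\|f\|_{\mathcal H^\gamma}=\sup_{z\in M}\ \sup_{v\neq w\in B_{T_zM}(0,\mathrm{inj}_M(z))}\frac{\|d^k(f\circ\exp_z)(v)-d^k(f\circ\exp_z)(w)\|_{\mathrm{op}}}{\|v-w\|^\delta}.$$ Manifold classes: $\mathcal C_d(\tau)$ is the set of compact smooth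 submanifolds $M$ of $\mathbb R^D$, without boundary, of dimension $d$, containing the fixed point $x$, with $\tau_M\ge\tau$. $\mathcal C_{d,\alpha}(\tau,L)$ is the set of $M\in\mathcal C_d(\tau)$ whose inclusion map $\iota_M:M\hookrightarrow\mathbb R^D$ is $(\alpha+1)$-Hölder with $\|\iota_M\|_{\mathcal H^{\alpha+1}}\le L$. Statistical model: $\Sigma^d_{\alpha,\beta}(\tau,L,f_{\min},f_{\max},R)$, for $0\le f_{\min}<f_{\max}$, is the set of Borel probability measures $P$ on $\mathbb R^D$ such that (i) there is $M_P\in\mathcal C_{d,\alpha}(\tau,L)$ with $\mathrm{supp}\,P=M_P$; (ii) there is a version $f_P$ of $dP/d\mu_{M_P}$ belonging to $\mathcal H^\beta(M_P,\mathbb R)$; (iii) $f_{\min}\le f_P\le f_{\max}$ and $\|f_P\|_{\mathcal H^\beta}\le R$. Under $P^{\otimes n}$, $X_1,\dots,X_n$ are i.i.d. with law $P$. *)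

theory Defs
  imports "HOL-Probability.Probability"
begin

section \<open>Iterated derivatives on relatively open subsets of a linear subspace\<close>

text \<open>Throughout, \<open>U\<close> is a relatively open subset of a linear subspace \<open>H\<close> (possibly \<open>H = UNIV\<close>),
  and derivatives are taken within \<open>U\<close>. If \<open>f\<close> is differentiable at \<open>x\<close> within \<open>U\<close>, the values
  \<open>frechet_derivative f (at x within U) v\<close> are uniquely determined for \<open>v \<in> H\<close>; no other directions
  are used below. Since the spaces are finite-dimensional, the differential is itself \<open>k\<close> times
  differentiable iff all its evaluations at fixed directions are.\<close>

primrec times_differentiable_on ::
  "nat \<Rightarrow> 'a::real_normed_vector set \<Rightarrow> 'a set \<Rightarrow> ('a \<Rightarrow> 'b::real_normed_vector) \<Rightarrow> bool" where
  "times_differentiable_on 0 H U f \<longleftrightarrow> True"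
| "times_differentiable_on (Suc k) H U f \<longleftrightarrow>
     f differentiable_on U \<and>
     (\<forall>v\<in>H. times_differentiable_on k H U (\<lambda>x. frechet_derivative f (at x within U) v))"

definition smooth_rel ::
  "'a::real_normed_vector set \<Rightarrow> 'a set \<Rightarrow> ('a \<Rightarrow> 'b::real_normed_vector) \<Rightarrow> bool" where
  "smooth_rel H U f \<longleftrightarrow> (\<forall>k. times_differentiable_on k H U f)"

abbreviation smooth_on :: "'a::real_normed_vector set \<Rightarrow> ('a \<Rightarrow> 'b::real_normed_vector) \<Rightarrow> bool" where
  "smooth_on U f \<equiv> smooth_rel UNIV U f"

text \<open>\<open>iter_deriv U [v\<^sub>1, \<dots>, v\<^sub>k] f x\<close> is the value of the \<open>k\<close>-linear map \<open>d\<^sup>k f(x)\<close> at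
  \<open>(v\<^sub>1, \<dots>, v\<^sub>k)\<close>.\<close>

primrec iter_deriv ::
  "'a::real_normed_vector set \<Rightarrow> 'a list \<Rightarrow> ('a \<Rightarrow> 'b::real_normed_vector) \<Rightarrow> 'a \<Rightarrow> 'b" where
  "iter_deriv U [] f = f"
| "iter_deriv U (v # vs) f = iter_deriv U vs (\<lambda>x. frechet_derivative f (at x within U) v)"

definition multilinear_op_norm ::
  "nat \<Rightarrow> 'a::real_normed_vector set \<Rightarrow> ('a list \<Rightarrow> 'b::real_normed_vector) \<Rightarrow> ennreal" where
  "multilinear_op_norm k H A =
     (SUP vs\<in>{vs. length vs = k \<and> set vs \<subseteq> H \<inter> cball 0 1}. ennreal (norm (A vs)))"


section \<open>Submanifolds, exponential map, injectivity radius, reach\<close>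

text \<open>Embedded smooth \<open>d\<close>-dimensional submanifold without boundary: around each of its points some
  ambient smooth diffeomorphism straightens \<open>M\<close> to a \<open>d\<close>-dimensional linear subspace.\<close>

definition smooth_submanifold :: "nat \<Rightarrow> 'a::euclidean_space set \<Rightarrow> bool" where
  "smooth_submanifold d M \<longleftrightarrow>
     (\<forall>z\<in>M. \<exists>U V \<phi> \<psi> H. open U \<and> z \<in> U \<and> open (V :: 'a set) \<and>
        homeomorphism U V \<phi> \<psi> \<and> smooth_on U \<phi> \<and> smooth_on V \<psi> \<and>
        subspace H \<and> dim H = d \<and> \<phi> ` (M \<inter> U) = H \<inter> V)"

definition tangent_space :: "'a::euclidean_space set \<Rightarrow> 'a \<Rightarrow> 'a set" where
  "tangent_space M z =
     {v. \<exists>c e. 0 < e \<and> smooth_on {-e<..<e} c \<and> c ` {-e<..<e} \<subseteq> M \<and>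
           c (0::real) = z \<and> (c has_vector_derivative v) (at 0)}"

text \<open>The Levi-Civita connection of the metric induced by the Euclidean one is the tangential
  projection of the ambient derivative, so a curve in \<open>M\<close> is a geodesic iff the tangential part of
  its acceleration vanishes. For compact \<open>M\<close> all geodesics extend to the whole line.\<close>

definition geodesic :: "'a::euclidean_space set \<Rightarrow> (real \<Rightarrow> 'a) \<Rightarrow> bool" where
  "geodesic M c \<longleftrightarrow>
     smooth_on UNIV c \<and> range c \<subseteq> M \<and>
     (\<forall>t. \<forall>w\<in>tangent_space M (c t).
        vector_derivative (\<lambda>s. vector_derivative c (at s)) (at t) \<bullet> w = 0)"

definition exp_map :: "'a::euclidean_space set \<Rightarrow> 'a \<Rightarrow> 'a \<Rightarrow> 'a" where
  "exp_map M z v =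
     (THE y. \<exists>c. geodesic M c \<and> c 0 = z \<and> vector_derivative c (at 0) = v \<and> c 1 = y)"

definition smooth_parametrization ::
  "'a::euclidean_space set \<Rightarrow> 'a set \<Rightarrow> 'a set \<Rightarrow> ('a \<Rightarrow> 'a) \<Rightarrow> bool" where
  "smooth_parametrization M H U \<phi> \<longleftrightarrow>
     smooth_rel H U \<phi> \<and> openin (top_of_set M) (\<phi> ` U) \<and>
     (\<exists>\<psi>. homeomorphism U (\<phi> ` U) \<phi> \<psi>) \<and>
     (\<forall>v\<in>U. inj_on (frechet_derivative \<phi> (at v within U)) H)"

definition inj_radius :: "'a::euclidean_space set \<Rightarrow> 'a \<Rightarrow> ereal" where
  "inj_radius M z =
     (SUP e\<in>{e::real. 0 < e \<and>
               smooth_parametrization M (tangent_space M z)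
                 (tangent_space M z \<inter> ball 0 e) (exp_map M z)}. ereal e)"

definition normal_ball :: "'a::euclidean_space set \<Rightarrow> 'a \<Rightarrow> 'a set" where
  "normal_ball M z = {v \<in> tangent_space M z. ereal (norm v) < inj_radius M z}"

definition reach :: "'a::euclidean_space set \<Rightarrow> ereal" where
  "reach M =
     (SUP r\<in>{r::real. 0 \<le> r \<and> (\<forall>y. infdist y M \<le> r \<longrightarrow> (\<exists>!z. z \<in> M \<and> infdist y M = dist y z))}.
        ereal r)"


section \<open>Hoelder functions on a submanifold\<close>

definition holder_order :: "real \<Rightarrow> nat" where
  "holder_order \<gamma> = nat \<lceil>\<gamma> - 1\<rceil>"

definition holder_exponent :: "real \<Rightarrow> real" where
  "holder_exponent \<gamma> = \<gamma> - real (holder_order \<gamma>)"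

definition local_holder_norm ::
  "real \<Rightarrow> 'a::euclidean_space set \<Rightarrow> ('a \<Rightarrow> 'b::real_normed_vector) \<Rightarrow> 'a \<Rightarrow> ennreal" where
  "local_holder_norm \<gamma> M f z =
     (let B = normal_ball M z; k = holder_order \<gamma>; g = f \<circ> exp_map M z in
      SUP v\<in>B. SUP w\<in>B - {v}.
        multilinear_op_norm k (tangent_space M z) (\<lambda>us. iter_deriv B us g v - iter_deriv B us g w)
          / ennreal (norm (v - w) powr holder_exponent \<gamma>))"

definition holder_norm ::
  "real \<Rightarrow> 'a::euclidean_space set \<Rightarrow> ('a \<Rightarrow> 'b::real_normed_vector) \<Rightarrow> ennreal" where
  "holder_norm \<gamma> M f = (SUP z\<in>M. local_holder_norm \<gamma> M f z)"

definition holder_on ::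
  "real \<Rightarrow> 'a::euclidean_space set \<Rightarrow> ('a \<Rightarrow> 'b::real_normed_vector) \<Rightarrow> bool" where
  "holder_on \<gamma> M f \<longleftrightarrow>
     (\<forall>z\<in>M. times_differentiable_on (holder_order \<gamma>) (tangent_space M z) (normal_ball M z)
               (f \<circ> exp_map M z)
           \<and> local_holder_norm \<gamma> M f z < \<infinity>)"


section \<open>Hausdorff measure and volume measure\<close>

text \<open>Normalised so that the \<open>d\<close>-dimensional Hausdorff measure agrees with the Riemannian volume on
  \<open>d\<close>-dimensional submanifolds; intended for \<open>d \<ge> 1\<close>, where empty covering sets contribute 0.\<close>

definition hausdorff_content :: "nat \<Rightarrow> real \<Rightarrow> 'a::metric_space set \<Rightarrow> ennreal" where
  "hausdorff_content d \<epsilon> A =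
     (INF U\<in>{U :: nat \<Rightarrow> 'a set. A \<subseteq> (\<Union>i. U i) \<and> (\<forall>i. bounded (U i) \<and> diameter (U i) \<le> \<epsilon>)}.
        \<Sum>i. ennreal (unit_ball_vol (real d) * (diameter (U i) / 2) ^ d))"

definition hausdorff_outer :: "nat \<Rightarrow> 'a::metric_space set \<Rightarrow> ennreal" where
  "hausdorff_outer d A = (SUP \<epsilon>\<in>{0<..}. hausdorff_content d \<epsilon> A)"

definition volume_measure :: "nat \<Rightarrow> 'a::euclidean_space set \<Rightarrow> 'a measure" where
  "volume_measure d M = measure_of UNIV (sets borel) (\<lambda>A. hausdorff_outer d (A \<inter> M))"


section \<open>Manifold classes and the statistical model\<close>

definition manifold_class :: "nat \<Rightarrow> 'a::euclidean_space \<Rightarrow> real \<Rightarrow> 'a set set" where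
  "manifold_class d x \<tau> =
     {M. compact M \<and> smooth_submanifold d M \<and> x \<in> M \<and> ereal \<tau> \<le> reach M}"

definition holder_manifold_class ::
  "nat \<Rightarrow> real \<Rightarrow> 'a::euclidean_space \<Rightarrow> real \<Rightarrow> real \<Rightarrow> 'a set set" where
  "holder_manifold_class d \<alpha> x \<tau> L =
     {M \<in> manifold_class d x \<tau>.
        holder_on (\<alpha> + 1) M (\<lambda>y. y) \<and> holder_norm (\<alpha> + 1) M (\<lambda>y. y) \<le> ennreal L}"

definition measure_support :: "'a::topological_space measure \<Rightarrow> 'a set" where
  "measure_support P = {y. \<forall>U. open U \<and> y \<in> U \<longrightarrow> emeasure P U \<noteq> 0}"

text \<open>The functions that may serve as \<open>f\<^sub>P\<close> for a law \<open>P\<close> with support \<open>M\<close>. Only the values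
  on \<open>M\<close> matter; there such a function is continuous and hence uniquely determined by \<open>P\<close>. It is
  regarded as a Borel function on the whole space, which is no restriction (extend it by 0).\<close>

definition admissible_densities ::
  "nat \<Rightarrow> real \<Rightarrow> real \<Rightarrow> real \<Rightarrow> real \<Rightarrow> 'a::euclidean_space measure \<Rightarrow> ('a \<Rightarrow> real) set" where
  "admissible_densities d \<beta> fmin fmax R P =
     (let M = measure_support P in
      {f. f \<in> borel_measurable borel \<and>
          P = density (volume_measure d M) (\<lambda>y. ennreal (f y)) \<and>
          holder_on \<beta> M f \<and>
          (\<forall>y\<in>M. fmin \<le> f y \<and> f y \<le> fmax) \<and>
          holder_norm \<beta> M f \<le> ennreal R})"

definition statistical_model ::
  "nat \<Rightarrow> real \<Rightarrow> real \<Rightarrow> 'a::euclidean_space \<Rightarrow> real \<Rightarrow> real \<Rightarrow> real \<Rightarrow> real \<Rightarrow> real \<Rightarrow> 'a measure set" where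
  "statistical_model d \<alpha> \<beta> x \<tau> L fmin fmax R =
     {P. prob_space P \<and> sets P = sets borel \<and>
         measure_support P \<in> holder_manifold_class d \<alpha> x \<tau> L \<and>
         admissible_densities d \<beta> fmin fmax R P \<noteq> {}}"


section \<open>Minimax risk\<close>

definition ennreal_powr :: "ennreal \<Rightarrow> real \<Rightarrow> ennreal" where
  "ennreal_powr a r = (if a = \<infinity> then \<infinity> else ennreal (enn2real a powr r))"

text \<open>The expectation is a nonnegative integral, so that an estimator with infinite \<open>p\<close>-th moment has
  infinite loss.\<close>

definition pointwise_loss ::
  "nat \<Rightarrow> real \<Rightarrow> 'a measure \<Rightarrow> ((nat \<Rightarrow> 'a) \<Rightarrow> real) \<Rightarrow> real \<Rightarrow> ennreal" where
  "pointwise_loss n p P fhat y =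
     ennreal_powr (\<integral>\<^sup>+ X. ennreal (\<bar>fhat X - y\<bar> powr p) \<partial>(\<Pi>\<^sub>M i\<in>{..<n}. P)) (1 / p)"

text \<open>The inner supremum is over all versions \<open>f\<^sub>P\<close>; they share the same value at \<open>x\<close>.\<close>

definition minimax_risk ::
  "nat \<Rightarrow> real \<Rightarrow> nat \<Rightarrow> real \<Rightarrow> real \<Rightarrow> 'a::euclidean_space \<Rightarrow> real \<Rightarrow> real \<Rightarrow> real \<Rightarrow> real \<Rightarrow> real \<Rightarrow> ennreal" where
  "minimax_risk n p d \<alpha> \<beta> x \<tau> L fmin fmax R =
     (INF fhat\<in>borel_measurable (\<Pi>\<^sub>M i\<in>{..<n}. borel).
        SUP P\<in>statistical_model d \<alpha> \<beta> x \<tau> L fmin fmax R.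
          SUP f\<in>admissible_densities d \<beta> fmin fmax R P. pointwise_loss n p P fhat (f x))"

end

theory Submission
  imports Defs "HOL-Complex_Analysis.Complex_Analysis"
begin

text \<open>
  Le Cam's two-point method, on a round sphere \<open>M\<close> of radius \<open>r > \<tau>\<close> through \<open>x\<close>: compare the uniform
  density with its perturbation by \<open>A (g - c)\<close>, where \<open>c\<close> is the mean of \<open>g\<close> and
  \<open>g y = sinc (N |y - x|) ^ (2 d)\<close>. Then \<open>g x = 1\<close>, and \<open>g\<close> has \<open>L\<^sup>2\<close>-norm squared of order \<open>N ^ - d\<close>.

  Since the constants may depend neither on \<open>\<alpha>\<close> nor on \<open>\<beta>\<close>, the derivatives of order \<open>k\<close> must grow only
  geometrically in \<open>k\<close>, which excludes compactly supported bumps. In the exponential charts of the sphere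
  both the inclusion and \<open>g\<close> extend to entire functions of exponential type, so that Cauchy's
  estimates bound them by \<open>2 r (e\<^sup>2 / r) ^ k\<close> and \<open>(e ^ (4 d) N) ^ k\<close>. With \<open>A\<close> of order
  \<open>R (e ^ (4 d) N) ^ - \<beta>\<close> and \<open>N ^ (2 \<beta> + d)\<close> of order \<open>n e ^ (- 8 d \<beta>)\<close> the factors exponential in \<open>\<beta>\<close>
  cancel from \<open>n ^ (\<beta> / (2 \<beta> + d)) A\<close>. None of the bounds uses the injectivity radius, as they hold on the
  whole tangent space.
\<close>

section \<open>Complexified functions and Cauchy estimates\<close>

text \<open>The difficulty is uniformity: the constant is fixed before p, \<alpha>, \<beta>, L and
  x, while the sample size from which the bound holds may depend on all of them. A factor
  \<open>K powr \<gamma>\<close> is therefore harmless only if K \<le> 1 or if the choice of N and A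
  absorbs it. The former holds for the inclusion because r \<ge> 9 \<ge> exp 2; the latter is
  arranged for the bump. The length of a tangent vector and the distance to x are not holomorphic,
  but their squares extend to entire functions. Hence only even functions of them occur, cosine and
  sinc. An even power of sinc is nonnegative, and with exponent 2 d its square decays like the power
  - 4 d of the distance, which beats the volume growth of order d at all scales above 1 / N.
  Exponential map, reach and volume measure are available only through their definitions, so each is
  worked out for the sphere by elementary means. Exact volumes are avoided: two-sided bounds up to
  constants suffice, one side from explicit coverings, the other from a comparison with Lebesgue
  measure.\<close>

text \<open>A pair \<open>(v, w)\<close> stands for the point \<open>v + \<i> w\<close> of the complexification of \<open>'a\<close>.\<close>

inductive cx_fun :: "('a::euclidean_space \<times> 'a) set \<Rightarrow> ('a \<times> 'a \<Rightarrow> complex) \<Rightarrow> bool"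
  for S where
  cx_const: "cx_fun S (\<lambda>_. c)"
| cx_linear: "cx_fun S (\<lambda>p. Complex (fst p \<bullet> a) (snd p \<bullet> a))"
| cx_add: "cx_fun S F \<Longrightarrow> cx_fun S G \<Longrightarrow> cx_fun S (\<lambda>p. F p + G p)"
| cx_mult: "cx_fun S F \<Longrightarrow> cx_fun S G \<Longrightarrow> cx_fun S (\<lambda>p. F p * G p)"
| cx_comp: "cx_fun S F \<Longrightarrow> open T \<Longrightarrow> h holomorphic_on T \<Longrightarrow> F ` S \<subseteq> T \<Longrightarrow> cx_fun S (\<lambda>p. h (F p))"

text \<open>The shape of the derivative encodes the Cauchy-Riemann equations: an imaginary
  displacement acts as \<i> times the real one. Requiring \<open>F' u\<close> to lie in
  \<open>cx_fun\<close> again makes the class closed under differentiation, so that derivatives can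
  be iterated.\<close>

definition cx_derivative ::
  "('a::euclidean_space \<times> 'a) set \<Rightarrow> ('a \<times> 'a \<Rightarrow> complex) \<Rightarrow> ('a \<Rightarrow> 'a \<times> 'a \<Rightarrow> complex) \<Rightarrow> bool" where
  "cx_derivative S F F' \<longleftrightarrow> (\<forall>u. cx_fun S (F' u)) \<and>
     (\<forall>p\<in>S. (F has_derivative (\<lambda>q. F' (fst q) p + \<i> * F' (snd q) p)) (at p))"

lemma cx_fun_sum:
  "finite A \<Longrightarrow> (\<And>i. i \<in> A \<Longrightarrow> cx_fun S (F i)) \<Longrightarrow> cx_fun S (\<lambda>p. \<Sum>i\<in>A. F i p)"
  by (induction A rule: finite_induct) (auto intro: cx_fun.cx_const cx_fun.cx_add cx_fun.cx_mult)

lemma cx_fun_power: "cx_fun S F \<Longrightarrow> cx_fun S (\<lambda>p. F p ^ n)"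
  by (induction n) (auto intro: cx_fun.cx_const cx_fun.cx_add cx_fun.cx_mult)

lemma cx_fun_entire: "cx_fun S F \<Longrightarrow> h holomorphic_on UNIV \<Longrightarrow> cx_fun S (\<lambda>p. h (F p))"
  by (rule cx_comp[of S F UNIV]) auto

lemma cx_fun_derivative_exists:
  assumes "cx_fun S F"
  shows "\<exists>F'. cx_derivative S F F'"
  using assms
proof (induction rule: cx_fun.induct)
  case (cx_const c)
  have "cx_derivative S (\<lambda>_. c) (\<lambda>_ _. 0)"
    by (auto simp: cx_derivative_def intro: cx_fun.cx_const cx_fun.cx_add cx_fun.cx_mult)
  then show ?case by blast
next
  case (cx_linear a)
  have "cx_derivative S (\<lambda>p. Complex (fst p \<bullet> a) (snd p \<bullet> a)) (\<lambda>u _. of_real (u \<bullet> a))"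
    unfolding cx_derivative_def
  proof (intro conjI allI ballI)
    fix p
    have "((\<lambda>p. of_real (fst p \<bullet> a) + \<i> * of_real (snd p \<bullet> a)) has_derivative
        (\<lambda>q. of_real (fst q \<bullet> a) + \<i> * of_real (snd q \<bullet> a))) (at p)"
      by (auto intro!: derivative_eq_intros)
    then show "((\<lambda>p. Complex (fst p \<bullet> a) (snd p \<bullet> a)) has_derivative
        (\<lambda>q. of_real (fst q \<bullet> a) + \<i> * of_real (snd q \<bullet> a))) (at p)"
      by (simp add: Complex_eq)
  qed (rule cx_fun.cx_const)
  then show ?case by blast
next
  case (cx_add F G)
  then obtain F' G' where *: "cx_derivative S F F'" "cx_derivative S G G'" by blast
  have "cx_derivative S (\<lambda>p. F p + G p) (\<lambda>u p. F' u p + G' u p)"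
    unfolding cx_derivative_def
  proof (intro conjI allI ballI)
    fix p assume "p \<in> S"
    then have "((\<lambda>p. F p + G p) has_derivative (\<lambda>q. (F' (fst q) p + \<i> * F' (snd q) p) +
        (G' (fst q) p + \<i> * G' (snd q) p))) (at p)"
      using * by (intro has_derivative_add) (auto simp: cx_derivative_def)
    then show "((\<lambda>p. F p + G p) has_derivative
        (\<lambda>q. F' (fst q) p + G' (fst q) p + \<i> * (F' (snd q) p + G' (snd q) p))) (at p)"
      by (simp add: algebra_simps)
  qed (use * in \<open>auto simp: cx_derivative_def intro!: cx_fun.cx_const cx_fun.cx_add cx_fun.cx_mult\<close>)
  then show ?case by blast
next
  case (cx_mult F G)
  then obtain F' G' where *: "cx_derivative S F F'" "cx_derivative S G G'" by blast
  have "cx_derivative S (\<lambda>p. F p * G p) (\<lambda>u p. F p * G' u p + F' u p * G p)"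
    unfolding cx_derivative_def
  proof (intro conjI allI ballI)
    fix p assume "p \<in> S"
    then have "((\<lambda>p. F p * G p) has_derivative (\<lambda>q. F p * (G' (fst q) p + \<i> * G' (snd q) p)
         + (F' (fst q) p + \<i> * F' (snd q) p) * G p)) (at p)"
      using * by (intro has_derivative_mult) (auto simp: cx_derivative_def)
    then show "((\<lambda>p. F p * G p) has_derivative
        (\<lambda>q. F p * G' (fst q) p + F' (fst q) p * G p + \<i> * (F p * G' (snd q) p + F' (snd q) p * G p))) (at p)"
      by (simp add: algebra_simps)
  qed (use * cx_mult in \<open>auto simp: cx_derivative_def intro!: cx_fun.cx_const cx_fun.cx_add cx_fun.cx_mult\<close>)
  then show ?case by blast
next
  case (cx_comp F T h)
  then obtain F' where *: "cx_derivative S F F'" by blast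
  \<comment> \<open>The only place where closure under differentiation could fail; holomorphic
    functions have holomorphic derivatives on the same open set.\<close>
  have h': "deriv h holomorphic_on T"
    using cx_comp by (simp add: holomorphic_deriv)
  have "cx_derivative S (\<lambda>p. h (F p)) (\<lambda>u p. deriv h (F p) * F' u p)"
    unfolding cx_derivative_def
  proof (intro conjI allI ballI)
    fix u show "cx_fun S (\<lambda>p. deriv h (F p) * F' u p)"
      using * h' cx_comp by (auto simp: cx_derivative_def intro!: cx_fun.cx_mult cx_fun.cx_comp[of S F T "deriv h"])
  next
    fix p assume p: "p \<in> S"
    then have "(h has_field_derivative deriv h (F p)) (at (F p))"
      using cx_comp by (intro holomorphic_derivI[of h T]) auto
    then have "(h has_derivative (\<lambda>z. deriv h (F p) * z)) (at (F p))"
      by (simp add: has_field_derivative_def)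
    have "(F has_derivative (\<lambda>q. F' (fst q) p + \<i> * F' (snd q) p)) (at p)"
      using * p by (auto simp: cx_derivative_def)
    from has_derivative_compose[OF this, of h] \<open>(h has_derivative _) _\<close>
    have "((\<lambda>p. h (F p)) has_derivative
        (\<lambda>q. deriv h (F p) * (F' (fst q) p + \<i> * F' (snd q) p))) (at p)"
      by blast
    then show "((\<lambda>p. h (F p)) has_derivative
        (\<lambda>q. deriv h (F p) * F' (fst q) p + \<i> * (deriv h (F p) * F' (snd q) p))) (at p)"
      by (simp add: algebra_simps)
  qed
  then show ?case by blast
qed

definition cx_deriv ::
  "('a::euclidean_space \<times> 'a) set \<Rightarrow> ('a \<times> 'a \<Rightarrow> complex) \<Rightarrow> 'a \<Rightarrow> 'a \<times> 'a \<Rightarrow> complex" where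
  "cx_deriv S F = (SOME F'. cx_derivative S F F')"

lemma cx_deriv: "cx_fun S F \<Longrightarrow> cx_derivative S F (cx_deriv S F)"
  unfolding cx_deriv_def using cx_fun_derivative_exists[of S F] by (rule someI_ex)

lemma cx_fun_cx_deriv: "cx_fun S F \<Longrightarrow> cx_fun S (cx_deriv S F u)"
  using cx_deriv by (auto simp: cx_derivative_def)

lemma has_derivative_cx_fun:
  "cx_fun S F \<Longrightarrow> p \<in> S \<Longrightarrow>
    (F has_derivative (\<lambda>q. cx_deriv S F (fst q) p + \<i> * cx_deriv S F (snd q) p)) (at p)"
  using cx_deriv by (auto simp: cx_derivative_def)

lemma linear_cx_deriv:
  assumes "cx_fun S F" "p \<in> S"
  shows "linear (\<lambda>u. cx_deriv S F u p)"
proof -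
  let ?D = "\<lambda>q. cx_deriv S F (fst q) p + \<i> * cx_deriv S F (snd q) p"
  have lin: "linear ?D"
    using has_derivative_cx_fun[OF assms] has_derivative_linear by blast
  \<comment> \<open>Linearity in u is not part of \<open>cx_derivative\<close>. At the origin both
    summands coincide up to the factor \<i>, so the value there is killed by 1 + \<i>; after that,
    restriction to real directions is linear.\<close>
  have "?D 0 = 0" using linear_0[OF lin] .
  then have "(1 + \<i>) * cx_deriv S F 0 p = 0" by (simp add: algebra_simps)
  moreover have "1 + \<i> \<noteq> 0" by (simp add: complex_eq_iff)
  ultimately have z: "cx_deriv S F 0 p = 0" by simp
  have "linear (\<lambda>u::'a. (u, 0::'a))" by (auto intro!: linearI)
  from linear_compose[OF this lin] have "linear (\<lambda>u. ?D (u, 0))" by (simp add: o_def)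
  then show ?thesis by (simp add: z)
qed

primrec cx_iter ::
  "('a::euclidean_space \<times> 'a) set \<Rightarrow> 'a list \<Rightarrow> ('a \<times> 'a \<Rightarrow> complex) \<Rightarrow> 'a \<times> 'a \<Rightarrow> complex" where
  "cx_iter S [] F = F"
| "cx_iter S (v # vs) F = cx_iter S vs (cx_deriv S F v)"

lemma cx_fun_cx_iter: "cx_fun S F \<Longrightarrow> cx_fun S (cx_iter S vs F)"
  by (induction vs arbitrary: F) (auto simp: cx_fun_cx_deriv)

lemma cx_iter_append: "cx_iter S (us @ vs) F = cx_iter S vs (cx_iter S us F)"
  by (induction us arbitrary: F) auto

text \<open>Cauchy's inequality on the complex line through p in direction u. Only the imaginary
  part of the parameter uses up the width of the strip; real displacements are unrestricted, because
  the bound B is uniform in the real part.\<close>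

lemma cx_deriv_bound:
  fixes F :: "'a::euclidean_space \<times> 'a \<Rightarrow> complex"
  assumes F: "cx_fun UNIV F" and "0 < \<rho>" and H: "subspace H"
    and u: "u \<in> H" "norm u \<le> 1" and p: "fst p \<in> H" "snd p \<in> H" "norm (snd p) + \<rho> \<le> t"
    and B: "\<And>q. fst q \<in> H \<Longrightarrow> snd q \<in> H \<Longrightarrow> norm (snd q) \<le> t \<Longrightarrow> norm (F q) \<le> B"
  shows "norm (cx_deriv UNIV F u p) \<le> B / \<rho>"
proof -
  define \<phi> where "\<phi> = (\<lambda>\<zeta>. p + (Re \<zeta> *\<^sub>R u, Im \<zeta> *\<^sub>R u))"
  define f where "f = (\<lambda>\<zeta>. F (\<phi> \<zeta>))"
  have D: "(f has_field_derivative cx_deriv UNIV F u (\<phi> \<zeta>)) (at \<zeta>)" for \<zeta>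
  proof -
    have "(\<phi> has_derivative (\<lambda>h. (Re h *\<^sub>R u, Im h *\<^sub>R u))) (at \<zeta>)"
      unfolding \<phi>_def by (auto intro!: derivative_eq_intros has_derivative_Pair)
    from has_derivative_compose[OF this has_derivative_cx_fun[OF F UNIV_I]]
    have "(f has_derivative (\<lambda>h. cx_deriv UNIV F (Re h *\<^sub>R u) (\<phi> \<zeta>)
        + \<i> * cx_deriv UNIV F (Im h *\<^sub>R u) (\<phi> \<zeta>))) (at \<zeta>)"
      unfolding f_def by simp
    moreover have "(\<lambda>h. cx_deriv UNIV F (Re h *\<^sub>R u) (\<phi> \<zeta>) + \<i> * cx_deriv UNIV F (Im h *\<^sub>R u) (\<phi> \<zeta>))
        = (*) (cx_deriv UNIV F u (\<phi> \<zeta>))"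
    proof
      fix h
      have "cx_deriv UNIV F (Re h *\<^sub>R u) (\<phi> \<zeta>) + \<i> * cx_deriv UNIV F (Im h *\<^sub>R u) (\<phi> \<zeta>)
         = (of_real (Re h) + \<i> * of_real (Im h)) * cx_deriv UNIV F u (\<phi> \<zeta>)"
        by (simp add: linear_scale[OF linear_cx_deriv[OF F UNIV_I]] scaleR_conv_of_real algebra_simps)
      then show "cx_deriv UNIV F (Re h *\<^sub>R u) (\<phi> \<zeta>) + \<i> * cx_deriv UNIV F (Im h *\<^sub>R u) (\<phi> \<zeta>)
        = cx_deriv UNIV F u (\<phi> \<zeta>) * h"
        by (simp add: complex_eq[symmetric] mult.commute)
    qed
    ultimately show ?thesis by (simp add: has_field_derivative_def)
  qed
  have hol: "f holomorphic_on X" for X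
    using D by (meson field_differentiable_at_within field_differentiable_def holomorphic_on_def)
  have "norm ((deriv ^^ 1) f 0) \<le> fact 1 * B / \<rho> ^ 1"
  proof (rule Cauchy_inequality[OF hol holomorphic_on_imp_continuous_on[OF hol] \<open>0 < \<rho>\<close>])
    fix \<zeta> :: complex assume "norm (0 - \<zeta>) = \<rho>"
    then have "\<bar>Im \<zeta>\<bar> \<le> \<rho>" using abs_Im_le_cmod[of \<zeta>] by simp
    then have "norm (Im \<zeta> *\<^sub>R u) \<le> \<rho>"
      using u mult_mono[of "\<bar>Im \<zeta>\<bar>" \<rho> "norm u" 1] \<open>0 < \<rho>\<close> by simp
    then have "norm (snd (\<phi> \<zeta>)) \<le> t"
      using p norm_triangle_ineq[of "snd p" "Im \<zeta> *\<^sub>R u"] by (simp add: \<phi>_def)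
    moreover have "fst (\<phi> \<zeta>) \<in> H" "snd (\<phi> \<zeta>) \<in> H"
      using H u p by (auto simp: \<phi>_def intro!: subspace_add subspace_scale)
    ultimately show "norm (f \<zeta>) \<le> B" unfolding f_def by (rule B[rotated 2])
  qed
  moreover have "\<phi> 0 = p" by (simp add: \<phi>_def zero_prod_def[symmetric])
  ultimately show ?thesis using DERIV_imp_deriv[OF D[of 0]] by simp
qed

text \<open>Each derivative spends \<rho> of the strip width. In contrast to a single Cauchy
  estimate of order k this produces no factorial: if B grows like exp (c t), the choice t = k \<rho>
  gives the geometric bound (exp (c \<rho>) / \<rho>) ^ k.\<close>

lemma cx_iter_bound:
  fixes F :: "'a::euclidean_space \<times> 'a \<Rightarrow> complex"
  assumes F: "cx_fun UNIV F" and \<rho>: "0 < \<rho>" and H: "subspace H"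
    and us: "\<And>u. u \<in> set us \<Longrightarrow> u \<in> H \<and> norm u \<le> 1"
    and p: "fst p \<in> H" "snd p \<in> H" "norm (snd p) + real (length us) * \<rho> \<le> t"
    and B: "\<And>q. fst q \<in> H \<Longrightarrow> snd q \<in> H \<Longrightarrow> norm (snd q) \<le> t \<Longrightarrow> norm (F q) \<le> B"
  shows "norm (cx_iter UNIV us F p) \<le> B / \<rho> ^ length us"
  using F us p(3) B
proof (induction us arbitrary: F B t)
  case Nil
  then show ?case using p by simp
next
  case (Cons u us)
  have "norm (cx_iter UNIV us (cx_deriv UNIV F u) p) \<le> (B / \<rho>) / \<rho> ^ length us"
  proof (rule Cons.IH[where t = "t - \<rho>"])
    show "norm (snd p) + real (length us) * \<rho> \<le> t - \<rho>"
      using Cons.prems(3) by (simp add: algebra_simps)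
    fix q assume "fst q \<in> H" "snd q \<in> H" "norm (snd q) \<le> t - \<rho>"
    then show "norm (cx_deriv UNIV F u q) \<le> B / \<rho>"
      using Cons.prems by (intro cx_deriv_bound[OF _ \<rho> H, where t = t]) auto
  qed (use Cons.prems in \<open>auto simp: cx_fun_cx_deriv\<close>)
  then show ?case by (simp add: field_simps)
qed

section \<open>Real points: derivatives within relatively open subsets of a subspace\<close>

lemma has_derivative_real_part_cx_fun:
  assumes F: "cx_fun S F" and v: "(v, 0) \<in> S"
  shows "((\<lambda>v. Re (F (v, 0))) has_derivative (\<lambda>u. Re (cx_deriv S F u (v, 0)))) (at v)"
proof -
  have "((\<lambda>v. (v, 0::'a)) has_derivative (\<lambda>u. (u, 0))) (at v)"
    by (intro has_derivative_Pair has_derivative_ident has_derivative_const)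
  from has_derivative_Re[OF has_derivative_compose[OF this has_derivative_cx_fun[OF F v]]]
  show ?thesis using linear_0[OF linear_cx_deriv[OF F v]] by simp
qed

text \<open>Within a subset of a proper subspace the derivative is not unique as a linear map, so
  \<open>frechet_derivative\<close> may choose any candidate. On directions u in H all candidates
  agree, since the segment x + t u stays in U for small t and determines the value as a one-variable
  derivative.\<close>

lemma frechet_derivative_within_subspace:
  fixes f :: "'a::euclidean_space \<Rightarrow> 'b::real_normed_vector"
  assumes U: "U = H \<inter> T" and H: "subspace H" and "open T" and x: "x \<in> U" and u: "u \<in> H"
    and f: "(f has_derivative f') (at x within U)"
  shows "frechet_derivative f (at x within U) u = f' u"
proof -
  have g: "(f has_derivative frechet_derivative f (at x within U)) (at x within U)"
    using f frechet_derivative_works differentiableI by blast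
  let ?\<gamma> = "\<lambda>t::real. x + t *\<^sub>R u"
  have "open (?\<gamma> -` T)" using \<open>open T\<close>
    by (intro open_vimage continuous_intros) auto
  then obtain e where e: "0 < e" "ball 0 e \<subseteq> ?\<gamma> -` T"
    using x U by (auto simp: open_contains_ball elim!: ballE[of _ _ 0])
  have sub: "?\<gamma> ` ball 0 e \<subseteq> U"
    using e x u U by (auto intro!: subspace_add[OF H] subspace_scale[OF H])
  have *: "((\<lambda>t. f (?\<gamma> t)) has_vector_derivative D u) (at 0)"
    if D: "(f has_derivative D) (at x within U)" for D
  proof -
    have "(?\<gamma> has_derivative (\<lambda>t. t *\<^sub>R u)) (at 0 within ball 0 e)"
      by (auto intro!: derivative_eq_intros)
    moreover have "(f has_derivative D) (at (?\<gamma> 0) within ?\<gamma> ` ball 0 e)"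
      using has_derivative_subset[OF D sub] by simp
    ultimately have "((\<lambda>t. f (?\<gamma> t)) has_derivative (\<lambda>t. D (t *\<^sub>R u))) (at 0 within ball 0 e)"
      using diff_chain_within[of ?\<gamma> "\<lambda>t. t *\<^sub>R u" 0 "ball 0 e" f D] by (simp add: o_def)
    then have "((\<lambda>t. f (?\<gamma> t)) has_derivative (\<lambda>t. D (t *\<^sub>R u))) (at 0)"
      using e by (simp add: at_within_open[of 0 "ball 0 e"])
    then show ?thesis
      by (simp add: has_vector_derivative_def linear_scale[OF has_derivative_linear[OF D]])
  qed
  show ?thesis using vector_derivative_unique_at[OF *[OF g] *[OF f]] .
qed

text \<open>Comparing real parts at real points suffices, and this relation is inherited by
  derivatives in real directions.\<close>

definition cx_represents ::
  "('a::euclidean_space \<times> 'a) set \<Rightarrow> 'a set \<Rightarrow> ('a \<Rightarrow> 'b::euclidean_space) \<Rightarrow> ('b \<Rightarrow> 'a \<times> 'a \<Rightarrow> complex) \<Rightarrow> bool" where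
  "cx_represents S U f F \<longleftrightarrow>
     (\<forall>b\<in>Basis. cx_fun S (F b)) \<and> (\<forall>v\<in>U. (v, 0) \<in> S \<and> f v = (\<Sum>b\<in>Basis. Re (F b (v, 0)) *\<^sub>R b))"

lemma cx_represents_has_derivative:
  assumes "cx_represents S U f F" "x \<in> U"
  shows "(f has_derivative (\<lambda>u. \<Sum>b\<in>Basis. Re (cx_deriv S (F b) u (x, 0)) *\<^sub>R b)) (at x within U)"
proof -
  have "((\<lambda>v. \<Sum>b\<in>Basis. Re (F b (v, 0)) *\<^sub>R b) has_derivative
      (\<lambda>u. \<Sum>b\<in>Basis. Re (cx_deriv S (F b) u (x, 0)) *\<^sub>R b)) (at x)"
    using assms
    by (intro has_derivative_sum has_derivative_scaleR_left has_derivative_real_part_cx_fun)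
      (auto simp: cx_represents_def)
  then have "((\<lambda>v. \<Sum>b\<in>Basis. Re (F b (v, 0)) *\<^sub>R b) has_derivative
      (\<lambda>u. \<Sum>b\<in>Basis. Re (cx_deriv S (F b) u (x, 0)) *\<^sub>R b)) (at x within U)"
    by (rule has_derivative_at_withinI)
  then show ?thesis
    by (rule has_derivative_transform[rotated 2]) (use assms in \<open>auto simp: cx_represents_def\<close>)
qed

text \<open>The induction step for every iterated notion: differentiating f within U replaces the
  representing functions by their complex derivatives, and the situation is as before.\<close>

lemma cx_represents_frechet:
  assumes f: "cx_represents S U f F" and U: "U = H \<inter> T" "subspace H" "open T" and u: "u \<in> H"
  shows "cx_represents S U (\<lambda>x. frechet_derivative f (at x within U) u) (\<lambda>b. cx_deriv S (F b) u)"
  using f frechet_derivative_within_subspace[OF U _ u cx_represents_has_derivative[OF f]]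
  unfolding cx_represents_def by (auto simp: cx_fun_cx_deriv)

lemma times_differentiable_on_cx:
  assumes "cx_represents S U f F" and U: "U = H \<inter> T" "subspace H" "open T"
  shows "times_differentiable_on k H U f"
  using assms(1)
proof (induction k arbitrary: f F)
  case (Suc k)
  have "f differentiable_on U"
    unfolding differentiable_on_def differentiable_def
    using cx_represents_has_derivative[OF Suc.prems] by blast
  then show ?case
    using Suc.IH[OF cx_represents_frechet[OF Suc.prems U]] by simp
qed simp

lemma smooth_on_cx:
  assumes "cx_represents S U f F" "open U"
  shows "smooth_on U f"
  unfolding smooth_rel_def using times_differentiable_on_cx[OF assms(1), of UNIV U] assms(2) by auto

lemma iter_deriv_cx:
  assumes "cx_represents S U f F" and U: "U = H \<inter> T" "subspace H" "open T" and "set us \<subseteq> H"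
  shows "cx_represents S U (iter_deriv U us f) (\<lambda>b. cx_iter S us (F b))"
  using assms(1,5)
proof (induction us arbitrary: f F)
  case (Cons u us)
  then have "u \<in> H" "set us \<subseteq> H" by auto
  from Cons.IH[OF cx_represents_frechet[OF Cons.prems(1) U this(1)] this(2)]
  show ?case by simp
qed simp

section \<open>Hoelder seminorms from geometric derivative bounds\<close>

lemma Re_cx_fun_diff_bound:
  fixes F :: "'a::euclidean_space \<times> 'a \<Rightarrow> complex"
  assumes F: "cx_fun UNIV F" and H: "subspace H" and v: "v \<in> H" "w \<in> H"
    and B: "\<And>u q. u \<in> H \<Longrightarrow> norm u \<le> 1 \<Longrightarrow> q \<in> H \<Longrightarrow> norm (cx_deriv UNIV F u (q, 0)) \<le> B"
  shows "\<bar>Re (F (v, 0)) - Re (F (w, 0))\<bar> \<le> B * norm (v - w)"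
proof (cases "v = w")
  case False
  define u where "u = (v - w) /\<^sub>R norm (v - w)"
  have u: "u \<in> H" "norm u = 1" "v - w = norm (v - w) *\<^sub>R u"
    using v H False by (auto simp: u_def intro!: subspace_scale subspace_diff)
  have "\<bar>Re (F (w + norm (v - w) *\<^sub>R u, 0)) - Re (F (w + 0 *\<^sub>R u, 0))\<bar> \<le> B * \<bar>norm (v - w) - 0\<bar>"
  proof (rule field_differentiable_bound[where S = UNIV and f = "\<lambda>t. Re (F (w + t *\<^sub>R u, 0))", unfolded real_norm_def])
    fix t :: real
    have "((\<lambda>t. w + t *\<^sub>R u) has_derivative (\<lambda>s. s *\<^sub>R u)) (at t)"
      by (auto intro!: derivative_eq_intros)
    from has_derivative_compose[OF this has_derivative_real_part_cx_fun[OF F UNIV_I]]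
    show "((\<lambda>t. Re (F (w + t *\<^sub>R u, 0))) has_field_derivative
        Re (cx_deriv UNIV F u (w + t *\<^sub>R u, 0))) (at t within UNIV)"
      by (simp add: has_field_derivative_def linear_scale[OF linear_cx_deriv[OF F UNIV_I]] mult.commute[of _ "Re _"])
    have "w + t *\<^sub>R u \<in> H" using v u H by (intro subspace_add subspace_scale) auto
    then have "norm (cx_deriv UNIV F u (w + t *\<^sub>R u, 0)) \<le> B" using u B by simp
    then show "\<bar>Re (cx_deriv UNIV F u (w + t *\<^sub>R u, 0))\<bar> \<le> B"
      using abs_Re_le_cmod order_trans by blast
  qed auto
  moreover have "w + norm (v - w) *\<^sub>R u = v" using u(3)[symmetric] by simp
  ultimately show ?thesis by simp
qed simp

text \<open>Interpolates between the trivial and the Lipschitz bound of a difference: a number t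
  \<ge> 1 satisfies 1 \<le> \<open>t powr \<delta>\<close>, a number t \<le> 1 satisfies t \<le>
  \<open>t powr \<delta>\<close>.\<close>

lemma min_le_powr:
  fixes K s \<delta> :: real
  assumes "0 < K" "0 \<le> s" "0 < \<delta>" "\<delta> \<le> 1"
  shows "min 1 (K * s) \<le> K powr \<delta> * s powr \<delta>"
proof -
  have "min 1 (K * s) \<le> (K * s) powr \<delta>"
  proof (cases "K * s \<ge> 1")
    case True
    then show ?thesis using assms ge_one_powr_ge_zero[of "K * s" \<delta>] by simp
  next
    case False
    then show ?thesis
      using assms powr_mono'[of \<delta> 1 "K * s"] by (cases "s = 0") auto
  qed
  then show ?thesis using assms by (simp add: powr_mult)
qed

text \<open>For \<gamma> > 0 the ceiling in \<open>holder_order\<close> is nonnegative, so the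
  conversion to \<open>nat\<close> does not truncate. At integers the exponent is 1, with order
  \<gamma> - 1.\<close>

lemma holder_exponent_bounds:
  assumes "0 < \<gamma>"
  shows "0 < holder_exponent \<gamma>" "holder_exponent \<gamma> \<le> 1"
  using assms unfolding holder_exponent_def holder_order_def by linarith+

lemma open_ereal_norm_less: "open {v::'a::euclidean_space. ereal (norm v) < a}"
  by (cases a) (auto simp: open_Collect_less continuous_intros)

lemma normal_ball_eq: "normal_ball M z = tangent_space M z \<inter> {v. ereal (norm v) < inj_radius M z}"
  by (auto simp: normal_ball_def)

lemma norm_le_DIM_mult:
  fixes y :: "'b::euclidean_space"
  assumes "\<And>b. b \<in> Basis \<Longrightarrow> \<bar>y \<bullet> b\<bar> \<le> B"
  shows "norm y \<le> real DIM('b) * B"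
  using norm_le_l1[of y] sum_bounded_above[of Basis "\<lambda>b. \<bar>y \<bullet> b\<bar>" B] assms by simp

text \<open>With k the order and \<delta> the exponent, the k-th derivatives differ by at most 2 A K
  ^ k and also by at most A K ^ (k + 1) times the distance. Interpolation gives K to the power k +
  \<delta> = \<gamma>, so that \<gamma> enters the constant only through
  \<open>K powr \<gamma>\<close>. The bounds hold on the whole tangent space, and the normal ball
  matters only as a relatively open subset of it.\<close>

lemma
  fixes f :: "'a::euclidean_space \<Rightarrow> 'b::euclidean_space"
  assumes \<gamma>: "0 < \<gamma>" and K: "0 < K" and H: "subspace (tangent_space M z)"
    and F: "\<And>b. b \<in> Basis \<Longrightarrow> cx_fun UNIV (F b)"
    and f: "\<And>v. v \<in> tangent_space M z \<Longrightarrow> f (exp_map M z v) = (\<Sum>b\<in>Basis. Re (F b (v, 0)) *\<^sub>R b)"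
    and B: "\<And>b us v. b \<in> Basis \<Longrightarrow> set us \<subseteq> tangent_space M z \<inter> cball 0 1 \<Longrightarrow> v \<in> tangent_space M z \<Longrightarrow>
      length us \<le> Suc (holder_order \<gamma>) \<Longrightarrow> norm (cx_iter UNIV us (F b) (v, 0)) \<le> A * K ^ length us"
  shows local_holder_norm_cx:
      "local_holder_norm \<gamma> M f z \<le> ennreal (real DIM('b) * (2 * A * K powr \<gamma>))"
    and times_differentiable_on_exp_map_cx:
      "times_differentiable_on k (tangent_space M z) (normal_ball M z) (f \<circ> exp_map M z)"
proof -
  let ?T = "tangent_space M z" and ?U = "normal_ball M z" and ?k = "holder_order \<gamma>"
  define \<delta> where "\<delta> = holder_exponent \<gamma>"
  have \<delta>: "0 < \<delta>" "\<delta> \<le> 1" and \<gamma>\<delta>: "\<gamma> = real ?k + \<delta>"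
    using holder_exponent_bounds[OF \<gamma>] by (auto simp: \<delta>_def holder_exponent_def)
  have K\<gamma>: "K powr \<gamma> = K ^ ?k * K powr \<delta>"
    using K by (subst \<gamma>\<delta>) (simp add: powr_add powr_realpow)
  note U = normal_ball_eq[of M z] H open_ereal_norm_less
  have UT: "?U \<subseteq> ?T" by (auto simp: normal_ball_def)
  have rep: "cx_represents UNIV ?U (f \<circ> exp_map M z) F"
    using F f UT by (auto simp: cx_represents_def)
  show "times_differentiable_on k ?T ?U (f \<circ> exp_map M z)"
    by (rule times_differentiable_on_cx[OF rep U])
  \<comment> \<open>The hypothesis for the empty list at the origin forces A \<ge> 0.\<close>
  obtain b0 :: 'b where "b0 \<in> Basis" using nonempty_Basis by blast
  have "norm (cx_iter UNIV [] (F b0) (0, 0)) \<le> A * K ^ length ([]::'a list)"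
    by (rule B) (use \<open>b0 \<in> Basis\<close> H in \<open>auto simp: subspace_0\<close>)
  then have "norm (F b0 (0, 0)) \<le> A" by simp
  then have A0: "0 \<le> A" by (rule order_trans[OF norm_ge_zero])
  have main: "norm (iter_deriv ?U us (f \<circ> exp_map M z) v - iter_deriv ?U us (f \<circ> exp_map M z) w)
      \<le> real DIM('b) * (2 * A * K powr \<gamma>) * norm (v - w) powr \<delta>"
    if us: "length us = ?k" "set us \<subseteq> ?T \<inter> cball 0 1" and v: "v \<in> ?U" and w: "w \<in> ?U" for us v w
  proof -
    note it = iter_deriv_cx[OF rep U, of us]
    have "\<bar>(iter_deriv ?U us (f \<circ> exp_map M z) v - iter_deriv ?U us (f \<circ> exp_map M z) w) \<bullet> b\<bar>
        \<le> 2 * A * K powr \<gamma> * norm (v - w) powr \<delta>" if b: "b \<in> Basis" for b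
    proof -
      let ?G = "cx_iter UNIV us (F b)"
      have vw: "v \<in> ?T" "w \<in> ?T" using v w UT by auto
      have "\<bar>Re (?G (v, 0)) - Re (?G (w, 0))\<bar> \<le> norm (?G (v, 0)) + norm (?G (w, 0))"
        using abs_Re_le_cmod[of "?G (v, 0)"] abs_Re_le_cmod[of "?G (w, 0)"] by linarith
      also have "\<dots> \<le> A * K ^ ?k + A * K ^ ?k"
        using B[OF b us(2) vw(1)] B[OF b us(2) vw(2)] us(1) by simp
      finally have 1: "\<bar>Re (?G (v, 0)) - Re (?G (w, 0))\<bar> \<le> 2 * A * K ^ ?k" by simp
      have 2: "\<bar>Re (?G (v, 0)) - Re (?G (w, 0))\<bar> \<le> A * K ^ Suc ?k * norm (v - w)"
      proof (rule Re_cx_fun_diff_bound[OF cx_fun_cx_iter[OF F[OF b]] H vw])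
        fix u q assume "u \<in> ?T" "norm u \<le> 1" "q \<in> ?T"
        then show "norm (cx_deriv UNIV ?G u (q, 0)) \<le> A * K ^ Suc ?k"
          using B[OF b, of "us @ [u]" q] us by (simp add: cx_iter_append)
      qed
      also have "A * K ^ Suc ?k * norm (v - w) \<le> 2 * A * K ^ ?k * (K * norm (v - w))"
        using A0 K by (simp add: mult_right_mono)
      finally have "\<bar>Re (?G (v, 0)) - Re (?G (w, 0))\<bar> \<le> 2 * A * K ^ ?k * min 1 (K * norm (v - w))"
        using 1 by (simp add: min_def split: if_splits)
      also have "\<dots> \<le> 2 * A * K ^ ?k * (K powr \<delta> * norm (v - w) powr \<delta>)"
        using A0 K \<delta> by (intro mult_left_mono min_le_powr) auto
      also have "\<dots> = 2 * A * K powr \<gamma> * norm (v - w) powr \<delta>"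
        by (simp add: K\<gamma>)
      finally show ?thesis
        using it us v w b
        by (simp add: cx_represents_def inner_diff_left inner_sum_left_Basis)
    qed
    from norm_le_DIM_mult[OF this] show ?thesis by (simp add: mult.assoc)
  qed
  show "local_holder_norm \<gamma> M f z \<le> ennreal (real DIM('b) * (2 * A * K powr \<gamma>))"
    unfolding local_holder_norm_def Let_def
  proof (intro SUP_least)
    fix v w assume v: "v \<in> ?U" and w: "w \<in> ?U - {v}"
    then have pos: "0 < norm (v - w) powr \<delta>" by auto
    have "multilinear_op_norm ?k ?T
        (\<lambda>us. iter_deriv ?U us (f \<circ> exp_map M z) v - iter_deriv ?U us (f \<circ> exp_map M z) w)
      \<le> ennreal (real DIM('b) * (2 * A * K powr \<gamma>) * norm (v - w) powr \<delta>)"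
      unfolding multilinear_op_norm_def using main v w
      by (intro SUP_least) (auto intro!: ennreal_leI)
    also have "\<dots> = ennreal (real DIM('b) * (2 * A * K powr \<gamma>)) * ennreal (norm (v - w) powr \<delta>)"
      using A0 by (subst ennreal_mult) auto
    finally show "multilinear_op_norm ?k ?T
        (\<lambda>us. iter_deriv ?U us (f \<circ> exp_map M z) v - iter_deriv ?U us (f \<circ> exp_map M z) w)
        / ennreal (norm (v - w) powr holder_exponent \<gamma>) \<le> ennreal (real DIM('b) * (2 * A * K powr \<gamma>))"
      using pos by (intro divide_le_posI_ennreal) (auto simp: \<delta>_def mult.commute)
  qed
qed

section \<open>The exponential map of a sphere in complexified form\<close>

text \<open>The cosine of the square root of q. The cosine is even, so its power series is a series
  in the square, and no branch of the root is involved.\<close>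

definition entire_cos :: "complex \<Rightarrow> complex" where
  "entire_cos q = (\<Sum>n. cos_coeff (2 * n) *\<^sub>R q ^ n)"

text \<open>This is sin W / W as a function of q = W^2: the derivative of cos (sqrt q) is - sin
  (sqrt q) / (2 sqrt q).\<close>

definition entire_sinc :: "complex \<Rightarrow> complex" where
  "entire_sinc q = - 2 * deriv entire_cos q"

lemma entire_cos_sums: "(\<lambda>n. cos_coeff (2 * n) *\<^sub>R (W\<^sup>2) ^ n) sums cos (W::complex)"
proof -
  have "(\<lambda>n. cos_coeff n *\<^sub>R W ^ n) sums cos W" by (rule cos_converges)
  \<comment> \<open>The odd coefficients of the cosine series vanish.\<close>
  then have "(\<lambda>n. cos_coeff (2 * n) *\<^sub>R W ^ (2 * n)) sums cos W"
    by (subst sums_mono_reindex[where g = "\<lambda>n. 2 * n"]) (auto simp: strict_mono_def cos_coeff_def elim!: evenE)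
  then show ?thesis by (simp add: power_mult)
qed

lemma entire_cos_square: "entire_cos (W\<^sup>2) = cos W"
  unfolding entire_cos_def using entire_cos_sums sums_unique by metis

lemma entire_cos_has_derivative:
  "(entire_cos has_field_derivative (\<Sum>n. diffs (\<lambda>n. of_real (cos_coeff (2 * n))) n * q ^ n)) (at q)"
proof -
  \<comment> \<open>Every complex number is a square, so convergence of the cosine series everywhere
    is convergence of this one everywhere.\<close>
  have "summable (\<lambda>n. of_real (cos_coeff (2 * n)) * y ^ n)" for y :: complex
    using entire_cos_sums[of "csqrt y"] by (auto simp: sums_iff scaleR_conv_of_real)
  from termdiffs_strong_converges_everywhere[OF this, of q]
  show ?thesis by (simp add: entire_cos_def[abs_def] scaleR_conv_of_real)
qed

lemma holomorphic_entire_cos: "entire_cos holomorphic_on A"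
  using entire_cos_has_derivative
  by (meson field_differentiable_at_within field_differentiable_def holomorphic_on_def)

lemma holomorphic_entire_sinc: "entire_sinc holomorphic_on UNIV"
  unfolding entire_sinc_def[abs_def]
  by (intro holomorphic_intros holomorphic_deriv holomorphic_entire_cos) auto

lemma entire_sinc_square: "W * entire_sinc (W\<^sup>2) = sin W"
proof -
  have "(entire_cos has_field_derivative deriv entire_cos (W\<^sup>2)) (at (W\<^sup>2))"
    using DERIV_imp_deriv entire_cos_has_derivative by metis
  moreover have "((\<lambda>W::complex. W\<^sup>2) has_field_derivative 2 * W) (at W)"
    by (auto intro!: derivative_eq_intros)
  ultimately have "((\<lambda>W. entire_cos (W\<^sup>2)) has_field_derivative deriv entire_cos (W\<^sup>2) * (2 * W)) (at W)"
    by (rule DERIV_chain2)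
  then have "(cos has_field_derivative deriv entire_cos (W\<^sup>2) * (2 * W)) (at W)"
    by (simp add: entire_cos_square)
  from DERIV_unique[OF this DERIV_cos] have "deriv entire_cos (W\<^sup>2) * (2 * W) = - sin W" by simp
  then show ?thesis by (simp add: entire_sinc_def algebra_simps)
qed

lemma entire_sinc_0: "entire_sinc 0 = 1"
proof -
  have "deriv entire_cos 0 = (\<Sum>n. diffs (\<lambda>n. of_real (cos_coeff (2 * n))) n * 0 ^ n)"
    using entire_cos_has_derivative by (rule DERIV_imp_deriv)
  also have "\<dots> = - 1 / 2"
    by (subst powser_zero) (simp add: diffs_def cos_coeff_def)
  finally show ?thesis by (simp add: entire_sinc_def)
qed

lemma entire_cos_of_real: "entire_cos (of_real (s\<^sup>2)) = of_real (cos s)"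
  using entire_cos_square[of "of_real s"] by (simp add: cos_of_real)

lemma entire_sinc_of_real: "entire_sinc (of_real (s\<^sup>2)) = of_real (sinc s)"
proof (cases "s = 0")
  case False
  then have "of_real s * entire_sinc (of_real (s\<^sup>2)) = of_real s * of_real (sinc s)"
    using entire_sinc_square[of "of_real s"] by (simp add: sin_of_real[symmetric])
  then show ?thesis using False mult_left_cancel of_real_eq_0_iff by blast
qed (simp add: entire_sinc_0)

lemma cmod_cos_square: "(cmod (cos W))\<^sup>2 = (cos (Re W))\<^sup>2 + (sinh (Im W))\<^sup>2"
  using norm_cos_squared[of W] by (simp add: sinh_def power_divide exp_minus field_simps)

lemma cmod_sin_square: "(cmod (sin W))\<^sup>2 = (sin (Re W))\<^sup>2 + (sinh (Im W))\<^sup>2"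
proof -
  have "(cmod (cos (of_real pi / 2 - W)))\<^sup>2 = (cos (pi / 2 - Re W))\<^sup>2 + (sinh (- Im W))\<^sup>2"
    by (subst cmod_cos_square) simp
  then show ?thesis unfolding sin_cos_eq[of W, symmetric] by (simp add: cos_diff)
qed

lemma sinh_le_mult_cosh:
  fixes t :: real
  shows "\<bar>sinh t\<bar> \<le> \<bar>t\<bar> * cosh t"
proof -
  have *: "sinh s \<le> s * cosh s" if "0 \<le> s" for s :: real
  proof -
    have "0 * cosh 0 - sinh (0::real) \<le> s * cosh s - sinh s"
    proof (rule DERIV_nonneg_imp_nondecreasing[OF that])
      fix x :: real assume "0 \<le> x"
      have "((\<lambda>t. t * cosh t - sinh t) has_real_derivative x * sinh x) (at x)"
        by (auto intro!: derivative_eq_intros)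
      then show "\<exists>y. ((\<lambda>t. t * cosh t - sinh t) has_real_derivative y) (at x) \<and> 0 \<le> y"
        using \<open>0 \<le> x\<close> by auto
    qed
    then show ?thesis by simp
  qed
  show ?thesis using *[of "\<bar>t\<bar>"] by (cases "0 \<le> t") auto
qed

text \<open>For W = s + \<i> t, the square of |sin W| is sin^2 s + sinh^2 t, which is at most (s^2 +
  t^2) cosh^2 t. Growth thus depends on the imaginary part alone, which is what an estimate on
  strips requires.\<close>

lemma cmod_entire_sinc_le: "cmod (entire_sinc (W\<^sup>2)) \<le> cosh (Im W)"
proof (cases "W = 0")
  case False
  let ?s = "Re W" and ?t = "Im W"
  have "(cmod W * cmod (entire_sinc (W\<^sup>2)))\<^sup>2 = (sin ?s)\<^sup>2 + (sinh ?t)\<^sup>2"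
    by (simp add: norm_mult[symmetric] entire_sinc_square cmod_sin_square)
  also have "\<dots> \<le> ?s\<^sup>2 * (cosh ?t)\<^sup>2 + ?t\<^sup>2 * (cosh ?t)\<^sup>2"
  proof (rule add_mono)
    have "(sin ?s)\<^sup>2 \<le> ?s\<^sup>2" using abs_sin_x_le_abs_x abs_le_square_iff by blast
    also have "\<dots> \<le> ?s\<^sup>2 * (cosh ?t)\<^sup>2" by (simp add: cosh_real_ge_1 mult_le_cancel_left1)
    finally show "(sin ?s)\<^sup>2 \<le> ?s\<^sup>2 * (cosh ?t)\<^sup>2" .
    have "(sinh ?t)\<^sup>2 \<le> (?t * cosh ?t)\<^sup>2"
      using sinh_le_mult_cosh[of ?t] by (simp add: abs_le_square_iff[symmetric] abs_mult)
    then show "(sinh ?t)\<^sup>2 \<le> ?t\<^sup>2 * (cosh ?t)\<^sup>2" by (simp add: power_mult_distrib)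
  qed
  also have "\<dots> = (cmod W * cosh ?t)\<^sup>2"
    by (simp add: cmod_power2 power_mult_distrib algebra_simps)
  finally have "cmod W * cmod (entire_sinc (W\<^sup>2)) \<le> cmod W * cosh ?t"
    by (rule power2_le_imp_le) simp
  then show ?thesis using False by simp
qed (simp add: entire_sinc_0)

text \<open>W is a complex length of v + \<i> w, and its imaginary part is no longer than that of
  the vector. Otherwise the real part of the equation would give |Re W| > |v| as well, and the
  product Re W * Im W = v \<bullet> w would violate the Cauchy-Schwarz inequality.\<close>

lemma abs_Im_sqrt_le:
  fixes v w :: "'a::real_inner"
  assumes "W\<^sup>2 = Complex ((norm v)\<^sup>2 - (norm w)\<^sup>2) (2 * (v \<bullet> w))"
  shows "\<bar>Im W\<bar> \<le> norm w"
proof (rule ccontr)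
  assume neg: "\<not> \<bar>Im W\<bar> \<le> norm w"
  have 1: "(Re W)\<^sup>2 - (Im W)\<^sup>2 = (norm v)\<^sup>2 - (norm w)\<^sup>2" and 2: "Re W * Im W = v \<bullet> w"
    using arg_cong[OF assms, of Re] arg_cong[OF assms, of Im]
    by (auto simp: Re_power2 Im_power2)
  have t: "(norm w)\<^sup>2 < (Im W)\<^sup>2"
    using neg power_strict_mono[of "norm w" "\<bar>Im W\<bar>" 2] by simp
  then have s: "(norm v)\<^sup>2 < (Re W)\<^sup>2" using 1 by simp
  have "(v \<bullet> w)\<^sup>2 \<le> (norm v)\<^sup>2 * (norm w)\<^sup>2"
    using Cauchy_Schwarz_ineq[of v w] by (simp add: power2_norm_eq_inner)
  also have "\<dots> < (Re W)\<^sup>2 * (Im W)\<^sup>2"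
    using s t by (intro mult_strict_mono) (auto intro: le_less_trans[OF zero_le_power2])
  finally show False using 2 by (simp add: power_mult_distrib[symmetric])
qed

definition cx_coord :: "'a::euclidean_space \<Rightarrow> 'a \<times> 'a \<Rightarrow> complex" where
  "cx_coord b p = Complex (fst p \<bullet> b) (snd p \<bullet> b)"

text \<open>The bilinear, not the Hermitian, extension of the squared norm; only the former is
  holomorphic. It may vanish or be negative away from real points.\<close>

definition cx_sqnorm :: "'a::euclidean_space \<times> 'a \<Rightarrow> complex" where
  "cx_sqnorm p = (\<Sum>b\<in>Basis. (cx_coord b p)\<^sup>2)"

lemma cx_fun_coord: "cx_fun S (cx_coord b)"
  unfolding cx_coord_def[abs_def] by (rule cx_linear)

lemma cx_fun_sqnorm: "cx_fun S cx_sqnorm"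
  unfolding cx_sqnorm_def[abs_def] by (intro cx_fun_sum cx_fun_power cx_fun_coord) auto

lemma cx_sqnorm_eq:
  "cx_sqnorm p = Complex ((norm (fst p))\<^sup>2 - (norm (snd p))\<^sup>2) (2 * (fst p \<bullet> snd p))"
proof (rule complex_eqI)
  show "Re (cx_sqnorm p) = Re (Complex ((norm (fst p))\<^sup>2 - (norm (snd p))\<^sup>2) (2 * (fst p \<bullet> snd p)))"
    unfolding power2_norm_eq_inner euclidean_inner[of "fst p" "fst p"] euclidean_inner[of "snd p" "snd p"]
    by (simp add: cx_sqnorm_def cx_coord_def Re_power2 sum_subtractf power2_eq_square)
  show "Im (cx_sqnorm p) = Im (Complex ((norm (fst p))\<^sup>2 - (norm (snd p))\<^sup>2) (2 * (fst p \<bullet> snd p)))"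
    by (simp add: cx_sqnorm_def cx_coord_def Im_power2 sum_distrib_left mult.assoc
        euclidean_inner[of "fst p" "snd p"])
qed

lemma cx_sqnorm_real: "cx_sqnorm (v, 0) = of_real ((norm v)\<^sup>2)"
  by (simp add: cx_sqnorm_eq complex_eq_iff)

text \<open>The exponential map at a of the sphere of radius r about the origin. The form with
  \<open>sinc\<close> covers v = 0 and shows that only the square of the length of v enters.\<close>

definition sphere_exp :: "real \<Rightarrow> 'a::euclidean_space \<Rightarrow> 'a \<Rightarrow> 'a" where
  "sphere_exp r a v = cos (norm v / r) *\<^sub>R a + sinc (norm v / r) *\<^sub>R v"

definition cx_sphere_exp :: "real \<Rightarrow> 'a::euclidean_space \<Rightarrow> 'a \<Rightarrow> 'a \<times> 'a \<Rightarrow> complex" where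
  "cx_sphere_exp r a b p = entire_cos (of_real (1 / r\<^sup>2) * cx_sqnorm p) * of_real (a \<bullet> b)
     + entire_sinc (of_real (1 / r\<^sup>2) * cx_sqnorm p) * cx_coord b p"

lemma cx_fun_sphere_exp: "cx_fun S (cx_sphere_exp r a b)"
  unfolding cx_sphere_exp_def[abs_def]
  by (intro cx_add cx_mult cx_const cx_fun_coord cx_fun_sqnorm
      cx_fun_entire[OF _ holomorphic_entire_cos] cx_fun_entire[OF _ holomorphic_entire_sinc])

lemma cx_sphere_exp_real:
  assumes "0 < r"
  shows "cx_sphere_exp r a b (v, 0) = of_real (sphere_exp r a v \<bullet> b)"
proof -
  have q: "of_real (1 / r\<^sup>2) * cx_sqnorm (v, 0) = of_real ((norm v / r)\<^sup>2)"
    by (simp add: cx_sqnorm_real power_divide)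
  have "cx_coord b (v, 0) = of_real (v \<bullet> b)" by (simp add: cx_coord_def complex_eq_iff)
  then show ?thesis
    unfolding cx_sphere_exp_def q entire_cos_of_real entire_sinc_of_real
    by (simp add: sphere_exp_def inner_add_left)
qed

text \<open>On the complexified sphere \<open>Y \<bullet> Y = r\<^sup>2\<close> the real and imaginary parts of \<open>Y\<close> satisfy
  \<open>|Re Y|\<^sup>2 - |Im Y|\<^sup>2 = r\<^sup>2\<close>, so both are controlled by the Hermitian norm of \<open>Y\<close>.\<close>

lemma
  fixes a :: "'a::euclidean_space"
  assumes r: "0 < r" "norm a = r" and perp: "fst p \<bullet> a = 0" "snd p \<bullet> a = 0"
  defines "Y1 \<equiv> \<Sum>b\<in>Basis. Re (cx_sphere_exp r a b p) *\<^sub>R b"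
    and "Y2 \<equiv> \<Sum>b\<in>Basis. Im (cx_sphere_exp r a b p) *\<^sub>R b"
  shows norm_Im_sphere_exp_le: "norm Y2 \<le> norm (snd p) * cosh (norm (snd p) / r)"
    and norm_Re_sphere_exp: "(norm Y1)\<^sup>2 = r\<^sup>2 + (norm Y2)\<^sup>2"
proof -
  define v w where "v = fst p" and "w = snd p"
  define q where "q = of_real (1 / r\<^sup>2) * cx_sqnorm p"
  define W where "W = csqrt q"
  have W: "W\<^sup>2 = q" by (simp add: W_def)
  define C S where "C = entire_cos q" and "S = entire_sinc q"
  define s t \<kappa> where "s = Re W" and "t = Im W" and "\<kappa> = norm w / r"
  have C: "C = cos W" and S: "W * S = sin W"
    unfolding C_def S_def W[symmetric] by (rule entire_cos_square, rule entire_sinc_square)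
  have Y1: "Y1 = Re C *\<^sub>R a + (Re S *\<^sub>R v - Im S *\<^sub>R w)"
    unfolding Y1_def cx_sphere_exp_def q_def[symmetric] C_def[symmetric] S_def[symmetric]
    by (rule euclidean_eqI)
       (simp add: cx_coord_def v_def w_def inner_add_left inner_diff_left)
  have Y2: "Y2 = Im C *\<^sub>R a + (Re S *\<^sub>R w + Im S *\<^sub>R v)"
    unfolding Y2_def cx_sphere_exp_def q_def[symmetric] C_def[symmetric] S_def[symmetric]
    by (rule euclidean_eqI)
       (simp add: cx_coord_def v_def w_def inner_add_left inner_diff_left)
  have perp': "v \<bullet> a = 0" "w \<bullet> a = 0" "a \<bullet> v = 0" "a \<bullet> w = 0"
    using perp by (auto simp: v_def w_def inner_commute)
  have aa: "a \<bullet> a = r\<^sup>2" using r by (simp add: power2_norm_eq_inner[symmetric])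
  have n1: "(norm Y1)\<^sup>2 = (Re C)\<^sup>2 * r\<^sup>2 + (Re S)\<^sup>2 * (v \<bullet> v) + (Im S)\<^sup>2 * (w \<bullet> w) - 2 * Re S * Im S * (v \<bullet> w)"
    unfolding Y1 power2_norm_eq_inner
    by (simp add: inner_add_left inner_add_right inner_diff_left inner_diff_right perp' aa
        inner_commute[of w v]) (simp add: power2_eq_square algebra_simps)
  have n2: "(norm Y2)\<^sup>2 = (Im C)\<^sup>2 * r\<^sup>2 + (Re S)\<^sup>2 * (w \<bullet> w) + (Im S)\<^sup>2 * (v \<bullet> v) + 2 * Re S * Im S * (v \<bullet> w)"
    unfolding Y2 power2_norm_eq_inner
    by (simp add: inner_add_left inner_add_right inner_diff_left inner_diff_right perp' aa
        inner_commute[of w v]) (simp add: power2_eq_square algebra_simps)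
  have q: "Re q * r\<^sup>2 = v \<bullet> v - w \<bullet> w" "Im q * r\<^sup>2 = 2 * (v \<bullet> w)"
    using r by (auto simp: q_def cx_sqnorm_eq v_def w_def power2_norm_eq_inner)
  \<comment> \<open>This is cos^2 + sin^2 = 1 without the root W. Its real part, multiplied by r^2,
    is the real part of Y \<bullet> Y = r^2.\<close>
  have "C\<^sup>2 + q * S\<^sup>2 = 1"
    unfolding W[symmetric] C power_mult_distrib[symmetric] S by simp
  then have "Re (C\<^sup>2 + q * S\<^sup>2) = 1" by simp
  then have "(Re C)\<^sup>2 - (Im C)\<^sup>2 + (Re q * ((Re S)\<^sup>2 - (Im S)\<^sup>2) - Im q * (2 * Re S * Im S)) = 1"
    by (simp add: Re_power2 Im_power2)
  then have "((Re C)\<^sup>2 - (Im C)\<^sup>2 + (Re q * ((Re S)\<^sup>2 - (Im S)\<^sup>2) - Im q * (2 * Re S * Im S))) * r\<^sup>2 = 1 * r\<^sup>2"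
    by (rule arg_cong)
  then have "((Re C)\<^sup>2 - (Im C)\<^sup>2) * r\<^sup>2 + (Re q * r\<^sup>2) * ((Re S)\<^sup>2 - (Im S)\<^sup>2) - (Im q * r\<^sup>2) * (2 * Re S * Im S) = r\<^sup>2"
    by (simp add: algebra_simps)
  then show n12: "(norm Y1)\<^sup>2 = r\<^sup>2 + (norm Y2)\<^sup>2"
    unfolding n1 n2 q by (simp add: algebra_simps)
  have tk: "\<bar>t\<bar> \<le> \<kappa>"
  proof -
    have "(of_real r * W)\<^sup>2 = cx_sqnorm p"
      using r by (simp add: power_mult_distrib W q_def)
    also have "\<dots> = Complex ((norm v)\<^sup>2 - (norm w)\<^sup>2) (2 * (v \<bullet> w))"
      by (simp add: cx_sqnorm_eq v_def w_def)
    finally have "\<bar>Im (of_real r * W)\<bar> \<le> norm w" by (rule abs_Im_sqrt_le)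
    then show ?thesis using r by (simp add: t_def \<kappa>_def abs_mult field_simps)
  qed
  have k0: "0 \<le> \<kappa>" using r by (simp add: \<kappa>_def)
  \<comment> \<open>Twice the square of |Y2| equals the sum of the squares of |Y1| and |Y2| minus
    r^2. In that sum the terms with v \<bullet> w cancel, and only the moduli of C and S
    remain.\<close>
  have "2 * (norm Y2)\<^sup>2 = (cmod C)\<^sup>2 * r\<^sup>2 + (cmod S)\<^sup>2 * (v \<bullet> v + w \<bullet> w) - r\<^sup>2"
    using n12 unfolding n1 n2 cmod_power2 by (simp add: algebra_simps)
  also have "v \<bullet> v + w \<bullet> w = r\<^sup>2 * (s\<^sup>2 - t\<^sup>2 + 2 * \<kappa>\<^sup>2)"
  proof -
    have "Re q = s\<^sup>2 - t\<^sup>2" unfolding W[symmetric] by (simp add: Re_power2 s_def t_def)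
    then have "v \<bullet> v - w \<bullet> w = (s\<^sup>2 - t\<^sup>2) * r\<^sup>2" using q by simp
    moreover have "w \<bullet> w = \<kappa>\<^sup>2 * r\<^sup>2"
      using r by (simp add: \<kappa>_def power_divide power2_norm_eq_inner)
    ultimately show ?thesis by (simp add: algebra_simps)
  qed
  also have "(cmod C)\<^sup>2 * r\<^sup>2 + (cmod S)\<^sup>2 * (r\<^sup>2 * (s\<^sup>2 - t\<^sup>2 + 2 * \<kappa>\<^sup>2)) - r\<^sup>2
      = r\<^sup>2 * ((cmod C)\<^sup>2 + (cmod S)\<^sup>2 * (s\<^sup>2 + t\<^sup>2) - 1 + 2 * (cmod S)\<^sup>2 * (\<kappa>\<^sup>2 - t\<^sup>2))"
    by (simp add: algebra_simps)
  also have "(cmod S)\<^sup>2 * (s\<^sup>2 + t\<^sup>2) = (sin s)\<^sup>2 + (sinh t)\<^sup>2"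
    using cmod_sin_square[of W] unfolding S[symmetric] norm_mult power_mult_distrib s_def t_def
    by (simp add: cmod_power2 mult.commute)
  also have "(cmod C)\<^sup>2 = (cos s)\<^sup>2 + (sinh t)\<^sup>2"
    by (simp add: C cmod_cos_square s_def t_def)
  also have "r\<^sup>2 * ((cos s)\<^sup>2 + (sinh t)\<^sup>2 + ((sin s)\<^sup>2 + (sinh t)\<^sup>2) - 1 + 2 * (cmod S)\<^sup>2 * (\<kappa>\<^sup>2 - t\<^sup>2))
      = 2 * (r\<^sup>2 * ((sinh t)\<^sup>2 + (cmod S)\<^sup>2 * (\<kappa>\<^sup>2 - t\<^sup>2)))"
    by (simp add: cos_squared_eq algebra_simps)
  finally have "(norm Y2)\<^sup>2 = r\<^sup>2 * ((sinh t)\<^sup>2 + (cmod S)\<^sup>2 * (\<kappa>\<^sup>2 - t\<^sup>2))" by simp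
  \<comment> \<open>Since \<kappa>^2 - t^2 \<ge> 0, both sinh t and S may be replaced by their
    bounds in terms of cosh t; the terms with t^2 cancel and leave \<kappa>^2 cosh^2 t.\<close>
  also have "\<dots> \<le> r\<^sup>2 * (t\<^sup>2 * (cosh t)\<^sup>2 + (cosh t)\<^sup>2 * (\<kappa>\<^sup>2 - t\<^sup>2))"
  proof (intro mult_left_mono add_mono mult_right_mono)
    show "(sinh t)\<^sup>2 \<le> t\<^sup>2 * (cosh t)\<^sup>2"
      using sinh_le_mult_cosh[of t] by (simp add: abs_le_square_iff[symmetric] abs_mult power_mult_distrib[symmetric])
    show "(cmod S)\<^sup>2 \<le> (cosh t)\<^sup>2"
      using cmod_entire_sinc_le[of W] by (intro power_mono) (auto simp: S_def W t_def)
    show "0 \<le> \<kappa>\<^sup>2 - t\<^sup>2" using tk k0 by (simp add: abs_le_square_iff[symmetric])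
  qed simp
  also have "\<dots> = (r * \<kappa> * cosh t)\<^sup>2" by (simp add: power_mult_distrib algebra_simps)
  also have "\<dots> \<le> (r * \<kappa> * cosh \<kappa>)\<^sup>2"
    using tk k0 r cosh_real_nonneg_le_iff[of "\<bar>t\<bar>" \<kappa>]
    by (intro power_mono mult_left_mono) auto
  finally have "norm Y2 \<le> r * \<kappa> * cosh \<kappa>"
    by (rule power2_le_imp_le) (use r k0 in auto)
  then show "norm Y2 \<le> norm (snd p) * cosh (norm (snd p) / r)"
    using r by (simp add: \<kappa>_def w_def)
qed

text \<open>A coordinate is bounded by the Hermitian norm, whose square is r^2 plus twice the square
  of |Y2|. As \<kappa> cosh \<kappa> \<le> exp (2 \<kappa>), this is at most 3 r^2 exp (4 \<kappa>),
  and 3 is rounded up to 4.\<close>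

lemma cmod_sphere_exp_le:
  fixes a :: "'a::euclidean_space"
  assumes r: "0 < r" "norm a = r" and perp: "fst p \<bullet> a = 0" "snd p \<bullet> a = 0" and b: "b \<in> Basis"
  shows "cmod (cx_sphere_exp r a b p) \<le> 2 * r * exp (2 * norm (snd p) / r)"
proof -
  define Y1 Y2 where "Y1 = (\<Sum>b\<in>Basis. Re (cx_sphere_exp r a b p) *\<^sub>R b)"
    and "Y2 = (\<Sum>b\<in>Basis. Im (cx_sphere_exp r a b p) *\<^sub>R b)"
  define \<kappa> where "\<kappa> = norm (snd p) / r"
  have k0: "0 \<le> \<kappa>" using r by (simp add: \<kappa>_def)
  have "norm Y2 \<le> r * (\<kappa> * cosh \<kappa>)"
    using norm_Im_sphere_exp_le[OF r perp] r by (simp add: Y2_def \<kappa>_def)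
  also have "\<kappa> * cosh \<kappa> \<le> exp \<kappa> * exp \<kappa>"
    using k0 exp_ge_add_one_self[of \<kappa>] by (intro mult_mono) (auto simp: cosh_def simp del: exp_ge_add_one_self)
  finally have "norm Y2 \<le> r * exp (2 * \<kappa>)" using r by (simp add: exp_double power2_eq_square)
  then have 2: "(norm Y2)\<^sup>2 \<le> r\<^sup>2 * (exp (2 * \<kappa>))\<^sup>2"
    using power_mono[of "norm Y2" "r * exp (2 * \<kappa>)" 2] by (simp add: power_mult_distrib)
  have "(cmod (cx_sphere_exp r a b p))\<^sup>2 = (Y1 \<bullet> b)\<^sup>2 + (Y2 \<bullet> b)\<^sup>2"
    using b by (simp add: cmod_power2 Y1_def Y2_def)
  also have "\<dots> \<le> (norm Y1)\<^sup>2 + (norm Y2)\<^sup>2"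
    using Basis_le_norm[OF b, of Y1] Basis_le_norm[OF b, of Y2]
    by (intro add_mono) (auto simp: abs_le_square_iff[symmetric])
  also have "\<dots> = r\<^sup>2 + 2 * (norm Y2)\<^sup>2"
    using norm_Re_sphere_exp[OF r perp] by (simp add: Y1_def Y2_def)
  also have "\<dots> \<le> r\<^sup>2 * (exp (2 * \<kappa>))\<^sup>2 + 2 * (r\<^sup>2 * (exp (2 * \<kappa>))\<^sup>2)"
    using 2 k0 r by (intro add_mono mult_left_mono) (auto simp: mult_le_cancel_left1)
  also have "\<dots> \<le> (2 * r * exp (2 * \<kappa>))\<^sup>2"
    by (simp add: power_mult_distrib)
  finally have "cmod (cx_sphere_exp r a b p) \<le> 2 * r * exp (2 * \<kappa>)"
    by (rule power2_le_imp_le) (use r in simp)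
  then show ?thesis by (simp add: \<kappa>_def)
qed

section \<open>The complexified bump\<close>

definition cx_bump :: "real \<Rightarrow> nat \<Rightarrow> real \<Rightarrow> 'a::euclidean_space \<Rightarrow> 'a \<Rightarrow> 'a \<times> 'a \<Rightarrow> complex" where
  "cx_bump N m r a \<xi> p = entire_sinc (of_real (N\<^sup>2) *
     (\<Sum>b\<in>Basis. (cx_sphere_exp r a b p + of_real (- (\<xi> \<bullet> b)))\<^sup>2)) ^ (2 * m)"

lemma cx_fun_bump: "cx_fun S (cx_bump N m r a \<xi>)"
  unfolding cx_bump_def[abs_def]
  by (intro cx_fun_power cx_fun_entire[OF _ holomorphic_entire_sinc] cx_mult cx_const
      cx_fun_sum cx_add cx_fun_sphere_exp) auto

lemma cx_bump_real:
  assumes "0 < r"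
  shows "cx_bump N m r a \<xi> (v, 0) = of_real (sinc (N * norm (sphere_exp r a v - \<xi>)) ^ (2 * m))"
proof -
  have "(\<Sum>b\<in>Basis. (cx_sphere_exp r a b (v, 0) + of_real (- (\<xi> \<bullet> b)))\<^sup>2)
      = of_real (\<Sum>b\<in>Basis. ((sphere_exp r a v - \<xi>) \<bullet> b)\<^sup>2)"
    by (simp add: cx_sphere_exp_real[OF assms] inner_diff_left)
  also have "(\<Sum>b\<in>Basis. ((sphere_exp r a v - \<xi>) \<bullet> b)\<^sup>2) = (norm (sphere_exp r a v - \<xi>))\<^sup>2"
    unfolding power2_norm_eq_inner euclidean_inner[of "sphere_exp r a v - \<xi>" "sphere_exp r a v - \<xi>"]
    by (simp add: power2_eq_square)
  finally have "of_real (N\<^sup>2) * (\<Sum>b\<in>Basis. (cx_sphere_exp r a b (v, 0) + of_real (- (\<xi> \<bullet> b)))\<^sup>2)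
      = of_real ((N * norm (sphere_exp r a v - \<xi>))\<^sup>2)"
    by (simp add: power_mult_distrib)
  then show ?thesis unfolding cx_bump_def by (simp only: entire_sinc_of_real of_real_power[of "sinc _"])
qed

text \<open>The complex distance from \<xi> has imaginary part at most that of the point on the
  complexified sphere, and this is at most twice |snd p| as long as |snd p| \<le> r, because cosh 1
  \<le> 2. Each of the 2 m factors then contributes exp (2 N |snd p|).\<close>

lemma cmod_bump_le:
  fixes a :: "'a::euclidean_space"
  assumes r: "0 < r" "norm a = r" and perp: "fst p \<bullet> a = 0" "snd p \<bullet> a = 0"
    and N: "0 \<le> N" and small: "norm (snd p) \<le> r"
  shows "cmod (cx_bump N m r a \<xi> p) \<le> exp (4 * real m * N * norm (snd p))"
proof -
  define Y1 Y2 where "Y1 = (\<Sum>b\<in>Basis. Re (cx_sphere_exp r a b p) *\<^sub>R b)"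
    and "Y2 = (\<Sum>b\<in>Basis. Im (cx_sphere_exp r a b p) *\<^sub>R b)"
  define q where "q = (Y1 - \<xi>, Y2)"
  have "cx_sphere_exp r a b p + of_real (- (\<xi> \<bullet> b)) = cx_coord b q" if "b \<in> Basis" for b
    using that by (simp add: q_def cx_coord_def Y1_def Y2_def inner_diff_left complex_eq_iff)
  then have eq: "cx_bump N m r a \<xi> p = entire_sinc (of_real (N\<^sup>2) * cx_sqnorm q) ^ (2 * m)"
    by (simp add: cx_bump_def cx_sqnorm_def)
  define W where "W = csqrt (of_real (N\<^sup>2) * cx_sqnorm q)"
  have W2: "W\<^sup>2 = of_real (N\<^sup>2) * cx_sqnorm q" by (simp add: W_def)
  have "W\<^sup>2 = Complex ((norm (N *\<^sub>R fst q))\<^sup>2 - (norm (N *\<^sub>R snd q))\<^sup>2) (2 * ((N *\<^sub>R fst q) \<bullet> (N *\<^sub>R snd q)))"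
    unfolding W2 cx_sqnorm_eq
    by (simp add: complex_eq_iff power_mult_distrib algebra_simps power2_eq_square)
  then have "\<bar>Im W\<bar> \<le> norm (N *\<^sub>R snd q)" by (rule abs_Im_sqrt_le)
  also have "\<dots> = N * norm Y2" using N by (simp add: q_def)
  also have "\<dots> \<le> N * (norm (snd p) * 2)"
  proof (intro mult_left_mono N)
    have "cosh (norm (snd p) / r) \<le> cosh 1"
      using r small by (subst cosh_real_nonneg_le_iff) auto
    also have "cosh 1 \<le> (2::real)"
    proof -
      have "exp (- 1) \<le> (1::real)" by simp
      then show ?thesis using exp_le unfolding cosh_field_def by argo
    qed
    finally have "norm (snd p) * cosh (norm (snd p) / r) \<le> norm (snd p) * 2"
      by (intro mult_left_mono) auto
    then show "norm Y2 \<le> norm (snd p) * 2"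
      using norm_Im_sphere_exp_le[OF r perp] unfolding Y2_def by linarith
  qed
  finally have Im: "\<bar>Im W\<bar> \<le> 2 * N * norm (snd p)" by simp
  have "cmod (entire_sinc (W\<^sup>2)) \<le> cosh \<bar>Im W\<bar>"
    using cmod_entire_sinc_le[of W] by simp
  also have "\<dots> \<le> exp \<bar>Im W\<bar>" by (simp add: cosh_def)
  also have "\<dots> \<le> exp (2 * N * norm (snd p))" using Im by simp
  finally have "cmod (entire_sinc (W\<^sup>2)) ^ (2 * m) \<le> exp (2 * N * norm (snd p)) ^ (2 * m)"
    by (intro power_mono) auto
  also have "\<dots> = exp (4 * real m * N * norm (snd p))"
    by (subst exp_of_nat_mult[symmetric]) (simp add: algebra_simps)
  finally show ?thesis unfolding eq W2[symmetric] norm_power .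
qed

section \<open>Geometry of spheres in a coordinate subspace\<close>

definition inversion :: "'a::euclidean_space \<Rightarrow> 'a" where
  "inversion y = (1 / (norm y)\<^sup>2) *\<^sub>R y"

lemma norm_inversion: "norm (inversion y) = 1 / norm y"
  by (simp add: inversion_def power2_eq_square)

lemma inversion_inversion: "inversion (inversion y) = y"
  by (cases "y = 0") (simp_all add: inversion_def power_divide power2_eq_square)

lemma inversion_eq_0: "inversion y = 0 \<longleftrightarrow> y = 0"
  using norm_inversion[of y] by (metis divide_eq_0_iff norm_eq_zero zero_neq_one)

text \<open>Here the domain S of the complexified functions is a proper subset: the reciprocal of
  the bilinear square Q is holomorphic only where Q does not vanish. Among real points, this
  excludes p alone.\<close>

lemma smooth_on_inversion:
  fixes p n :: "'a::euclidean_space"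
  shows "smooth_on (- {p}) (\<lambda>y. inversion (y - p) + n)"
proof -
  define Q :: "'a \<times> 'a \<Rightarrow> complex" where "Q = (\<lambda>x. \<Sum>b\<in>Basis. (cx_coord b x + of_real (- (p \<bullet> b)))\<^sup>2)"
  define S where "S = {x. Q x \<noteq> 0}"
  define F where "F = (\<lambda>b x. inverse (Q x) * (cx_coord b x + of_real (- (p \<bullet> b))) + of_real (n \<bullet> b))"
  have Q: "cx_fun S Q" unfolding Q_def
    by (intro cx_fun_sum cx_fun_power cx_add cx_fun_coord cx_const) auto
  have F: "cx_fun S (F b)" for b unfolding F_def
    by (intro cx_add cx_mult cx_fun_coord cx_const cx_comp[OF Q, of "- {0}" inverse])
       (auto intro!: holomorphic_intros simp: S_def)
  have Qr: "Q (v, 0) = of_real ((norm (v - p))\<^sup>2)" for v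
  proof -
    have "Q (v, 0) = of_real (\<Sum>b\<in>Basis. ((v - p) \<bullet> b)\<^sup>2)"
      by (simp add: Q_def cx_coord_def complex_of_real_def[symmetric] inner_diff_left)
    also have "(\<Sum>b\<in>Basis. ((v - p) \<bullet> b)\<^sup>2) = (norm (v - p))\<^sup>2"
      unfolding power2_norm_eq_inner euclidean_inner[of "v - p" "v - p"]
      by (simp add: power2_eq_square)
    finally show ?thesis .
  qed
  have "cx_represents S (- {p}) (\<lambda>y. inversion (y - p) + n) F"
    unfolding cx_represents_def
  proof (intro conjI ballI F)
    fix v assume v: "v \<in> - {p}"
    then show "(v, 0) \<in> S" by (simp add: S_def Qr)
    have "Re (F b (v, 0)) = (inversion (v - p) + n) \<bullet> b" for b
    proof -
      have "F b (v, 0) = of_real ((inversion (v - p) + n) \<bullet> b)"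
        by (simp add: F_def Qr cx_coord_def complex_of_real_def[symmetric] inversion_def
            inner_add_left inner_diff_left divide_inverse)
      then show ?thesis by simp
    qed
    then show "inversion (v - p) + n = (\<Sum>b\<in>Basis. Re (F b (v, 0)) *\<^sub>R b)"
      by (simp add: euclidean_representation)
  qed
  then show ?thesis by (rule smooth_on_cx) auto
qed

lemma has_vector_derivative_inner:
  assumes "(f has_vector_derivative f') (at t)" "(g has_vector_derivative g') (at t)"
  shows "((\<lambda>s. f s \<bullet> g s) has_real_derivative (f t \<bullet> g' + f' \<bullet> g t)) (at t)"
proof -
  have "((\<lambda>s. f s \<bullet> g s) has_derivative (\<lambda>h. f t \<bullet> (h *\<^sub>R g') + (h *\<^sub>R f') \<bullet> g t)) (at t)"
    using assms unfolding has_vector_derivative_def by (rule has_derivative_inner)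
  moreover have "(\<lambda>h. f t \<bullet> (h *\<^sub>R g') + (h *\<^sub>R f') \<bullet> g t) = (*) (f t \<bullet> g' + f' \<bullet> g t)"
    by (simp add: fun_eq_iff algebra_simps)
  ultimately show ?thesis by (simp add: has_field_derivative_def)
qed

text \<open>Connects the two notions of derivative for curves: smoothness is expressed by
  \<open>frechet_derivative\<close> evaluated at directions, geodesics by
  \<open>vector_derivative\<close>. The direction 1 translates between them.\<close>

lemma smooth_on_UNIV_vector_derivative:
  fixes g :: "real \<Rightarrow> 'a::euclidean_space"
  assumes "smooth_on UNIV g"
  shows "(g has_vector_derivative vector_derivative g (at t)) (at t)"
    and "((\<lambda>s. vector_derivative g (at s)) has_vector_derivative
      vector_derivative (\<lambda>s. vector_derivative g (at s)) (at t)) (at t)"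
proof -
  have td: "times_differentiable_on (Suc (Suc 0)) UNIV UNIV g"
    using assms unfolding smooth_rel_def by blast
  then have 1: "g differentiable at s" for s by (simp add: differentiable_on_def)
  then show "(g has_vector_derivative vector_derivative g (at t)) (at t)"
    by (simp add: vector_derivative_works)
  have eq: "frechet_derivative g (at s) 1 = vector_derivative g (at s)" for s
  proof -
    have "(g has_derivative frechet_derivative g (at s)) (at s)"
      using 1 frechet_derivative_works by blast
    moreover have "(g has_derivative (\<lambda>x. x *\<^sub>R vector_derivative g (at s))) (at s)"
      using 1[of s] by (simp add: vector_derivative_works has_vector_derivative_def)
    ultimately have "frechet_derivative g (at s) = (\<lambda>x. x *\<^sub>R vector_derivative g (at s))"
      by (rule has_derivative_unique)
    then show ?thesis by simp
  qed
  have "(\<lambda>s. frechet_derivative g (at s) 1) differentiable at t"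
    using td by (simp add: differentiable_on_def)
  then show "((\<lambda>s. vector_derivative g (at s)) has_vector_derivative
      vector_derivative (\<lambda>s. vector_derivative g (at s)) (at t)) (at t)"
    unfolding eq by (simp add: vector_derivative_works)
qed

text \<open>Spanning the sphere by d + 1 coordinate vectors makes the orthogonal projection, the
  grids and the boxes explicit. The vector \<open>e0\<close> supplies a pole, which serves for
  inversion and as a known point of the sphere.\<close>

locale subspace_sphere =
  fixes I :: "'a::euclidean_space set" and e0 c :: 'a and r :: real and d :: nat
  assumes I_Basis: "I \<subseteq> Basis" and e0: "e0 \<in> I" and card_I: "card I = Suc d"
    and d: "1 \<le> d" and r: "0 < r"
begin

definition W :: "'a set" where
  "W = {y. \<forall>b\<in>Basis. b \<notin> I \<longrightarrow> y \<bullet> b = 0}"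

definition M :: "'a set" where
  "M = {y. y - c \<in> W \<and> norm (y - c) = r}"

lemma subspace_W: "subspace W"
  by (auto simp: W_def subspace_def inner_add_left)

lemma e0_Basis: "e0 \<in> Basis" using I_Basis e0 by blast

lemma norm_e0 [simp]: "norm e0 = 1" "e0 \<bullet> e0 = 1" using e0_Basis by auto

lemma e0_W: "e0 \<in> W"
  using e0 I_Basis by (auto simp: W_def inner_Basis)

lemma compact_M: "compact M"
proof -
  have "M = (+) c ` (W \<inter> sphere 0 r)"
  proof (intro equalityI subsetI)
    fix y assume "y \<in> M"
    then have "y - c \<in> W \<inter> sphere 0 r" by (auto simp: M_def)
    then have "c + (y - c) \<in> (+) c ` (W \<inter> sphere 0 r)" by (rule imageI)
    then show "y \<in> (+) c ` (W \<inter> sphere 0 r)" by simp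
  qed (auto simp: M_def)
  moreover have "compact (W \<inter> sphere 0 r)"
    using closed_Int_compact[OF closed_subspace[OF subspace_W] compact_sphere] by simp
  ultimately show ?thesis using compact_translation by metis
qed

lemma pole_M: "c + r *\<^sub>R e0 \<in> M"
  using r subspace_scale[OF subspace_W e0_W] by (simp add: M_def)

text \<open>Inversion in a pole of the sphere maps the rest of the sphere onto a hyperplane.\<close>

lemma smooth_submanifold_M: "smooth_submanifold d M"
  unfolding smooth_submanifold_def
proof
  fix z assume z: "z \<in> M"
  \<comment> \<open>The sign selects a pole different from z, so two charts cover the
    sphere.\<close>
  obtain \<sigma> :: real where \<sigma>: "\<sigma>\<^sup>2 = 1" "z \<noteq> c + (\<sigma> * r) *\<^sub>R e0"
  proof (cases "z = c + (1 * r) *\<^sub>R e0")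
    case True
    have "z \<noteq> c + (-1 * r) *\<^sub>R e0"
    proof
      assume "z = c + (-1 * r) *\<^sub>R e0"
      with True have "(1 * r) *\<^sub>R e0 = (-1 * r) *\<^sub>R e0" by (metis add_left_cancel)
      then have "r *\<^sub>R (e0 \<bullet> e0) = - r *\<^sub>R (e0 \<bullet> e0)"
        by (metis inner_scaleR_left mult_1 mult_minus1 real_scaleR_def)
      then show False using r by simp
    qed
    then show ?thesis by (intro that[of "-1"]) auto
  qed (intro that[of 1], auto)
  \<comment> \<open>Inversion at p sends the rest of the sphere to an affine hyperplane of W at
    signed height - \<sigma> / (2 r); the shift by n moves it through the origin, as a chart must
    end in a linear subspace.\<close>
  define p n where "p = c + (\<sigma> * r) *\<^sub>R e0" and "n = (\<sigma> / (2 * r)) *\<^sub>R e0"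
  define H where "H = {v. \<forall>b\<in>Basis. b \<notin> I - {e0} \<longrightarrow> v \<bullet> b = 0}"
  have H: "H = {v \<in> W. v \<bullet> e0 = 0}"
    using e0_Basis by (auto simp: H_def W_def)
  define \<phi> \<psi> where "\<phi> = (\<lambda>y. inversion (y - p) + n)" and "\<psi> = (\<lambda>u. inversion (u - n) + p)"
  have inv: "\<psi> (\<phi> y) = y" "\<phi> (\<psi> y) = y" for y
    by (simp_all add: \<phi>_def \<psi>_def inversion_inversion)
  have ne: "\<phi> y = n \<longleftrightarrow> y = p" "\<psi> y = p \<longleftrightarrow> y = n" for y
    by (simp_all add: \<phi>_def \<psi>_def inversion_eq_0)
  have sm: "smooth_on (- {p}) \<phi>" "smooth_on (- {n}) \<psi>"
    unfolding \<phi>_def \<psi>_def by (rule smooth_on_inversion)+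
  have cont: "continuous_on (- {p}) \<phi>" "continuous_on (- {n}) \<psi>"
    unfolding \<phi>_def \<psi>_def inversion_def by (auto intro!: continuous_intros)
  have imU: "\<phi> ` (- {p}) = - {n}"
  proof (intro equalityI subsetI)
    fix y assume "y \<in> - {n}"
    then have "\<phi> (\<psi> y) \<in> \<phi> ` (- {p})" using ne by auto
    then show "y \<in> \<phi> ` (- {p})" by (simp add: inv)
  qed (use ne in auto)
  have imV: "\<psi> ` (- {n}) = - {p}"
  proof (intro equalityI subsetI)
    fix y assume "y \<in> - {p}"
    then have "\<psi> (\<phi> y) \<in> \<psi> ` (- {n})" using ne by auto
    then show "y \<in> \<psi> ` (- {n})" by (simp add: inv)
  qed (use ne in auto)
  have hom: "homeomorphism (- {p}) (- {n}) \<phi> \<psi>"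
    unfolding homeomorphism_def using inv imU imV cont by auto
  have key: "y \<in> M \<longleftrightarrow> \<phi> y \<in> H" if "y \<noteq> p" for y
  proof -
    define w where "w = y - p"
    have w: "w \<noteq> 0" "0 < (norm w)\<^sup>2" using that by (auto simp: w_def)
    have yc: "y - c = w + (\<sigma> * r) *\<^sub>R e0" by (simp add: w_def p_def)
    have 1: "y - c \<in> W \<longleftrightarrow> w \<in> W"
    proof
      assume "y - c \<in> W"
      then have "(y - c) - (\<sigma> * r) *\<^sub>R e0 \<in> W"
        by (rule subspace_diff[OF subspace_W _ subspace_scale[OF subspace_W e0_W]])
      then show "w \<in> W" by (simp add: yc)
    next
      assume "w \<in> W"
      then show "y - c \<in> W"
        unfolding yc using subspace_W e0_W by (intro subspace_add subspace_scale)
    qed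
    have 2: "\<phi> y \<in> W \<longleftrightarrow> w \<in> W"
    proof
      assume "w \<in> W" then show "\<phi> y \<in> W"
        unfolding \<phi>_def inversion_def n_def w_def[symmetric]
        using subspace_W e0_W by (intro subspace_add subspace_scale)
    next
      assume "\<phi> y \<in> W"
      then have "(norm w)\<^sup>2 *\<^sub>R (\<phi> y - n) \<in> W"
        unfolding n_def using subspace_W e0_W by (intro subspace_diff subspace_scale)
      then show "w \<in> W" using w by (simp add: \<phi>_def inversion_def w_def[symmetric])
    qed
    have "(norm (y - c))\<^sup>2 = (norm w)\<^sup>2 + 2 * (\<sigma> * r) * (w \<bullet> e0) + r\<^sup>2"
      unfolding yc power2_norm_eq_inner using \<sigma>(1)
      by (simp add: inner_add_left inner_add_right inner_commute power2_eq_square algebra_simps)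
    moreover have "norm (y - c) = r \<longleftrightarrow> (norm (y - c))\<^sup>2 = r\<^sup>2" using r by simp
    ultimately have 3: "norm (y - c) = r \<longleftrightarrow> (norm w)\<^sup>2 + 2 * \<sigma> * r * (w \<bullet> e0) = 0"
      by (simp add: mult.assoc)
    have "\<phi> y \<bullet> e0 = (w \<bullet> e0) / (norm w)\<^sup>2 + \<sigma> / (2 * r)"
      by (simp add: \<phi>_def inversion_def n_def w_def[symmetric] inner_add_left)
    also have "\<dots> = \<sigma> * ((norm w)\<^sup>2 + 2 * \<sigma> * r * (w \<bullet> e0)) / (2 * r * (norm w)\<^sup>2)"
      using w r \<sigma>(1) by (simp add: field_simps power2_eq_square)
    finally have 4: "\<phi> y \<bullet> e0 = 0 \<longleftrightarrow> (norm w)\<^sup>2 + 2 * \<sigma> * r * (w \<bullet> e0) = 0"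
      using w r \<sigma>(1) by auto
    show ?thesis unfolding M_def H using 1 2 3 4 by simp
  qed
  have im: "\<phi> ` (M \<inter> - {p}) = H \<inter> - {n}"
  proof (intro equalityI subsetI)
    fix u assume u: "u \<in> H \<inter> - {n}"
    then have "\<psi> u \<noteq> p" using ne by auto
    then have "\<psi> u \<in> M" using key[of "\<psi> u"] u inv by auto
    then have "\<phi> (\<psi> u) \<in> \<phi> ` (M \<inter> - {p})" using \<open>\<psi> u \<noteq> p\<close> by blast
    then show "u \<in> \<phi> ` (M \<inter> - {p})" by (simp add: inv)
  qed (use key ne in auto)
  have sub: "subspace H" unfolding H using subspace_W
    by (auto simp: subspace_def inner_add_left)
  have "dim H = card (I - {e0})"
    unfolding H_def using I_Basis by (intro dim_substandard) auto
  also have "\<dots> = d" using card_I e0 by (simp add: card_Diff_singleton)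
  finally have dim: "dim H = d" .
  have "z \<in> - {p}" using \<sigma>(2) by (simp add: p_def)
  then have "open (- {p}) \<and> z \<in> - {p} \<and> open (- {n}) \<and>
        homeomorphism (- {p}) (- {n}) \<phi> \<psi> \<and> smooth_on (- {p}) \<phi> \<and> smooth_on (- {n}) \<psi> \<and>
        subspace H \<and> dim H = d \<and> \<phi> ` (M \<inter> - {p}) = H \<inter> - {n}"
    using hom sm sub dim im by auto
  then show "\<exists>U V \<phi> \<psi> H. open U \<and> z \<in> U \<and> open (V :: 'a set) \<and>
        homeomorphism U V \<phi> \<psi> \<and> smooth_on U \<phi> \<and> smooth_on V \<psi> \<and>
        subspace H \<and> dim H = d \<and> \<phi> ` (M \<inter> U) = H \<inter> V"
    by (rule_tac x = "- {p}" in exI, rule_tac x = "- {n}" in exI, rule_tac x = \<phi> in exI,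
        rule_tac x = \<psi> in exI, rule_tac x = H in exI)
qed

section \<open>Geodesics and the exponential map of the sphere\<close>

definition great_circle :: "'a \<Rightarrow> 'a \<Rightarrow> real \<Rightarrow> 'a" where
  "great_circle a v t = c + cos (norm v / r * t) *\<^sub>R a + (sin (norm v / r * t) / (norm v / r)) *\<^sub>R v"

lemma smooth_great_circle: "open U \<Longrightarrow> smooth_on U (great_circle a v)"
proof -
  assume "open U"
  define F :: "'a \<Rightarrow> real \<times> real \<Rightarrow> complex" where
    "F = (\<lambda>b p. of_real (c \<bullet> b) + cos (of_real (norm v / r) * cx_coord 1 p) * of_real (a \<bullet> b)
       + sin (of_real (norm v / r) * cx_coord 1 p) * of_real ((v \<bullet> b) / (norm v / r)))"
  have "cx_fun UNIV (F b)" for b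
    unfolding F_def
    by (intro cx_add cx_mult cx_const cx_fun_coord cx_fun_entire[of _ _ cos] cx_fun_entire[of _ _ sin])
       (auto intro!: holomorphic_intros)
  moreover have "Re (F b (t, 0)) = great_circle a v t \<bullet> b" for b t
  proof -
    have "F b (t, 0) = of_real (great_circle a v t \<bullet> b)"
      by (simp add: F_def great_circle_def cx_coord_def complex_of_real_def[symmetric]
          inner_add_left cos_of_real[symmetric] sin_of_real[symmetric])
    then show ?thesis by simp
  qed
  ultimately have "cx_represents UNIV U (great_circle a v) F"
    by (simp add: cx_represents_def euclidean_representation)
  then show ?thesis using \<open>open U\<close> by (rule smooth_on_cx)
qed

lemma great_circle_derivatives:
  shows "(great_circle a v has_vector_derivative
      (- (norm v / r) * sin (norm v / r * t)) *\<^sub>R a + cos (norm v / r * t) *\<^sub>R v) (at t)"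
    and "((\<lambda>t. (- (norm v / r) * sin (norm v / r * t)) *\<^sub>R a + cos (norm v / r * t) *\<^sub>R v)
      has_vector_derivative - (norm v / r)\<^sup>2 *\<^sub>R (great_circle a v t - c)) (at t)"
proof -
  define \<kappa> where "\<kappa> = norm v / r"
  \<comment> \<open>If \<kappa> = 0, the quotient in \<open>great_circle\<close> is a division by
    zero with value 0; as it multiplies v = 0, the curve is the constant one it should be.\<close>
  have v0: "v = 0" if "\<kappa> = 0" using that r by (simp add: \<kappa>_def)
  have "((\<lambda>t. c + cos (\<kappa> * t) *\<^sub>R a + (sin (\<kappa> * t) / \<kappa>) *\<^sub>R v) has_vector_derivative
      ((- sin (\<kappa> * t) * \<kappa>) *\<^sub>R a + (cos (\<kappa> * t) * \<kappa> / \<kappa>) *\<^sub>R v)) (at t)"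
    by (auto intro!: derivative_eq_intros simp: has_vector_derivative_def algebra_simps)
  then show "(great_circle a v has_vector_derivative
      (- (norm v / r) * sin (norm v / r * t)) *\<^sub>R a + cos (norm v / r * t) *\<^sub>R v) (at t)"
    unfolding great_circle_def[abs_def] \<kappa>_def[symmetric]
    using v0 by (cases "\<kappa> = 0") (auto simp: mult.commute)
  have "((\<lambda>t. (- \<kappa> * sin (\<kappa> * t)) *\<^sub>R a + cos (\<kappa> * t) *\<^sub>R v) has_vector_derivative
      ((- \<kappa> * (cos (\<kappa> * t) * \<kappa>)) *\<^sub>R a + (- sin (\<kappa> * t) * \<kappa>) *\<^sub>R v)) (at t)"
    by (auto intro!: derivative_eq_intros simp: has_vector_derivative_def algebra_simps)
  moreover have "- \<kappa>\<^sup>2 *\<^sub>R (great_circle a v t - c) =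
      (- \<kappa> * (cos (\<kappa> * t) * \<kappa>)) *\<^sub>R a + (- sin (\<kappa> * t) * \<kappa>) *\<^sub>R v"
    unfolding great_circle_def \<kappa>_def[symmetric] using v0
    by (cases "\<kappa> = 0") (auto simp: algebra_simps power2_eq_square)
  ultimately show "((\<lambda>t. (- (norm v / r) * sin (norm v / r * t)) *\<^sub>R a + cos (norm v / r * t) *\<^sub>R v)
      has_vector_derivative - (norm v / r)\<^sup>2 *\<^sub>R (great_circle a v t - c)) (at t)"
    unfolding \<kappa>_def[symmetric] by simp
qed

lemma great_circle_0: "great_circle a v 0 = c + a"
  by (simp add: great_circle_def)

lemma great_circle_1: "great_circle a v 1 = c + sphere_exp r a v"
  using r by (cases "v = 0") (simp_all add: great_circle_def sphere_exp_def)

lemma great_circle_in_M: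
  assumes a: "a \<in> W" "norm a = r" and v: "v \<in> W" "v \<bullet> a = 0"
  shows "great_circle a v t \<in> M"
proof -
  define \<kappa> where "\<kappa> = norm v / r"
  have eq: "great_circle a v t - c = cos (\<kappa> * t) *\<^sub>R a + (sin (\<kappa> * t) / \<kappa>) *\<^sub>R v"
    by (simp add: great_circle_def \<kappa>_def)
  have "(norm (great_circle a v t - c))\<^sup>2 = (cos (\<kappa> * t))\<^sup>2 * r\<^sup>2 + (sin (\<kappa> * t) / \<kappa>)\<^sup>2 * (norm v)\<^sup>2"
    using v(2) a(2)[symmetric] unfolding eq power2_norm_eq_inner
    by (simp add: inner_add_left inner_add_right inner_commute[of a v] power2_norm_eq_inner)
      (simp add: power2_eq_square mult.assoc)
  also have "\<dots> = r\<^sup>2"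
  proof (cases "v = 0")
    case False
    then have "(sin (\<kappa> * t) / \<kappa>)\<^sup>2 * (norm v)\<^sup>2 = (sin (\<kappa> * t))\<^sup>2 * r\<^sup>2"
      using r by (simp add: \<kappa>_def power_divide field_simps)
    then show ?thesis by (simp add: sin_squared_eq algebra_simps)
  qed (simp add: \<kappa>_def)
  finally have "norm (great_circle a v t - c) = r" using r by simp
  moreover have "great_circle a v t - c \<in> W"
    unfolding eq using a v subspace_W by (intro subspace_add subspace_scale) auto
  ultimately show ?thesis by (simp add: M_def)
qed

text \<open>The equations that define the sphere are constant along the curve; their derivatives say
  that the velocity lies in W and is orthogonal to the radius.\<close>

lemma curve_in_M_derivative:
  assumes D: "(g has_vector_derivative v) (at t)" and S: "open S" "t \<in> S" "g ` S \<subseteq> M"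
  shows "v \<in> W" "v \<bullet> (g t - c) = 0"
proof -
  have D': "((\<lambda>s. g s - c) has_vector_derivative v) (at t)"
    using has_vector_derivative_diff[OF D has_vector_derivative_const[of c]] by simp
  have zero: "f' = 0" if f: "(f has_real_derivative f') (at t)" and "\<And>s. s \<in> S \<Longrightarrow> f s = k" for f f' k
  proof -
    have "((\<lambda>_. k) has_real_derivative f') (at t)"
      by (rule has_field_derivative_transform_within_open[OF f S(1,2)]) (use that in auto)
    then show ?thesis using DERIV_const DERIV_unique by blast
  qed
  show "v \<in> W" unfolding W_def
  proof (intro CollectI ballI impI)
    fix b :: 'a assume b: "b \<in> Basis" "b \<notin> I"
    have "((\<lambda>s. (g s - c) \<bullet> b) has_real_derivative (g t - c) \<bullet> 0 + v \<bullet> b) (at t)"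
      by (rule has_vector_derivative_inner[OF D' has_vector_derivative_const])
    moreover have "(g s - c) \<bullet> b = 0" if "s \<in> S" for s
      using S(3) that b by (auto simp: M_def W_def)
    ultimately have "(g t - c) \<bullet> 0 + v \<bullet> b = 0" by (rule zero)
    then show "v \<bullet> b = 0" by simp
  qed
  have "(g s - c) \<bullet> (g s - c) = r\<^sup>2" if "s \<in> S" for s
    using S(3) that by (auto simp: M_def power2_norm_eq_inner[symmetric])
  from zero[OF has_vector_derivative_inner[OF D' D'] this]
  show "v \<bullet> (g t - c) = 0" by (simp add: inner_commute)
qed

lemma tangent_space_M:
  assumes z: "z \<in> M"
  shows "tangent_space M z = {v \<in> W. v \<bullet> (z - c) = 0}"
proof (intro equalityI subsetI)
  fix v assume "v \<in> tangent_space M z"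
  then obtain g e where g: "0 < e" "g ` {-e<..<e} \<subseteq> M" "g (0::real) = z"
      "(g has_vector_derivative v) (at 0)"
    by (auto simp: tangent_space_def)
  then show "v \<in> {v \<in> W. v \<bullet> (z - c) = 0}"
    using curve_in_M_derivative[OF g(4), of "{-e<..<e}"] by auto
next
  fix v assume v: "v \<in> {v \<in> W. v \<bullet> (z - c) = 0}"
  have "range (great_circle (z - c) v) \<subseteq> M"
    using great_circle_in_M[of "z - c" v] z v by (auto simp: M_def)
  moreover have "(great_circle (z - c) v has_vector_derivative v) (at 0)"
    using great_circle_derivatives(1)[of "z - c" v 0] by simp
  moreover have "smooth_on {-1<..<1} (great_circle (z - c) v)"
    by (rule smooth_great_circle) simp
  moreover have "great_circle (z - c) v 0 = z" by (simp add: great_circle_0)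
  ultimately show "v \<in> tangent_space M z"
    unfolding tangent_space_def
    by (intro CollectI exI[of _ "great_circle (z - c) v"] exI[of _ 1]) auto
qed

lemma subspace_tangent_space: "z \<in> M \<Longrightarrow> subspace (tangent_space M z)"
  using subspace_W by (auto simp: tangent_space_M subspace_def inner_add_left)

lemma vector_derivative_great_circle:
  "vector_derivative (great_circle a v) (at t) =
    (- (norm v / r) * sin (norm v / r * t)) *\<^sub>R a + cos (norm v / r * t) *\<^sub>R v"
  by (rule vector_derivative_at[OF great_circle_derivatives(1)])

lemma geodesic_great_circle:
  assumes z: "z \<in> M" and v: "v \<in> tangent_space M z"
  shows "geodesic M (great_circle (z - c) v)"
  unfolding geodesic_def
proof (intro conjI allI ballI)
  show "smooth_on UNIV (great_circle (z - c) v)" by (rule smooth_great_circle) simp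
  have in_M: "great_circle (z - c) v t \<in> M" for t
    by (rule great_circle_in_M) (use z v tangent_space_M[OF z] in \<open>auto simp: M_def\<close>)
  then show "range (great_circle (z - c) v) \<subseteq> M" by blast
  fix t w assume w: "w \<in> tangent_space M (great_circle (z - c) v t)"
  have "vector_derivative (\<lambda>s. vector_derivative (great_circle (z - c) v) (at s)) (at t)
     = - (norm v / r)\<^sup>2 *\<^sub>R (great_circle (z - c) v t - c)"
    unfolding vector_derivative_great_circle
    by (rule vector_derivative_at[OF great_circle_derivatives(2)])
  then show "vector_derivative (\<lambda>s. vector_derivative (great_circle (z - c) v) (at s)) (at t) \<bullet> w = 0"
    using w by (simp add: tangent_space_M[OF in_M] inner_commute)
qed

text \<open>On a sphere the geodesic equation becomes linear. The acceleration is a multiple of the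
  radius, differentiating the orthogonality of velocity and radius fixes the factor, and constancy
  of the speed turns the equation into that of a harmonic oscillator about c. Uniqueness for the
  latter follows from conservation of energy.\<close>

lemma geodesic_unique:
  assumes g: "geodesic M g"
  shows "g t = great_circle (g 0 - c) (vector_derivative g (at 0)) t"
proof -
  define p q where "p = (\<lambda>t. vector_derivative g (at t))" and "q = (\<lambda>t. vector_derivative p (at t))"
  define v \<kappa> where "v = p 0" and "\<kappa> = norm v / r"
  note sm = smooth_on_UNIV_vector_derivative[of g]
  have gp: "(g has_vector_derivative p t) (at t)" for t
    using sm(1) g by (simp add: geodesic_def p_def)
  have up: "((\<lambda>t. g t - c) has_vector_derivative p t) (at t)" for t
    using has_vector_derivative_diff[OF gp has_vector_derivative_const[of c]] by simp
  have pq: "(p has_vector_derivative q t) (at t)" for t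
    using sm(2) g by (simp add: geodesic_def p_def q_def)
  have in_M: "g t \<in> M" for t using g by (auto simp: geodesic_def)
  have pW: "p t \<in> W" and pu: "p t \<bullet> (g t - c) = 0" for t
    using curve_in_M_derivative[OF gp, of UNIV t] in_M by auto
  have uu: "(g t - c) \<bullet> (g t - c) = r\<^sup>2" and uW: "g t - c \<in> W" for t
    using in_M[of t] by (auto simp: M_def power2_norm_eq_inner[symmetric])
  have qW: "q t \<in> W" for t unfolding W_def
  proof (intro CollectI ballI impI)
    fix b :: 'a assume b: "b \<in> Basis" "b \<notin> I"
    have "((\<lambda>s. p s \<bullet> b) has_real_derivative p t \<bullet> 0 + q t \<bullet> b) (at t)"
      by (rule has_vector_derivative_inner[OF pq has_vector_derivative_const])
    moreover have "(\<lambda>s. p s \<bullet> b) = (\<lambda>_. 0)" using pW b by (auto simp: W_def)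
    ultimately show "q t \<bullet> b = 0" using DERIV_unique[OF _ DERIV_const] by fastforce
  qed
  have qu: "q t \<bullet> (g t - c) = - (p t \<bullet> p t)" for t
  proof -
    have "((\<lambda>s. p s \<bullet> (g s - c)) has_real_derivative p t \<bullet> p t + q t \<bullet> (g t - c)) (at t)"
      by (rule has_vector_derivative_inner[OF pq up])
    then have "p t \<bullet> p t + q t \<bullet> (g t - c) = 0"
      unfolding pu using DERIV_unique DERIV_const by blast
    then show ?thesis by simp
  qed
  have q: "q t = - ((p t \<bullet> p t) / r\<^sup>2) *\<^sub>R (g t - c)" for t
  proof -
    \<comment> \<open>The tangential part of the acceleration: it is orthogonal to the radius, hence
      tangent, hence orthogonal to the acceleration by the geodesic equation, and so orthogonal to
      itself.\<close>
    define h where "h = q t + ((p t \<bullet> p t) / r\<^sup>2) *\<^sub>R (g t - c)"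
    have hu: "h \<bullet> (g t - c) = 0"
      using r by (simp add: h_def inner_add_left qu uu)
    moreover have "h \<in> W"
      unfolding h_def using subspace_W qW uW by (intro subspace_add subspace_scale)
    ultimately have "h \<in> tangent_space M (g t)" by (simp add: tangent_space_M[OF in_M])
    then have "q t \<bullet> h = 0" using g by (simp add: geodesic_def q_def p_def)
    then have "h \<bullet> h = 0"
      using hu by (subst (2) h_def) (simp add: inner_add_right inner_commute)
    then show ?thesis by (simp add: h_def eq_neg_iff_add_eq_0)
  qed
  have "((\<lambda>t. p t \<bullet> p t) has_real_derivative 0) (at t)" for t
  proof -
    have "p t \<bullet> q t + q t \<bullet> p t = 0"
      by (subst (1 2) q) (use pu[of t] in \<open>simp add: inner_commute\<close>)
    then show ?thesis using has_vector_derivative_inner[OF pq[of t] pq[of t]] by simp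
  qed
  then have "p t \<bullet> p t = v \<bullet> v" for t
    unfolding v_def by (intro DERIV_isconst_all) auto
  then have q': "q t = - \<kappa>\<^sup>2 *\<^sub>R (g t - c)" for t
    using q[of t] by (simp add: \<kappa>_def power_divide power2_norm_eq_inner)
  define G G' where "G = great_circle (g 0 - c) v"
    and "G' = (\<lambda>t. (- \<kappa> * sin (\<kappa> * t)) *\<^sub>R (g 0 - c) + cos (\<kappa> * t) *\<^sub>R v)"
  have GG': "(G has_vector_derivative G' t) (at t)" for t
    unfolding G_def G'_def \<kappa>_def by (rule great_circle_derivatives(1))
  have G'': "(G' has_vector_derivative - \<kappa>\<^sup>2 *\<^sub>R (G t - c)) (at t)" for t
    unfolding G_def G'_def \<kappa>_def by (rule great_circle_derivatives(2))
  define e e' where "e = (\<lambda>t. g t - G t)" and "e' = (\<lambda>t. p t - G' t)"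
  have e: "(e has_vector_derivative e' t) (at t)" for t
    unfolding e_def e'_def by (rule has_vector_derivative_diff[OF gp GG'])
  have e': "(e' has_vector_derivative - \<kappa>\<^sup>2 *\<^sub>R e t) (at t)" for t
    using has_vector_derivative_diff[OF pq G'', of t] unfolding e_def e'_def q'
    by (simp add: algebra_simps)
  \<comment> \<open>The energy of the difference from the great circle, which vanishes at time
    0.\<close>
  have "((\<lambda>t. e' t \<bullet> e' t + \<kappa>\<^sup>2 * (e t \<bullet> e t)) has_real_derivative 0) (at t)" for t
    using DERIV_add[OF has_vector_derivative_inner[OF e' e', of t]
        DERIV_cmult[OF has_vector_derivative_inner[OF e e, of t], of "\<kappa>\<^sup>2"]]
    by (simp add: inner_commute algebra_simps)
  then have "e' t \<bullet> e' t + \<kappa>\<^sup>2 * (e t \<bullet> e t) = e' 0 \<bullet> e' 0 + \<kappa>\<^sup>2 * (e 0 \<bullet> e 0)" for t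
    by (intro DERIV_isconst_all) auto
  moreover have e0: "e 0 = 0" "e' 0 = 0"
    by (simp_all add: e_def G_def great_circle_0 e'_def G'_def v_def)
  ultimately have "e' t \<bullet> e' t + \<kappa>\<^sup>2 * (e t \<bullet> e t) = 0" for t by simp
  moreover have "0 \<le> \<kappa>\<^sup>2 * (e t \<bullet> e t)" "0 \<le> e' t \<bullet> e' t" for t by simp_all
  ultimately have "e' t \<bullet> e' t = 0" for t by (metis add_nonneg_eq_0_iff)
  then have "e' t = 0" for t by simp
  \<comment> \<open>For \<kappa> = 0 the energy controls only the velocity, so e itself is recovered
    as a constant with initial value 0; this covers all \<kappa> at once.\<close>
  then have "((\<lambda>t. e t \<bullet> e t) has_real_derivative 0) (at t)" for t
    using has_vector_derivative_inner[OF e e, of t] by simp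
  then have "e t \<bullet> e t = e 0 \<bullet> e 0" by (intro DERIV_isconst_all) auto
  then show ?thesis using e0 by (simp add: e_def G_def v_def p_def)
qed

text \<open>The definite description is met because the great circle is the only geodesic with the
  given initial data.\<close>

lemma exp_map_M:
  assumes z: "z \<in> M" and v: "v \<in> tangent_space M z"
  shows "exp_map M z v = c + sphere_exp r (z - c) v"
  unfolding exp_map_def
proof (rule the_equality)
  show "\<exists>g. geodesic M g \<and> g 0 = z \<and> vector_derivative g (at 0) = v \<and> g 1 = c + sphere_exp r (z - c) v"
    using geodesic_great_circle[OF z v]
    by (intro exI[of _ "great_circle (z - c) v"])
       (simp add: great_circle_0 great_circle_1 vector_derivative_great_circle)
next
  fix y assume "\<exists>g. geodesic M g \<and> g 0 = z \<and> vector_derivative g (at 0) = v \<and> g 1 = y"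
  then obtain g where "geodesic M g" "g 0 = z" "vector_derivative g (at 0) = v" "g 1 = y" by blast
  then show "y = c + sphere_exp r (z - c) v"
    using geodesic_unique[of g 1] by (simp add: great_circle_1)
qed

text \<open>Split y - c into its part a in W and a part b orthogonal to W. The squared distance to z
  on the sphere depends on z only through a \<bullet> (z - c), so for nonzero a the equality case of
  Cauchy-Schwarz singles out the nearest point. The case a = 0 occurs only at distance at least r >
  \<tau>.\<close>

lemma reach_M:
  assumes "0 \<le> \<tau>" "\<tau> < r"
  shows "ereal \<tau> \<le> reach M"
  unfolding reach_def
proof (rule SUP_upper, intro CollectI conjI allI impI \<open>0 \<le> \<tau>\<close>)
  fix y assume y: "infdist y M \<le> \<tau>"
  obtain z0 where z0: "z0 \<in> M" "infdist y M = dist y z0"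
    using infdist_attains_inf[OF compact_imp_closed[OF compact_M], of y] pole_M by auto
  define a b where "a = (\<Sum>i\<in>I. ((y - c) \<bullet> i) *\<^sub>R i)" and "b = (y - c) - a"
  have finI: "finite I" using I_Basis finite_subset finite_Basis by blast
  have ab: "a \<bullet> i = (if i \<in> I then (y - c) \<bullet> i else 0)" if "i \<in> Basis" for i
  proof -
    have "a \<bullet> i = (\<Sum>j\<in>I. if j = i then (y - c) \<bullet> i else 0)"
      unfolding a_def inner_sum_left using I_Basis that
      by (intro sum.cong) (auto simp: inner_Basis)
    then show ?thesis using finI by simp
  qed
  then have aW: "a \<in> W" by (simp add: W_def)
  have bW: "b \<bullet> w = 0" if "w \<in> W" for w
    unfolding euclidean_inner[of b w]
    by (rule sum.neutral) (use that ab in \<open>auto simp: W_def b_def inner_diff_left\<close>)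
  have dist: "(dist y z)\<^sup>2 = norm b ^ 2 + norm a ^ 2 + r\<^sup>2 - 2 * (a \<bullet> (z - c))" if z: "z \<in> M" for z
  proof -
    have zW: "z - c \<in> W" "(z - c) \<bullet> (z - c) = r\<^sup>2"
      using z by (auto simp: M_def power2_norm_eq_inner[symmetric])
    have "y - z = b + (a - (z - c))" by (simp add: b_def)
    then show ?thesis
      using bW[OF aW] bW[OF zW(1)] zW(2) unfolding dist_norm power2_norm_eq_inner
      by (simp add: inner_add_left inner_add_right inner_diff_left inner_diff_right inner_commute)
  qed
  have a0: "a \<noteq> 0"
  proof
    assume "a = 0"
    then have "r\<^sup>2 \<le> (dist y z0)\<^sup>2" using dist[OF z0(1)] by simp
    then have "r \<le> dist y z0" using zero_le_dist by (rule power2_le_imp_le)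
    then show False using y z0 assms by simp
  qed
  have "z = c + (r / norm a) *\<^sub>R a" if z: "z \<in> M" "infdist y M = dist y z" for z
  proof -
    let ?p = "c + (r / norm a) *\<^sub>R a"
    have pM: "?p \<in> M" using aW a0 r subspace_scale[OF subspace_W aW] by (simp add: M_def)
    then have "dist y z \<le> dist y ?p" using z infdist_le by metis
    then have "(dist y z)\<^sup>2 \<le> (dist y ?p)\<^sup>2" by (intro power_mono) auto
    then have "a \<bullet> ((r / norm a) *\<^sub>R a) \<le> a \<bullet> (z - c)" using dist[OF z(1)] dist[OF pM] by simp
    moreover have "a \<bullet> ((r / norm a) *\<^sub>R a) = norm a * r"
      using a0 by (simp add: power2_norm_eq_inner[symmetric] power2_eq_square)
    moreover have nz: "norm (z - c) = r" using z by (simp add: M_def)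
    ultimately have "norm a * norm (z - c) \<le> a \<bullet> (z - c)" by simp
    then have "a \<bullet> (z - c) = norm a * norm (z - c)"
      using norm_cauchy_schwarz[of a "z - c"] by simp
    then have "norm a *\<^sub>R (z - c) = r *\<^sub>R a" using norm_cauchy_schwarz_eq nz by metis
    then have "inverse (norm a) *\<^sub>R (norm a *\<^sub>R (z - c)) = inverse (norm a) *\<^sub>R (r *\<^sub>R a)" by simp
    then have "z - c = (r / norm a) *\<^sub>R a" using a0 by (simp add: divide_inverse mult.commute)
    then show ?thesis by (simp add: algebra_simps)
  qed
  then show "\<exists>!z. z \<in> M \<and> infdist y M = dist y z" using z0 by metis
qed

end

section \<open>Hausdorff measure\<close>

lemma sum_double: "(\<Sum>k<2 * n. f k) = (\<Sum>k<n. f (2 * k)) + (\<Sum>k<n. f (2 * k + 1))"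
  for f :: "nat \<Rightarrow> 'a::comm_monoid_add"
  by (induction n) (simp_all add: ac_simps)

lemma infdist_diff_le: "infdist x C - infdist y C \<le> dist x y"
  using infdist_triangle[of x C y] by simp

locale metric_outer_measure =
  fixes \<mu> :: "'a::metric_space set \<Rightarrow> ennreal"
  assumes empty: "\<mu> {} = 0"
    and mono: "A \<subseteq> B \<Longrightarrow> \<mu> A \<le> \<mu> B"
    and subadditive: "\<mu> (\<Union>i. S i) \<le> (\<Sum>i::nat. \<mu> (S i))"
    and separated: "0 < \<eta> \<Longrightarrow> (\<And>x y. x \<in> A \<Longrightarrow> y \<in> B \<Longrightarrow> \<eta> \<le> dist x y) \<Longrightarrow> \<mu> A + \<mu> B \<le> \<mu> (A \<union> B)"
begin

lemma subadditive_Un: "\<mu> (A \<union> B) \<le> \<mu> A + \<mu> B"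
proof -
  have "\<mu> (\<Union>i. binaryset A B i) \<le> (\<Sum>i. \<mu> (binaryset A B i))" by (rule subadditive)
  also have "\<dots> = \<mu> A + \<mu> B" using empty by (rule suminf_binaryset_eq)
  finally show ?thesis by (simp add: UN_binaryset_eq)
qed

lemma subadditive_finite_UN:
  "finite T \<Longrightarrow> \<mu> (\<Union>t\<in>T. A t) \<le> (\<Sum>t\<in>T. \<mu> (A t))"
proof (induction T rule: finite_induct)
  case (insert t T)
  have "\<mu> (\<Union>t\<in>insert t T. A t) \<le> \<mu> (A t) + \<mu> (\<Union>t\<in>T. A t)"
    using subadditive_Un by simp
  also have "\<dots> \<le> (\<Sum>t\<in>insert t T. \<mu> (A t))" using insert by (simp add: add_left_mono)
  finally show ?case .
qed (simp add: empty)

text \<open>The gap may shrink with n, since each step splits off only the last of finitely many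
  sets.\<close>

lemma sum_separated_le:
  assumes "\<And>n::nat. \<exists>\<eta>>0. \<forall>j<n. \<forall>x\<in>B j. \<forall>y\<in>B n. \<eta> \<le> dist x y"
  shows "(\<Sum>k<n. \<mu> (B k)) \<le> \<mu> (\<Union>k<n. B k)"
proof (induction n)
  case (Suc n)
  obtain \<eta> where \<eta>: "0 < \<eta>" "\<forall>j<n. \<forall>x\<in>B j. \<forall>y\<in>B n. \<eta> \<le> dist x y" using assms by blast
  have "(\<Sum>k<Suc n. \<mu> (B k)) \<le> \<mu> (\<Union>k<n. B k) + \<mu> (B n)"
    using Suc by (simp add: add_right_mono)
  also have "\<dots> \<le> \<mu> ((\<Union>k<n. B k) \<union> B n)" using \<eta> by (intro separated) auto
  also have "(\<Union>k<n. B k) \<union> B n = (\<Union>k<Suc n. B k)" by (auto simp: lessThan_Suc)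
  finally show ?case .
qed (simp add: empty)

text \<open>Near C separation is lost, so X - C is exhausted by the sets \<open>A n\<close> at
  distance at least 1 / (n + 1). The remainder is a union of rings \<open>R k\<close>. Rings whose
  indices have the same parity are separated, so the measures of all rings sum to at most twice that
  of X, and the tail beyond n tends to 0.\<close>

lemma closed_caratheodory:
  assumes C: "closed C"
  shows "\<mu> (X \<inter> C) + \<mu> (X - C) \<le> \<mu> X"
\<comment> \<open>The empty set is treated apart because \<open>infdist\<close> to it is 0 by
  convention.\<close>
proof (cases "\<mu> X = \<infinity> \<or> C = {}")
  case False
  define A where "A = (\<lambda>n::nat. {x \<in> X. 1 / real (Suc n) \<le> infdist x C})"
  define R where "R = (\<lambda>n. {x \<in> X. 1 / real (n + 2) \<le> infdist x C \<and> infdist x C < 1 / real (n + 1)})"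
  have RX: "R n \<subseteq> X" for n by (auto simp: R_def)
  have sep: "1 / real (i + 2) - 1 / real (j + 1) \<le> dist x y" if "x \<in> R i" "y \<in> R j" for x y i j
    using that infdist_diff_le[of x C y] by (auto simp: R_def)
  have sep_sum: "(\<Sum>k<n. \<mu> (R (2 * k + s))) \<le> \<mu> X" for n s
  proof -
    have "(\<Sum>k<n. \<mu> (R (2 * k + s))) \<le> \<mu> (\<Union>k<n. R (2 * k + s))"
    proof (rule sum_separated_le)
      fix n :: nat
      define \<eta> where "\<eta> = 1 / real (2 * n + s) - 1 / real (2 * n + s + 1)"
      show "\<exists>\<eta>>0. \<forall>j<n. \<forall>x\<in>R (2 * j + s). \<forall>y\<in>R (2 * n + s). \<eta> \<le> dist x y"
      \<comment> \<open>For n = 0 no earlier ring exists and any gap will do; with s = 0 the value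
        \<eta> would involve a division by zero.\<close>
      proof (cases "n = 0")
        case False
        then have "0 < \<eta>" unfolding \<eta>_def by (simp add: frac_less2)
        moreover have "\<eta> \<le> dist x y" if "j < n" "x \<in> R (2 * j + s)" "y \<in> R (2 * n + s)" for j x y
        proof -
          have "1 / real (2 * n + s) \<le> 1 / real (2 * j + s + 2)"
            using that(1) by (intro divide_left_mono) auto
          then show ?thesis using sep[OF that(2,3)] by (simp add: \<eta>_def)
        qed
        ultimately show ?thesis by blast
      qed (auto intro: exI[of _ 1])
    qed
    also have "\<dots> \<le> \<mu> X" using RX by (intro mono) auto
    finally show ?thesis .
  qed
  have fin: "\<mu> X < \<infinity>" using False by (simp add: top.not_eq_extremum)
  have part: "(\<Sum>k<n. \<mu> (R k)) \<le> 2 * \<mu> X" for n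
  proof -
    have "(\<Sum>k<n. \<mu> (R k)) \<le> (\<Sum>k<2 * n. \<mu> (R k))" by (intro sum_mono2) auto
    also have "\<dots> \<le> \<mu> X + \<mu> X"
      unfolding sum_double using sep_sum[where n = n and s = 0] sep_sum[where n = n and s = 1] by (intro add_mono) auto
    finally show ?thesis by (simp add: mult_2)
  qed
  have "\<mu> (R k) \<le> \<mu> X" for k using RX by (rule mono)
  then have finR: "\<mu> (R k) < \<infinity>" for k using fin by (rule le_less_trans)
  define h where "h = (\<lambda>k. enn2real (\<mu> (R k)))"
  have h: "\<mu> (R k) = ennreal (h k)" "0 \<le> h k" for k
    using finR[of k] by (simp_all add: h_def)
  have "(\<Sum>k. ennreal (h k)) \<le> 2 * \<mu> X"
    using part by (intro suminf_le_const) (auto simp: h(1)[symmetric])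
  also have "\<dots> < \<infinity>" using fin by (simp add: ennreal_mult_less_top)
  finally have summ: "summable h" using h(2) summable_suminf_not_top by auto
  have cover: "\<mu> (X - C) \<le> \<mu> (A n) + ennreal (\<Sum>k. h (k + n))" for n
  proof -
    have "X - C \<subseteq> A n \<union> (\<Union>k. R (k + n))"
    proof
      fix x assume x: "x \<in> X - C"
      then have pos: "0 < infdist x C"
        using False C in_closed_iff_infdist_zero[of C x] infdist_nonneg[of x C] by auto
      show "x \<in> A n \<union> (\<Union>k. R (k + n))"
      proof (cases "1 / real (Suc n) \<le> infdist x C")
        case True then show ?thesis using x by (auto simp: A_def)
      next
        case lt: False
        obtain m where m: "1 / real (Suc m) \<le> infdist x C"
          using reals_Archimedean[OF pos] by (auto simp: inverse_eq_divide intro: less_imp_le)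
        \<comment> \<open>By minimality x lies in the ring with index N - 1, and this index is at
          least n because x is closer to C than 1 / (n + 1).\<close>
        define N where "N = (LEAST m. 1 / real (Suc m) \<le> infdist x C)"
        have N: "1 / real (Suc N) \<le> infdist x C" unfolding N_def using m by (rule LeastI)
        have nN: "n < N"
        proof (rule ccontr)
          assume "\<not> n < N"
          then have "1 / real (Suc n) \<le> 1 / real (Suc N)" by (intro divide_left_mono) auto
          then show False using lt N by linarith
        qed
        obtain K where K: "N = Suc K" "n \<le> K" using nN by (cases N) auto
        have "\<not> 1 / real (Suc K) \<le> infdist x C"
          using not_less_Least[of K "\<lambda>m. 1 / real (Suc m) \<le> infdist x C"] K(1)
          unfolding N_def[symmetric] by simp
        then have "x \<in> R K" using x N unfolding R_def K(1) by (simp add: not_le)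
        moreover have "K = (K - n) + n" using K(2) by simp
        ultimately show ?thesis by (metis UN_I UnI2 UNIV_I)
      qed
    qed
    then have "\<mu> (X - C) \<le> \<mu> (A n \<union> (\<Union>k. R (k + n)))" by (rule mono)
    also have "\<dots> \<le> \<mu> (A n) + \<mu> (\<Union>k. R (k + n))" by (rule subadditive_Un)
    also have "\<mu> (\<Union>k. R (k + n)) \<le> (\<Sum>k. \<mu> (R (k + n)))" by (rule subadditive)
    also have "\<dots> = ennreal (\<Sum>k. h (k + n))"
      unfolding h(1) using summ h(2) by (intro suminf_ennreal2) (auto simp: summable_iff_shift)
    finally show ?thesis by (simp add: add_left_mono)
  qed
  show ?thesis
  proof (rule ennreal_le_epsilon)
    fix e :: real assume "0 < e"
    obtain n where n: "norm (\<Sum>k. h (k + n)) < e"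
      using suminf_exist_split[OF \<open>0 < e\<close> summ] by auto
    have "\<mu> (X \<inter> C) + \<mu> (A n) \<le> \<mu> ((X \<inter> C) \<union> A n)"
    proof (rule separated)
      fix x y assume "x \<in> X \<inter> C" "y \<in> A n"
      then show "1 / real (Suc n) \<le> dist x y"
        using infdist_le[of x C y] by (auto simp: A_def dist_commute)
    qed simp
    also have "\<dots> \<le> \<mu> X" by (intro mono) (auto simp: A_def)
    finally have 1: "\<mu> (X \<inter> C) + \<mu> (A n) \<le> \<mu> X" .
    have "\<mu> (X \<inter> C) + \<mu> (X - C) \<le> \<mu> (X \<inter> C) + (\<mu> (A n) + ennreal e)"
    proof (intro add_left_mono order_trans[OF cover[of n]] ennreal_leI)
      show "(\<Sum>k. h (k + n)) \<le> e" using n by (simp add: abs_less_iff)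
    qed
    also have "\<dots> \<le> \<mu> X + ennreal e" using 1 by (simp add: add.assoc[symmetric] add_right_mono)
    finally show "\<mu> (X \<inter> C) + \<mu> (X - C) \<le> \<mu> X + ennreal e" .
  qed
qed (auto simp: empty)

lemma borel_caratheodory:
  obtains L where "measure_space UNIV L \<mu>" "sets borel \<subseteq> L"
proof
  let ?L = "lambda_system UNIV (Pow UNIV) \<mu>"
  have oms: "outer_measure_space (Pow UNIV) \<mu>"
    unfolding outer_measure_space_def
    by (auto simp: positive_def increasing_def countably_subadditive_def empty mono subadditive)
  show ms: "measure_space UNIV ?L \<mu>"
    using sigma_algebra.caratheodory_lemma[OF sigma_algebra_Pow oms] .
  have "C \<in> ?L" if "closed C" for C
  proof -
    have "\<mu> (X \<inter> C) + \<mu> (X - C) = \<mu> X" for X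
    proof (rule antisym[OF closed_caratheodory[OF that]])
      have "\<mu> ((X \<inter> C) \<union> (X - C)) \<le> \<mu> (X \<inter> C) + \<mu> (X - C)" by (rule subadditive_Un)
      moreover have "(X \<inter> C) \<union> (X - C) = X" by blast
      ultimately show "\<mu> X \<le> \<mu> (X \<inter> C) + \<mu> (X - C)" by simp
    qed
    then show ?thesis unfolding algebra.lambda_system_eq[OF algebra_Pow] by auto
  qed
  moreover have "sigma_algebra UNIV ?L" using ms by (simp add: measure_space_def)
  ultimately have "sigma_sets UNIV {C. closed C} \<subseteq> ?L"
    by (intro sigma_algebra.sigma_sets_subset) auto
  then show "sets borel \<subseteq> ?L" by (simp add: borel_eq_closed)
qed

end

section \<open>Hausdorff content and Hausdorff measure\<close>

definition hausdorff_weight :: "nat \<Rightarrow> real \<Rightarrow> 'a::metric_space set \<Rightarrow> ennreal" where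
  "hausdorff_weight d \<epsilon> U = (if bounded U \<and> diameter U \<le> \<epsilon>
     then ennreal (unit_ball_vol (real d) * (diameter U / 2) ^ d) else \<infinity>)"

text \<open>Infinite weight for large sets turns the restriction on the covers into a property of a
  set function, so that the general theory of outer measures yields countable subadditivity. That
  theory uses disjoint covers; passing to \<open>disjointed\<close> only decreases
  diameters.\<close>

lemma hausdorff_content_eq_outer_measure:
  assumes d: "1 \<le> d"
  shows "hausdorff_content d \<epsilon> A = outer_measure (Pow UNIV) (hausdorff_weight d \<epsilon>) A"
proof (rule antisym)
  show "hausdorff_content d \<epsilon> A \<le> outer_measure (Pow UNIV) (hausdorff_weight d \<epsilon>) A"
    unfolding outer_measure_def
  proof (rule INF_greatest)
    fix U :: "nat \<Rightarrow> 'a set" assume "U \<in> {U. range U \<subseteq> Pow UNIV \<and> disjoint_family U \<and> A \<subseteq> (\<Union>i. U i)}"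
    then have U: "A \<subseteq> (\<Union>i. U i)" by blast
    show "hausdorff_content d \<epsilon> A \<le> (\<Sum>i. hausdorff_weight d \<epsilon> (U i))"
    proof (cases "\<forall>i. bounded (U i) \<and> diameter (U i) \<le> \<epsilon>")
      case True
      then have "hausdorff_content d \<epsilon> A \<le> (\<Sum>i. ennreal (unit_ball_vol (real d) * (diameter (U i) / 2) ^ d))"
        unfolding hausdorff_content_def using U by (intro INF_lower) auto
      then show ?thesis using True by (simp add: hausdorff_weight_def)
    next
      case False
      then obtain i where "\<not> (bounded (U i) \<and> diameter (U i) \<le> \<epsilon>)" by blast
      then have "hausdorff_weight d \<epsilon> (U i) = \<infinity>" unfolding hausdorff_weight_def by (rule if_not_P)
      moreover have "(\<Sum>j\<in>{i}. hausdorff_weight d \<epsilon> (U j)) \<le> (\<Sum>i. hausdorff_weight d \<epsilon> (U i))"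
        by (rule sum_le_suminf) (auto intro: summableI)
      ultimately have "(\<Sum>i. hausdorff_weight d \<epsilon> (U i)) = \<infinity>" by (simp add: top_unique)
      then show ?thesis by simp
    qed
  qed
  show "outer_measure (Pow UNIV) (hausdorff_weight d \<epsilon>) A \<le> hausdorff_content d \<epsilon> A"
    unfolding hausdorff_content_def
  proof (rule INF_greatest)
    fix U :: "nat \<Rightarrow> 'a set"
    assume "U \<in> {U. A \<subseteq> (\<Union>i. U i) \<and> (\<forall>i. bounded (U i) \<and> diameter (U i) \<le> \<epsilon>)}"
    then have U: "A \<subseteq> (\<Union>i. U i)" "\<And>i. bounded (U i)" "\<And>i. diameter (U i) \<le> \<epsilon>" by auto
    have "outer_measure (Pow UNIV) (hausdorff_weight d \<epsilon>) A \<le> (\<Sum>i. hausdorff_weight d \<epsilon> (disjointed U i))"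
      unfolding outer_measure_def
      using U(1) disjoint_family_disjointed[of U] by (intro INF_lower) (auto simp: UN_disjointed_eq)
    also have "\<dots> \<le> (\<Sum>i. ennreal (unit_ball_vol (real d) * (diameter (U i) / 2) ^ d))"
    proof (intro suminf_le summableI)
      fix i
      have sub: "disjointed U i \<subseteq> U i" by (rule disjointed_subset)
      have 1: "bounded (disjointed U i)" using U(2) sub bounded_subset by blast
      have 2: "diameter (disjointed U i) \<le> diameter (U i)" using sub U(2) by (rule diameter_subset)
      have "unit_ball_vol (real d) * (diameter (disjointed U i) / 2) ^ d
          \<le> unit_ball_vol (real d) * (diameter (U i) / 2) ^ d"
        using 2 diameter_ge_0[OF 1] by (intro mult_left_mono power_mono) auto
      then show "hausdorff_weight d \<epsilon> (disjointed U i) \<le> ennreal (unit_ball_vol (real d) * (diameter (U i) / 2) ^ d)"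
        using 1 2 U(3)[of i] by (auto simp: hausdorff_weight_def intro: ennreal_leI)
    qed
    finally show "outer_measure (Pow UNIV) (hausdorff_weight d \<epsilon>) A
        \<le> (\<Sum>i. ennreal (unit_ball_vol (real d) * (diameter (U i) / 2) ^ d))" .
  qed
qed

lemma hausdorff_content_mono: "A \<subseteq> B \<Longrightarrow> hausdorff_content d \<epsilon> A \<le> hausdorff_content d \<epsilon> B"
  unfolding hausdorff_content_def by (rule INF_superset_mono) auto

lemma hausdorff_content_antimono: "\<delta> \<le> \<epsilon> \<Longrightarrow> hausdorff_content d \<epsilon> A \<le> hausdorff_content d \<delta> A"
  unfolding hausdorff_content_def by (rule INF_superset_mono) (auto intro: order_trans)

lemma hausdorff_content_le_outer: "0 < \<epsilon> \<Longrightarrow> hausdorff_content d \<epsilon> A \<le> hausdorff_outer d A"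
  unfolding hausdorff_outer_def by (rule SUP_upper) auto

lemma hausdorff_content_subadditive:
  assumes d: "1 \<le> d" and "0 \<le> \<epsilon>"
  shows "hausdorff_content d \<epsilon> (\<Union>i. A i :: 'a::metric_space set) \<le> (\<Sum>i::nat. hausdorff_content d \<epsilon> (A i))"
proof -
  have pos: "positive (Pow UNIV) (hausdorff_weight d \<epsilon> :: 'a set \<Rightarrow> ennreal)"
    using assms by (simp add: positive_def hausdorff_weight_def)
  have inc: "increasing (Pow UNIV) (hausdorff_weight d \<epsilon> :: 'a set \<Rightarrow> ennreal)"
    unfolding increasing_def
  proof (intro ballI impI)
    fix U V :: "'a set" assume UV: "U \<subseteq> V"
    show "hausdorff_weight d \<epsilon> U \<le> hausdorff_weight d \<epsilon> V"
    proof (cases "bounded V")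
      case True
      then have 1: "bounded U" using UV bounded_subset by blast
      have 2: "diameter U \<le> diameter V" using UV True by (rule diameter_subset)
      have "unit_ball_vol (real d) * (diameter U / 2) ^ d \<le> unit_ball_vol (real d) * (diameter V / 2) ^ d"
        using 2 diameter_ge_0[OF 1] by (intro mult_left_mono power_mono) auto
      then show ?thesis using 1 2 True by (auto simp: hausdorff_weight_def intro: ennreal_leI)
    qed (simp add: hausdorff_weight_def)
  qed
  interpret ring_of_sets UNIV "Pow (UNIV :: 'a set)" by (rule ring_of_sets_Pow)
  have "countably_subadditive (Pow UNIV) (outer_measure (Pow UNIV) (hausdorff_weight d \<epsilon> :: 'a set \<Rightarrow> ennreal))"
    using pos inc by (rule countably_subadditive_outer_measure)
  then have "hausdorff_content d \<epsilon> (\<Union>i. disjointed A i) \<le> (\<Sum>i. hausdorff_content d \<epsilon> (disjointed A i))"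
    unfolding hausdorff_content_eq_outer_measure[OF d] countably_subadditive_def
    using disjoint_family_disjointed[of A] by blast
  also have "\<dots> \<le> (\<Sum>i. hausdorff_content d \<epsilon> (A i))"
    by (intro suminf_le summableI hausdorff_content_mono disjointed_subset)
  finally show ?thesis by (simp add: UN_disjointed_eq)
qed

text \<open>A set of diameter at most \<delta> < \<eta> cannot meet both A and B, so a cover of the
  union splits into covers of the two. The omitted members are replaced by empty sets, which weigh 0
  since d \<ge> 1.\<close>

lemma hausdorff_content_separated:
  fixes A B :: "'a::metric_space set"
  assumes d: "1 \<le> d" and \<delta>: "\<delta> < \<eta>" and sep: "\<And>x y. x \<in> A \<Longrightarrow> y \<in> B \<Longrightarrow> \<eta> \<le> dist x y"
  shows "hausdorff_content d \<delta> A + hausdorff_content d \<delta> B \<le> hausdorff_content d \<delta> (A \<union> B)"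
  unfolding hausdorff_content_def[of d \<delta> "A \<union> B"]
proof (rule INF_greatest)
  fix U :: "nat \<Rightarrow> 'a set"
  assume "U \<in> {U. A \<union> B \<subseteq> (\<Union>i. U i) \<and> (\<forall>i. bounded (U i) \<and> diameter (U i) \<le> \<delta>)}"
  then have U: "A \<union> B \<subseteq> (\<Union>i. U i)" "\<And>i. bounded (U i)" "\<And>i. diameter (U i) \<le> \<delta>" by auto
  define w where "w = (\<lambda>V::'a set. ennreal (unit_ball_vol (real d) * (diameter V / 2) ^ d))"
  define V where "V = (\<lambda>i. if U i \<inter> A = {} then {} else U i)"
  define V' where "V' = (\<lambda>i. if U i \<inter> A = {} then U i else {})"
  have \<delta>0: "0 \<le> \<delta>" using U(2,3)[of 0] diameter_ge_0 order_trans by blast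
  have w0: "w {} = 0" using d by (simp add: w_def)
  have "A \<subseteq> (\<Union>i. V i)" using U(1) unfolding V_def by fastforce
  then have 1: "hausdorff_content d \<delta> A \<le> (\<Sum>i. w (V i))"
    unfolding hausdorff_content_def w_def using U \<delta>0 by (intro INF_lower) (auto simp: V_def)
  have "B \<subseteq> (\<Union>i. V' i)"
  proof
    fix y assume y: "y \<in> B"
    then obtain i where i: "y \<in> U i" using U(1) by blast
    have "U i \<inter> A = {}"
    proof (rule ccontr)
      assume "U i \<inter> A \<noteq> {}"
      then obtain x where "x \<in> U i" "x \<in> A" by blast
      then show False
        using sep[OF \<open>x \<in> A\<close> y] diameter_bounded_bound[OF U(2) \<open>x \<in> U i\<close> i] U(3)[of i] \<delta> by linarith
    qed
    then show "y \<in> (\<Union>i. V' i)" using i by (auto simp: V'_def)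
  qed
  then have 2: "hausdorff_content d \<delta> B \<le> (\<Sum>i. w (V' i))"
    unfolding hausdorff_content_def w_def using U \<delta>0 by (intro INF_lower) (auto simp: V'_def)
  have "(\<Sum>i. w (V i)) + (\<Sum>i. w (V' i)) = (\<Sum>i. w (V i) + w (V' i))"
    by (rule suminf_add) (auto intro: summableI)
  also have "(\<lambda>i. w (V i) + w (V' i)) = (\<lambda>i. w (U i))"
    by (auto simp: V_def V'_def w0)
  finally show "hausdorff_content d \<delta> A + hausdorff_content d \<delta> B
      \<le> (\<Sum>i. ennreal (unit_ball_vol (real d) * (diameter (U i) / 2) ^ d))"
    using add_mono[OF 1 2] by (simp add: w_def)
qed

text \<open>The two suprema run over independent scales; as contents increase when the scale
  decreases, both may be taken at the smaller one.\<close>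

lemma hausdorff_outer_add_le:
  assumes "\<And>\<epsilon>. 0 < \<epsilon> \<Longrightarrow> hausdorff_content d \<epsilon> A + hausdorff_content d \<epsilon> B \<le> c"
  shows "hausdorff_outer d A + hausdorff_outer d B \<le> c"
proof -
  have "hausdorff_content d \<epsilon> A + hausdorff_outer d B \<le> c" if \<epsilon>: "0 < \<epsilon>" for \<epsilon>
  proof -
    have "hausdorff_content d \<epsilon> A + hausdorff_outer d B
        = (SUP \<epsilon>'\<in>{0<..}. hausdorff_content d \<epsilon> A + hausdorff_content d \<epsilon>' B)"
      unfolding hausdorff_outer_def by (subst ennreal_SUP_add_right) auto
    also have "\<dots> \<le> c"
    proof (rule SUP_least)
      fix \<epsilon>' :: real assume \<epsilon>': "\<epsilon>' \<in> {0<..}"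
      have "hausdorff_content d \<epsilon> A + hausdorff_content d \<epsilon>' B
          \<le> hausdorff_content d (min \<epsilon> \<epsilon>') A + hausdorff_content d (min \<epsilon> \<epsilon>') B"
        by (intro add_mono hausdorff_content_antimono) auto
      also have "\<dots> \<le> c" using \<epsilon> \<epsilon>' by (intro assms) auto
      finally show "hausdorff_content d \<epsilon> A + hausdorff_content d \<epsilon>' B \<le> c" .
    qed
    finally show ?thesis .
  qed
  moreover have "hausdorff_outer d A + hausdorff_outer d B
      = (SUP \<epsilon>\<in>{0<..}. hausdorff_content d \<epsilon> A + hausdorff_outer d B)"
    unfolding hausdorff_outer_def[of d A] by (subst ennreal_SUP_add_left) auto
  ultimately show ?thesis by (auto intro: SUP_least)
qed

lemma metric_outer_measure_hausdorff:
  assumes d: "1 \<le> d"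
  shows "metric_outer_measure (hausdorff_outer d :: 'a::metric_space set \<Rightarrow> ennreal)"
proof
  have "hausdorff_content d \<epsilon> ({} :: 'a set) \<le> 0" if "0 < \<epsilon>" for \<epsilon>
  proof -
    have "hausdorff_content d \<epsilon> ({} :: 'a set)
        \<le> (\<Sum>i::nat. ennreal (unit_ball_vol (real d) * (diameter ({} :: 'a set) / 2) ^ d))"
      unfolding hausdorff_content_def by (rule INF_lower) (use that in auto)
    then show ?thesis using d by (simp add: power_0_left)
  qed
  then show "hausdorff_outer d ({} :: 'a set) = 0"
    unfolding hausdorff_outer_def by (auto intro!: antisym[OF SUP_least])
next
  fix A B :: "'a set" assume "A \<subseteq> B"
  then show "hausdorff_outer d A \<le> hausdorff_outer d B"
    unfolding hausdorff_outer_def by (intro SUP_mono) (auto intro: hausdorff_content_mono)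
next
  fix A :: "nat \<Rightarrow> 'a set"
  show "hausdorff_outer d (\<Union>i. A i) \<le> (\<Sum>i. hausdorff_outer d (A i))"
    unfolding hausdorff_outer_def[of d "\<Union>i. A i"]
  proof (rule SUP_least)
    fix \<epsilon> :: real assume "\<epsilon> \<in> {0<..}"
    then have "hausdorff_content d \<epsilon> (\<Union>i. A i) \<le> (\<Sum>i. hausdorff_content d \<epsilon> (A i))"
      using d by (intro hausdorff_content_subadditive) auto
    also have "\<dots> \<le> (\<Sum>i. hausdorff_outer d (A i))"
      using \<open>\<epsilon> \<in> {0<..}\<close> by (intro suminf_le summableI hausdorff_content_le_outer) auto
    finally show "hausdorff_content d \<epsilon> (\<Union>i. A i) \<le> (\<Sum>i. hausdorff_outer d (A i))" .
  qed
next
  fix \<eta> :: real and A B :: "'a set"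
  assume \<eta>: "0 < \<eta>" and sep: "\<And>x y. x \<in> A \<Longrightarrow> y \<in> B \<Longrightarrow> \<eta> \<le> dist x y"
  show "hausdorff_outer d A + hausdorff_outer d B \<le> hausdorff_outer d (A \<union> B)"
  proof (rule hausdorff_outer_add_le)
    fix \<epsilon> :: real assume "0 < \<epsilon>"
    define \<delta> where "\<delta> = min \<epsilon> (\<eta> / 2)"
    have \<delta>: "0 < \<delta>" "\<delta> < \<eta>" "\<delta> \<le> \<epsilon>" using \<open>0 < \<epsilon>\<close> \<eta> by (auto simp: \<delta>_def)
    have "hausdorff_content d \<epsilon> A + hausdorff_content d \<epsilon> B \<le> hausdorff_content d \<delta> A + hausdorff_content d \<delta> B"
      using \<delta> by (intro add_mono hausdorff_content_antimono) auto
    also have "\<dots> \<le> hausdorff_content d \<delta> (A \<union> B)"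
      using d \<delta>(2) sep by (rule hausdorff_content_separated)
    also have "\<dots> \<le> hausdorff_outer d (A \<union> B)" using \<delta>(1) by (rule hausdorff_content_le_outer)
    finally show "hausdorff_content d \<epsilon> A + hausdorff_content d \<epsilon> B \<le> hausdorff_outer d (A \<union> B)" .
  qed
qed

text \<open>A measure built by \<open>measure_of\<close> takes the prescribed values only if these
  are countably additive, so the definition yields Hausdorff measure only by virtue of
  Caratheodory's criterion.\<close>

lemma emeasure_volume_measure:
  fixes M :: "'a::euclidean_space set"
  assumes d: "1 \<le> d" and M: "M \<in> sets borel" and A: "A \<in> sets borel"
  shows "emeasure (volume_measure d M) A = hausdorff_outer d (A \<inter> M)"
proof -
  interpret H: metric_outer_measure "hausdorff_outer d :: 'a set \<Rightarrow> ennreal"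
    by (rule metric_outer_measure_hausdorff[OF d])
  obtain L where L: "measure_space UNIV L (hausdorff_outer d :: 'a set \<Rightarrow> ennreal)" "sets borel \<subseteq> L"
    by (rule H.borel_caratheodory)
  have "countably_additive (sets borel) (\<lambda>A. hausdorff_outer d (A \<inter> M))"
  proof (rule countably_additiveI)
    fix A :: "nat \<Rightarrow> 'a set" assume A: "range A \<subseteq> sets borel" "disjoint_family A"
    have "range (\<lambda>i. A i \<inter> M) \<subseteq> sets borel" using A M by auto
    then have "range (\<lambda>i. A i \<inter> M) \<subseteq> L" using L(2) by (rule subset_trans)
    moreover have "disjoint_family (\<lambda>i. A i \<inter> M)" using A(2) by (auto simp: disjoint_family_on_def)
    moreover have "(\<Union>i. A i \<inter> M) \<in> L"
      using A M L(2) by (intro subsetD[OF L(2)] sets.countable_UN) auto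
    ultimately show "(\<Sum>i. hausdorff_outer d (A i \<inter> M)) = hausdorff_outer d ((\<Union>i. A i) \<inter> M)"
      using L(1) by (auto simp: measure_space_def countably_additive_def)
  qed
  then show ?thesis
    unfolding volume_measure_def using A
    by (intro emeasure_measure_of_sigma) (auto simp: positive_def H.empty sets.sigma_algebra_axioms[of borel, simplified])
qed

lemma sets_volume_measure [simp, measurable_cong]: "sets (volume_measure d M) = sets borel"
  unfolding volume_measure_def by (simp add: sets_measure_of_conv sigma_algebra.sigma_sets_eq[OF sets.sigma_algebra_axioms[of borel, simplified]])

lemma space_volume_measure [simp]: "space (volume_measure d M) = UNIV"
  unfolding volume_measure_def by (simp add: space_measure_of_conv)

lemma hausdorff_content_finite_cover:
  assumes d: "1 \<le> d" and "0 \<le> \<epsilon>" and T: "finite T" and A: "A \<subseteq> (\<Union>t\<in>T. U t)"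
    and U: "\<And>t. t \<in> T \<Longrightarrow> bounded (U t) \<and> diameter (U t) \<le> \<delta>" and "\<delta> \<le> \<epsilon>"
  shows "hausdorff_content d \<epsilon> A \<le> ennreal (real (card T) * (unit_ball_vol (real d) * (\<delta> / 2) ^ d))"
proof -
  obtain f where f: "bij_betw f {..<card T} T"
    using ex_bij_betw_nat_finite[OF T] by (auto simp: atLeast0LessThan)
  define V where "V = (\<lambda>i. if i < card T then U (f i) else {})"
  have fT: "f i \<in> T" if "i < card T" for i using f that by (auto simp: bij_betw_def)
  have "A \<subseteq> (\<Union>i. V i)"
  proof
    fix x assume "x \<in> A"
    then obtain t where t: "t \<in> T" "x \<in> U t" using A by blast
    then obtain i where "i < card T" "f i = t" using f by (metis bij_betw_def imageE lessThan_iff)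
    then show "x \<in> (\<Union>i. V i)" using t by (auto simp: V_def)
  qed
  then have "hausdorff_content d \<epsilon> A \<le> (\<Sum>i. ennreal (unit_ball_vol (real d) * (diameter (V i) / 2) ^ d))"
    unfolding hausdorff_content_def using U fT assms(2,6)
    by (intro INF_lower) (force simp: V_def)
  also have "\<dots> = (\<Sum>i<card T. ennreal (unit_ball_vol (real d) * (diameter (V i) / 2) ^ d))"
    using d by (intro suminf_finite) (auto simp: V_def)
  also have "\<dots> \<le> (\<Sum>i<card T. ennreal (unit_ball_vol (real d) * (\<delta> / 2) ^ d))"
  proof (intro sum_mono ennreal_leI mult_left_mono power_mono divide_right_mono)
    fix i assume "i \<in> {..<card T}"
    then show "diameter (V i) \<le> \<delta>" "0 \<le> diameter (V i) / 2"
      using U[OF fT] diameter_ge_0 by (auto simp: V_def)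
  qed auto
  also have "\<dots> = ennreal (real (card T) * (unit_ball_vol (real d) * (\<delta> / 2) ^ d))"
    by (simp add: ennreal_of_nat_eq_real_of_nat ennreal_mult'[symmetric])
  finally show ?thesis .
qed

section \<open>Volume bounds on the sphere\<close>

context subspace_sphere
begin

section \<open>Upper bound for the volume of balls\<close>

lemma finite_I: "finite I" using I_Basis finite_subset finite_Basis by blast

lemma W_norm_le_sum:
  assumes "y \<in> W"
  shows "norm y \<le> (\<Sum>b\<in>I. \<bar>y \<bullet> b\<bar>)"
proof -
  have "norm y \<le> (\<Sum>b\<in>Basis. \<bar>y \<bullet> b\<bar>)" by (rule norm_le_l1)
  also have "\<dots> = (\<Sum>b\<in>I. \<bar>y \<bullet> b\<bar>)"
    using assms I_Basis by (intro sum.mono_neutral_right) (auto simp: W_def)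
  finally show ?thesis .
qed

lemma W_inner_eq_sum:
  assumes "y \<in> W"
  shows "y \<bullet> y = (\<Sum>b\<in>I. (y \<bullet> b)\<^sup>2)"
proof -
  have "y \<bullet> y = (\<Sum>b\<in>Basis. (y \<bullet> b)\<^sup>2)"
    by (subst euclidean_inner) (simp add: power2_eq_square)
  also have "\<dots> = (\<Sum>b\<in>I. (y \<bullet> b)\<^sup>2)"
    using assms I_Basis by (intro sum.mono_neutral_right) (auto simp: W_def)
  finally show ?thesis .
qed

text \<open>On \<open>sphere_chart i \<sigma>\<close> the coordinate \<open>i\<close> has the largest modulus, which makes it
  a 1-Lipschitz function of the others for the 1-norm.\<close>

definition sphere_chart :: "'a \<Rightarrow> real \<Rightarrow> 'a set" where
  "sphere_chart i \<sigma> = {y \<in> M. \<forall>j\<in>I. \<bar>(y - c) \<bullet> j\<bar> \<le> \<sigma> * ((y - c) \<bullet> i)}"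

lemma sphere_charts_cover: "M \<subseteq> (\<Union>i\<in>I. sphere_chart i 1 \<union> sphere_chart i (-1))"
proof
  fix y assume y: "y \<in> M"
  have "finite ((\<lambda>j. \<bar>(y - c) \<bullet> j\<bar>) ` I)" "(\<lambda>j. \<bar>(y - c) \<bullet> j\<bar>) ` I \<noteq> {}"
    using finite_I e0 by auto
  from Max_in[OF this] obtain i where i: "i \<in> I" "Max ((\<lambda>j. \<bar>(y - c) \<bullet> j\<bar>) ` I) = \<bar>(y - c) \<bullet> i\<bar>" by auto
  have "\<bar>(y - c) \<bullet> j\<bar> \<le> \<bar>(y - c) \<bullet> i\<bar>" if "j \<in> I" for j
    unfolding i(2)[symmetric] using that finite_I by (intro Max_ge) auto
  then have "y \<in> sphere_chart i 1 \<union> sphere_chart i (-1)"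
    using y unfolding sphere_chart_def by (cases "0 \<le> (y - c) \<bullet> i") auto
  then show "y \<in> (\<Union>i\<in>I. sphere_chart i 1 \<union> sphere_chart i (-1))" using i by blast
qed

text \<open>Equal norms give (u_i - v_i)(u_i + v_i) as the sum over j \<noteq> i of (v_j - u_j)(v_j
  + u_j). In a chart |u_j + v_j| is at most s = \<sigma> (u_i + v_i), so division by s leaves the
  sum of d differences. The 1-norm contributes another d of them.\<close>

lemma sphere_chart_lipschitz:
  assumes i: "i \<in> I" and \<sigma>: "\<bar>\<sigma>\<bar> = 1" and y: "y \<in> sphere_chart i \<sigma>" and z: "z \<in> sphere_chart i \<sigma>"
    and \<delta>: "\<And>j. j \<in> I - {i} \<Longrightarrow> \<bar>(y - z) \<bullet> j\<bar> \<le> \<delta>"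
  shows "norm (y - z) \<le> 2 * real d * \<delta>"
proof -
  define u v where "u = y - c" and "v = z - c"
  have uv: "y - z = u - v" by (simp add: u_def v_def)
  have u: "u \<in> W" "norm u = r" "\<And>j. j \<in> I \<Longrightarrow> \<bar>u \<bullet> j\<bar> \<le> \<sigma> * (u \<bullet> i)"
    using y by (auto simp: sphere_chart_def M_def u_def)
  have v: "v \<in> W" "norm v = r" "\<And>j. j \<in> I \<Longrightarrow> \<bar>v \<bullet> j\<bar> \<le> \<sigma> * (v \<bullet> i)"
    using z by (auto simp: sphere_chart_def M_def v_def)
  define s where "s = \<sigma> * (u \<bullet> i) + \<sigma> * (v \<bullet> i)"
  have "u \<noteq> 0" using u r by auto
  then obtain b where "b \<in> Basis" "u \<bullet> b \<noteq> 0" by (metis euclidean_all_zero_iff)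
  then have "b \<in> I" using u(1) by (auto simp: W_def)
  then have "0 < \<sigma> * (u \<bullet> i)" using u(3)[of b] \<open>u \<bullet> b \<noteq> 0\<close> by linarith
  moreover have "0 \<le> \<sigma> * (v \<bullet> i)" using v(3)[of i] i by linarith
  ultimately have s: "0 < s" by (simp add: s_def)
  have abs_i: "\<bar>(u - v) \<bullet> i\<bar> = \<bar>\<sigma> * (u \<bullet> i) - \<sigma> * (v \<bullet> i)\<bar>"
    using \<sigma> by (simp add: right_diff_distrib[symmetric] abs_mult inner_diff_left)
  have \<sigma>2: "\<sigma>\<^sup>2 = 1" using \<sigma> by (metis one_power2 power2_abs)
  have "(\<Sum>b\<in>I. (u \<bullet> b)\<^sup>2) = (\<Sum>b\<in>I. (v \<bullet> b)\<^sup>2)"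
    using W_inner_eq_sum u v by (metis power2_norm_eq_inner)
  then have "(u \<bullet> i)\<^sup>2 - (v \<bullet> i)\<^sup>2 = (\<Sum>j\<in>I - {i}. (v \<bullet> j)\<^sup>2 - (u \<bullet> j)\<^sup>2)"
    using i finite_I by (simp add: sum.remove sum_subtractf)
  also have "(u \<bullet> i)\<^sup>2 - (v \<bullet> i)\<^sup>2 = (\<sigma> * (u \<bullet> i) - \<sigma> * (v \<bullet> i)) * s"
  proof -
    have "(\<sigma> * (u \<bullet> i) - \<sigma> * (v \<bullet> i)) * s = \<sigma>\<^sup>2 * ((u \<bullet> i)\<^sup>2 - (v \<bullet> i)\<^sup>2)"
      unfolding s_def by (simp add: algebra_simps power2_eq_square)
    then show ?thesis using \<sigma>2 by simp
  qed
  finally have "\<bar>(u - v) \<bullet> i\<bar> * s = \<bar>\<Sum>j\<in>I - {i}. (v \<bullet> j)\<^sup>2 - (u \<bullet> j)\<^sup>2\<bar>"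
    using s abs_i by (metis abs_mult abs_of_pos)
  also have "\<dots> \<le> (\<Sum>j\<in>I - {i}. \<bar>(v \<bullet> j)\<^sup>2 - (u \<bullet> j)\<^sup>2\<bar>)" by (rule sum_abs)
  also have "\<dots> \<le> (\<Sum>j\<in>I - {i}. \<delta> * s)"
  proof (rule sum_mono)
    fix j assume j: "j \<in> I - {i}"
    have "\<bar>(v \<bullet> j)\<^sup>2 - (u \<bullet> j)\<^sup>2\<bar> = \<bar>(u - v) \<bullet> j\<bar> * \<bar>v \<bullet> j + u \<bullet> j\<bar>"
      by (simp add: abs_mult[symmetric] inner_diff_left power2_eq_square algebra_simps abs_minus_commute)
    also have "\<dots> \<le> \<delta> * s"
    proof (rule mult_mono)
      show "\<bar>(u - v) \<bullet> j\<bar> \<le> \<delta>" using \<delta>[OF j] uv by simp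
      then show "0 \<le> \<delta>" by linarith
      show "\<bar>v \<bullet> j + u \<bullet> j\<bar> \<le> s" using u(3)[of j] v(3)[of j] j unfolding s_def by auto
    qed simp
    finally show "\<bar>(v \<bullet> j)\<^sup>2 - (u \<bullet> j)\<^sup>2\<bar> \<le> \<delta> * s" .
  qed
  also have "\<dots> = real d * \<delta> * s" using i card_I finite_I by simp
  finally have 1: "\<bar>(u - v) \<bullet> i\<bar> \<le> real d * \<delta>" using s by simp
  have "norm (u - v) \<le> (\<Sum>b\<in>I. \<bar>(u - v) \<bullet> b\<bar>)"
    using subspace_diff[OF subspace_W u(1) v(1)] by (rule W_norm_le_sum)
  also have "\<dots> = \<bar>(u - v) \<bullet> i\<bar> + (\<Sum>b\<in>I - {i}. \<bar>(u - v) \<bullet> b\<bar>)"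
    using i finite_I by (rule sum.remove[rotated])
  also have "(\<Sum>b\<in>I - {i}. \<bar>(u - v) \<bullet> b\<bar>) \<le> (\<Sum>b\<in>I - {i}. \<delta>)"
    using \<delta> uv by (intro sum_mono) simp
  also have "\<dots> = real d * \<delta>" using i card_I finite_I by simp
  finally show ?thesis using 1 uv by simp
qed

text \<open>A grid of mesh \<rho> / K in the d coordinates other than i cuts the set into at most (3
  K) ^ d pieces of diameter at most 2 d \<rho> / K. In the product of number and weight K cancels,
  so the estimate is the same for every \<epsilon>.\<close>

lemma hausdorff_outer_chart_ball_le:
  assumes i: "i \<in> I" and \<sigma>: "\<bar>\<sigma>\<bar> = 1" and \<rho>: "0 < \<rho>"
  shows "hausdorff_outer d (sphere_chart i \<sigma> \<inter> cball y0 \<rho>)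
    \<le> ennreal (unit_ball_vol (real d) * (3 * real d) ^ d * \<rho> ^ d)"
  unfolding hausdorff_outer_def
proof (rule SUP_least)
  fix \<epsilon> :: real assume "\<epsilon> \<in> {0<..}"
  then have \<epsilon>: "0 < \<epsilon>" by simp
  define J where "J = I - {i}"
  have J: "finite J" "card J = d" "J \<subseteq> Basis"
    using finite_I card_I i I_Basis by (auto simp: J_def)
  obtain K :: nat where K: "2 * real d * \<rho> / \<epsilon> < real K" using reals_Archimedean2 by blast
  have K0: "0 < real K" using K \<rho> \<epsilon> by (smt (verit) divide_nonneg_pos mult_nonneg_nonneg of_nat_0_le_iff)
  define \<delta> where "\<delta> = 2 * real d * (\<rho> / real K)"
  have \<delta>: "\<delta> \<le> \<epsilon>" using K K0 \<epsilon> by (simp add: \<delta>_def field_simps)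
  define idx where "idx = (\<lambda>y j. \<lfloor>((y - y0) \<bullet> j) * (real K / \<rho>)\<rfloor>)"
  \<comment> \<open>The floor attains K at the right end point, so there are 2 K + 1 values per
    coordinate, which is at most 3 K.\<close>
  define T where "T = (J \<rightarrow>\<^sub>E {- int K..int K})"
  define A where "A = sphere_chart i \<sigma> \<inter> cball y0 \<rho>"
  define U where "U = (\<lambda>t. {y \<in> A. \<forall>j\<in>J. idx y j = t j})"
  have "A \<subseteq> (\<Union>t\<in>T. U t)"
  proof
    fix y assume y: "y \<in> A"
    have "idx y j \<in> {- int K..int K}" if "j \<in> J" for j
    proof -
      have "\<bar>(y - y0) \<bullet> j\<bar> \<le> norm (y - y0)" using J that Basis_le_norm by blast
      also have "\<dots> \<le> \<rho>" using y by (simp add: A_def dist_norm norm_minus_commute)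
      finally have "\<bar>((y - y0) \<bullet> j) * (real K / \<rho>)\<bar> \<le> real K"
        using \<rho> K0 by (simp add: abs_mult field_simps)
      then have "- real K \<le> ((y - y0) \<bullet> j) * (real K / \<rho>)" "((y - y0) \<bullet> j) * (real K / \<rho>) \<le> real K"
        by linarith+
      then show ?thesis unfolding idx_def by (auto simp: le_floor_iff floor_le_iff)
    qed
    then have "restrict (idx y) J \<in> T" by (auto simp: T_def)
    moreover have "y \<in> U (restrict (idx y) J)" using y by (auto simp: U_def)
    ultimately show "y \<in> (\<Union>t\<in>T. U t)" by blast
  qed
  moreover have "finite T" unfolding T_def using J by (intro finite_PiE) auto
  moreover have "bounded (U t) \<and> diameter (U t) \<le> \<delta>" for t
  proof
    show "bounded (U t)" by (rule bounded_subset[of "cball y0 \<rho>"]) (auto simp: U_def A_def)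
    show "diameter (U t) \<le> \<delta>"
    proof (rule diameter_le)
      show "U t \<noteq> {} \<or> 0 \<le> \<delta>" using \<rho> K0 by (simp add: \<delta>_def)
      fix y z assume yz: "y \<in> U t" "z \<in> U t"
      show "norm (y - z) \<le> \<delta>" unfolding \<delta>_def
      proof (rule sphere_chart_lipschitz[OF i \<sigma>])
        show "y \<in> sphere_chart i \<sigma>" "z \<in> sphere_chart i \<sigma>" using yz by (auto simp: U_def A_def)
        fix j assume "j \<in> I - {i}"
        then have "idx y j = idx z j" using yz by (auto simp: U_def J_def)
        then have "\<bar>((y - y0) \<bullet> j) * (real K / \<rho>) - ((z - y0) \<bullet> j) * (real K / \<rho>)\<bar> \<le> 1"
          unfolding idx_def by linarith
        also have "((y - y0) \<bullet> j) * (real K / \<rho>) - ((z - y0) \<bullet> j) * (real K / \<rho>)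
            = ((y - z) \<bullet> j) * (real K / \<rho>)"
          by (simp add: inner_diff_left algebra_simps diff_divide_distrib)
        finally show "\<bar>(y - z) \<bullet> j\<bar> \<le> \<rho> / real K"
          using K0 \<rho> by (simp add: abs_mult field_simps)
      qed
    qed
  qed
  ultimately have "hausdorff_content d \<epsilon> A \<le> ennreal (real (card T) * (unit_ball_vol (real d) * (\<delta> / 2) ^ d))"
    using \<delta> \<epsilon> d by (intro hausdorff_content_finite_cover) auto
  also have "\<dots> \<le> ennreal (unit_ball_vol (real d) * (3 * real d) ^ d * \<rho> ^ d)"
  proof (rule ennreal_leI)
    have "real (card T) = (2 * real K + 1) ^ d"
      unfolding T_def using J by (subst card_PiE) (auto simp: nat_add_distrib add.commute)
    also have "\<dots> \<le> (3 * real K) ^ d" using K0 by (intro power_mono) auto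
    finally have "real (card T) * (unit_ball_vol (real d) * (\<delta> / 2) ^ d)
        \<le> (3 * real K) ^ d * (unit_ball_vol (real d) * (\<delta> / 2) ^ d)"
      using \<rho> K0 by (intro mult_right_mono mult_nonneg_nonneg) (auto simp: \<delta>_def)
    also have "\<dots> = unit_ball_vol (real d) * (3 * real K * (\<delta> / 2)) ^ d"
      by (simp only: power_mult_distrib[of "3 * real K" "\<delta> / 2"] mult.left_commute)
    also have "3 * real K * (\<delta> / 2) = 3 * real d * \<rho>" using K0 by (simp add: \<delta>_def)
    finally show "real (card T) * (unit_ball_vol (real d) * (\<delta> / 2) ^ d)
        \<le> unit_ball_vol (real d) * (3 * real d) ^ d * \<rho> ^ d"
      by (simp add: power_mult_distrib mult.assoc)
  qed
  finally show "hausdorff_content d \<epsilon> (sphere_chart i \<sigma> \<inter> cball y0 \<rho>)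
    \<le> ennreal (unit_ball_vol (real d) * (3 * real d) ^ d * \<rho> ^ d)" by (simp add: A_def)
qed

sublocale hausdorff: metric_outer_measure "hausdorff_outer d :: 'a set \<Rightarrow> ennreal"
  by (rule metric_outer_measure_hausdorff[OF d])

text \<open>The choice of i and of the sign gives 2 (d + 1) charts.\<close>

lemma hausdorff_outer_ball_le:
  assumes \<rho>: "0 < \<rho>"
  shows "hausdorff_outer d (M \<inter> cball y0 \<rho>)
    \<le> ennreal (2 * real (d + 1) * unit_ball_vol (real d) * (3 * real d) ^ d * \<rho> ^ d)"
proof -
  define B where "B = unit_ball_vol (real d) * (3 * real d) ^ d * \<rho> ^ d"
  have B: "0 \<le> B" using \<rho> by (simp add: B_def)
  have "hausdorff_outer d (M \<inter> cball y0 \<rho>)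
      \<le> hausdorff_outer d (\<Union>i\<in>I. (sphere_chart i 1 \<inter> cball y0 \<rho>) \<union> (sphere_chart i (-1) \<inter> cball y0 \<rho>))"
    using sphere_charts_cover by (intro hausdorff.mono) blast
  also have "\<dots> \<le> (\<Sum>i\<in>I. hausdorff_outer d ((sphere_chart i 1 \<inter> cball y0 \<rho>) \<union> (sphere_chart i (-1) \<inter> cball y0 \<rho>)))"
    using finite_I by (rule hausdorff.subadditive_finite_UN)
  also have "\<dots> \<le> (\<Sum>i\<in>I. ennreal B + ennreal B)"
    using \<rho> unfolding B_def
    by (intro sum_mono order_trans[OF hausdorff.subadditive_Un] add_mono
        hausdorff_outer_chart_ball_le) auto
  also have "\<dots> = ennreal (real (d + 1) * (B + B))"
    using B by (simp add: card_I ennreal_plus[symmetric] ennreal_mult' ennreal_of_nat_eq_real_of_nat del: ennreal_plus)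
  also have "real (d + 1) * (B + B) = 2 * real (d + 1) * unit_ball_vol (real d) * (3 * real d) ^ d * \<rho> ^ d"
    unfolding B_def by (simp only: mult_2[symmetric] ac_simps)
  finally show ?thesis .
qed

section \<open>Lower bound for the volume by comparison with Lebesgue measure\<close>

text \<open>The part over \<open>A\<close> of the product of the cone with apex \<open>c\<close> and the unit cube of the orthogonal
  complement of \<open>W\<close>: a set of full dimension, whose Lebesgue measure bounds the Hausdorff measure of
  \<open>A\<close> from below.\<close>

definition thick_cone :: "'a set \<Rightarrow> 'a set" where
  "thick_cone A = {q. \<exists>y\<in>A. \<exists>t\<in>{0..1}. (\<forall>b\<in>I. (q - c) \<bullet> b = t * ((y - c) \<bullet> b)) \<and>
     (\<forall>b\<in>Basis - I. \<bar>(q - c) \<bullet> b\<bar> \<le> 1)}"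

text \<open>The constant of \<open>thick_cone_small\<close>: the number of boxes is at most 3 /
  \<delta>, their sides along I are 2 (r + 1) \<delta>, and the power of 2 accounts for the sides in
  the remaining directions.\<close>

definition cone_const :: real where
  "cone_const = 3 * (2 * (r + 1)) ^ (d + 1) * 2 ^ DIM('a)"

lemma cone_const_pos: "0 < cone_const" using r by (simp add: cone_const_def)

text \<open>Over a set of diameter at most \<delta> the cone stays close to one segment from c, so
  about 1 / \<delta> boxes of volume of order \<delta> ^ (d + 1) cover it. The Borel set S takes the
  place of the cone, whose measurability is left open.\<close>

lemma thick_cone_small:
  assumes AM: "A \<subseteq> M" and \<delta>: "0 < \<delta>" "\<delta> \<le> 1" and A: "\<And>y z. y \<in> A \<Longrightarrow> z \<in> A \<Longrightarrow> dist y z \<le> \<delta>"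
  obtains S where "S \<in> sets borel" "thick_cone A \<subseteq> S" "emeasure lborel S \<le> ennreal (cone_const * \<delta> ^ d)"
proof (cases "A = {}")
  case True
  show ?thesis by (rule that[of "{}"]) (auto simp: thick_cone_def True)
next
  case False
  then obtain z where z: "z \<in> A" by blast
  \<comment> \<open>Subdividing the segment into m parts gives steps of length at most \<delta> r,
    while m + 1 \<le> 3 / \<delta> because \<delta> \<le> 1.\<close>
  define m where "m = nat \<lceil>1 / \<delta>\<rceil>"
  have \<delta>1: "1 \<le> 1 / \<delta>" using \<delta> by simp
  have m: "1 / \<delta> \<le> real m" "real m \<le> 1 / \<delta> + 1"
    using \<delta>1 unfolding m_def by linarith+
  have m1: "1 \<le> m" using \<delta>1 m(1) by linarith
  \<comment> \<open>In a direction of I the deviation is at most r \<delta> along the segment plus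
    \<delta> across it.\<close>
  define h where "h = (\<Sum>b\<in>Basis. (if b \<in> I then (r + 1) * \<delta> else 1) *\<^sub>R b)"
  define p where "p = (\<lambda>l. c + (real l / real m) *\<^sub>R (z - c))"
  define S where "S = (\<Union>l\<in>{..m}. cbox (p l - h) (p l + h))"
  have hb: "h \<bullet> b = (if b \<in> I then (r + 1) * \<delta> else 1)" if "b \<in> Basis" for b
    using that by (simp add: h_def)
  have zW: "z - c \<in> W" using z AM by (auto simp: M_def)
  have sub: "thick_cone A \<subseteq> S"
  proof
    fix q assume "q \<in> thick_cone A"
    then obtain y t where y: "y \<in> A" and t: "0 \<le> t" "t \<le> 1"
      and q: "\<And>b. b \<in> I \<Longrightarrow> (q - c) \<bullet> b = t * ((y - c) \<bullet> b)" "\<And>b. b \<in> Basis - I \<Longrightarrow> \<bar>(q - c) \<bullet> b\<bar> \<le> 1"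
      by (auto simp: thick_cone_def)
    define l where "l = nat \<lfloor>t * real m\<rfloor>"
    have "0 \<le> t * real m" "t * real m \<le> real m" using t by (auto simp: mult_left_le_one_le)
    then have l: "real l \<le> t * real m" "t * real m \<le> real l + 1" "l \<le> m"
      unfolding l_def by linarith+
    have lm: "\<bar>t - real l / real m\<bar> \<le> \<delta>" "0 \<le> real l / real m" "real l / real m \<le> 1"
    proof -
      have "t - real l / real m = (t * real m - real l) / real m"
        using m1 by (simp add: diff_divide_distrib)
      then have "\<bar>t - real l / real m\<bar> = \<bar>t * real m - real l\<bar> / real m" by simp
      also have "\<dots> \<le> 1 / real m" using l by (intro divide_right_mono) auto
      also have "\<dots> \<le> \<delta>" using m m1 \<delta> by (simp add: field_simps)
      finally show "\<bar>t - real l / real m\<bar> \<le> \<delta>" .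
    qed (use l m1 in auto)
    have "\<bar>(q - p l) \<bullet> b\<bar> \<le> h \<bullet> b" if b: "b \<in> Basis" for b
    proof (cases "b \<in> I")
      case True
      have "(q - p l) \<bullet> b = (q - c) \<bullet> b - (real l / real m) * ((z - c) \<bullet> b)"
        by (simp add: p_def inner_diff_left inner_add_left)
      also have "\<dots> = (t - real l / real m) * ((y - c) \<bullet> b) + (real l / real m) * ((y - z) \<bullet> b)"
        using q(1)[OF True] by (simp add: inner_diff_left algebra_simps)
      finally have "\<bar>(q - p l) \<bullet> b\<bar> \<le> \<bar>t - real l / real m\<bar> * \<bar>(y - c) \<bullet> b\<bar> + (real l / real m) * \<bar>(y - z) \<bullet> b\<bar>"
        using lm(2) by (metis abs_mult abs_of_nonneg abs_triangle_ineq)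
      also have "\<dots> \<le> \<delta> * r + 1 * \<delta>"
      proof (intro add_mono mult_mono lm)
        have "norm (y - c) = r" using y AM by (auto simp: M_def)
        then show "\<bar>(y - c) \<bullet> b\<bar> \<le> r" using Basis_le_norm[OF b, of "y - c"] by simp
        show "\<bar>(y - z) \<bullet> b\<bar> \<le> \<delta>"
          using Basis_le_norm[OF b, of "y - z"] A[OF y z] by (simp add: dist_norm)
      qed (use \<delta> in auto)
      finally show ?thesis using True b by (simp add: hb algebra_simps)
    next
      case False
      then have "(z - c) \<bullet> b = 0" using zW b by (auto simp: W_def)
      then have "(q - p l) \<bullet> b = (q - c) \<bullet> b"
        by (simp add: p_def inner_diff_left inner_add_left)
      then show ?thesis using q(2)[of b] False b by (simp add: hb)
    qed
    then have "q \<in> cbox (p l - h) (p l + h)"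
      by (auto simp: mem_box inner_diff_left inner_add_left abs_le_iff algebra_simps)
    then show "q \<in> S" using l(3) unfolding S_def by blast
  qed
  have box: "emeasure lborel (cbox (p l - h) (p l + h)) \<le> ennreal ((2 * (r + 1)) ^ (d + 1) * 2 ^ DIM('a) * \<delta> ^ (d + 1))" for l
  proof -
    have "emeasure lborel (cbox (p l - h) (p l + h)) = ennreal (\<Prod>b\<in>Basis. ((p l + h) - (p l - h)) \<bullet> b)"
      using r \<delta> by (subst emeasure_lborel_cbox) (auto simp: inner_diff_left inner_add_left hb)
    also have "(\<Prod>b\<in>Basis. ((p l + h) - (p l - h)) \<bullet> b) = (\<Prod>b\<in>Basis. if b \<in> I then 2 * (r + 1) * \<delta> else 2)"
      by (intro prod.cong) (auto simp: inner_diff_left inner_add_left hb)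
    also have "\<dots> = (\<Prod>b\<in>I. 2 * (r + 1) * \<delta>) * (\<Prod>b\<in>Basis - I. 2)"
      using I_Basis by (simp add: prod.If_cases Int_absorb1 Diff_eq)
    also have "\<dots> = (2 * (r + 1) * \<delta>) ^ (d + 1) * 2 ^ card (Basis - I)"
      using card_I by simp
    also have "\<dots> \<le> (2 * (r + 1) * \<delta>) ^ (d + 1) * 2 ^ DIM('a)"
      using r \<delta> by (intro mult_left_mono power_increasing card_mono) auto
    finally show ?thesis by (simp add: power_mult_distrib ennreal_leI mult.assoc mult.left_commute mult.commute)
  qed
  have "emeasure lborel S \<le> (\<Sum>l\<in>{..m}. emeasure lborel (cbox (p l - h) (p l + h)))"
    unfolding S_def by (intro emeasure_subadditive_finite) auto
  also have "\<dots> \<le> (\<Sum>l\<in>{..m}. ennreal ((2 * (r + 1)) ^ (d + 1) * 2 ^ DIM('a) * \<delta> ^ (d + 1)))"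
    using box by (rule sum_mono)
  also have "\<dots> = ennreal (real (m + 1) * ((2 * (r + 1)) ^ (d + 1) * 2 ^ DIM('a) * \<delta> ^ (d + 1)))"
    using r \<delta> by (subst sum_ennreal) (auto simp del: power_Suc)
  also have "\<dots> \<le> ennreal (cone_const * \<delta> ^ d)"
  proof (rule ennreal_leI)
    have "real (m + 1) * \<delta> \<le> 3" using m(2) \<delta> by (simp add: field_simps)
    then have "(real (m + 1) * \<delta>) * ((2 * (r + 1)) ^ (d + 1) * 2 ^ DIM('a) * \<delta> ^ d)
        \<le> 3 * ((2 * (r + 1)) ^ (d + 1) * 2 ^ DIM('a) * \<delta> ^ d)"
      using r \<delta> by (intro mult_right_mono) auto
    moreover have "(real (m + 1) * \<delta>) * ((2 * (r + 1)) ^ (d + 1) * 2 ^ DIM('a) * \<delta> ^ d)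
        = real (m + 1) * ((2 * (r + 1)) ^ (d + 1) * 2 ^ DIM('a) * \<delta> ^ (d + 1))"
      by simp
    ultimately show "real (m + 1) * ((2 * (r + 1)) ^ (d + 1) * 2 ^ DIM('a) * \<delta> ^ (d + 1)) \<le> cone_const * \<delta> ^ d"
      unfolding cone_const_def by (simp only: mult.assoc)
  qed
  finally show ?thesis using sub by (intro that[of S]) (auto simp: S_def)
qed

text \<open>Sets of diameter 0 must also be covered, by null sets. For these the covers for \<delta>
  = 1 / (n + 1) are intersected, whose measures tend to 0 as d \<ge> 1.\<close>

lemma thick_cone_cover:
  assumes AM: "A \<subseteq> M" and A: "bounded A" "diameter A \<le> 1"
  obtains S where "S \<in> sets borel" "thick_cone A \<subseteq> S" "emeasure lborel S \<le> ennreal (cone_const * diameter A ^ d)"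
proof (cases "diameter A = 0")
  case False
  then have "0 < diameter A" using diameter_ge_0[OF A(1)] by simp
  with A that show ?thesis
    by (metis thick_cone_small[OF AM] diameter_bounded_bound)
next
  case True
  have "\<exists>S. S \<in> sets borel \<and> thick_cone A \<subseteq> S \<and> emeasure lborel S \<le> ennreal (cone_const * (1 / real (Suc n)) ^ d)" for n
  proof -
    have "dist y z \<le> 1 / real (Suc n)" if "y \<in> A" "z \<in> A" for y z
      using diameter_bounded_bound[OF A(1) that] True by (simp add: order_trans[of _ 0])
    then show ?thesis by (metis thick_cone_small[OF AM, of "1 / real (Suc n)"] divide_le_eq_1_pos
          le_add1 of_nat_0_less_iff of_nat_1 of_nat_le_iff plus_1_eq_Suc zero_less_Suc zero_less_divide_1_iff)
  qed
  then obtain S where S: "\<And>n. S n \<in> sets borel" "\<And>n. thick_cone A \<subseteq> S n"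
      "\<And>n. emeasure lborel (S n) \<le> ennreal (cone_const * (1 / real (Suc n)) ^ d)" by metis
  have "emeasure lborel (\<Inter>n. S n) \<le> 0"
  proof (rule ennreal_le_epsilon)
    fix e :: real assume "0 < e"
    then obtain n where n: "cone_const / e < real n" using reals_Archimedean2 by blast
    have "emeasure lborel (\<Inter>n. S n) \<le> emeasure lborel (S n)"
      using S(1) by (intro emeasure_mono) auto
    also have "\<dots> \<le> ennreal (cone_const * (1 / real (Suc n)) ^ d)" by (rule S(3))
    also have "\<dots> \<le> ennreal e"
    proof (rule ennreal_leI)
      have "(1 / real (Suc n)) ^ d \<le> (1 / real (Suc n)) ^ 1"
        using d by (intro power_decreasing) auto
      then have "cone_const * (1 / real (Suc n)) ^ d \<le> cone_const * (1 / real (Suc n))"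
        using cone_const_pos by (intro mult_left_mono) auto
      also have "\<dots> \<le> e" using n \<open>0 < e\<close> by (simp add: field_simps)
      finally show "cone_const * (1 / real (Suc n)) ^ d \<le> e" .
    qed
    finally show "emeasure lborel (\<Inter>n. S n) \<le> 0 + ennreal e" by simp
  qed
  moreover have "(\<Inter>n. S n) \<in> sets borel" using S(1) by auto
  ultimately show ?thesis using S(2) that[of "\<Inter>n. S n"] by auto
qed

text \<open>Every cover of A induces a cover of the thick cone whose Lebesgue measure is controlled
  by the sum of the d-th powers of the diameters. The content at scale 1 is enough, as it is a lower
  bound of the Hausdorff measure.\<close>

lemma thick_cone_le_hausdorff:
  assumes AM: "A \<subseteq> M" and B: "B \<in> sets borel" "B \<subseteq> thick_cone A" and \<beta>: "emeasure lborel B = ennreal \<beta>" "0 \<le> \<beta>"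
  shows "ennreal (\<beta> * unit_ball_vol (real d) / (2 ^ d * cone_const)) \<le> hausdorff_outer d A"
proof -
  define v where "v = unit_ball_vol (real d)"
  have v: "0 < v" by (simp add: v_def)
  have "ennreal (\<beta> * v / (2 ^ d * cone_const)) \<le> hausdorff_content d 1 A"
    unfolding hausdorff_content_def
  proof (rule INF_greatest)
    fix U :: "nat \<Rightarrow> 'a set"
    assume "U \<in> {U. A \<subseteq> (\<Union>i. U i) \<and> (\<forall>i. bounded (U i) \<and> diameter (U i) \<le> 1)}"
    then have U: "A \<subseteq> (\<Union>i. U i)" "\<And>i. bounded (U i)" "\<And>i. diameter (U i) \<le> 1" by auto
    have "\<exists>S. S \<in> sets borel \<and> thick_cone (U i \<inter> A) \<subseteq> S \<and> emeasure lborel S \<le> ennreal (cone_const * diameter (U i) ^ d)" for i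
    proof -
      have 1: "bounded (U i \<inter> A)" using U(2) by blast
      have 2: "diameter (U i \<inter> A) \<le> diameter (U i)" using U(2) by (intro diameter_subset) auto
      obtain S where S: "S \<in> sets borel" "thick_cone (U i \<inter> A) \<subseteq> S"
          "emeasure lborel S \<le> ennreal (cone_const * diameter (U i \<inter> A) ^ d)"
        using thick_cone_cover[of "U i \<inter> A"] AM 1 2 U(3)[of i] by (metis inf.coboundedI2 order_trans)
      have "cone_const * diameter (U i \<inter> A) ^ d \<le> cone_const * diameter (U i) ^ d"
        using cone_const_pos 2 diameter_ge_0[OF 1] by (intro mult_left_mono power_mono) auto
      from order_trans[OF S(3) ennreal_leI[OF this]] S(1,2) show ?thesis by (intro exI[of _ S] conjI)
    qed
    then obtain S where S: "\<And>i. S i \<in> sets borel" "\<And>i. thick_cone (U i \<inter> A) \<subseteq> S i"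
        "\<And>i. emeasure lborel (S i) \<le> ennreal (cone_const * diameter (U i) ^ d)" by metis
    have "B \<subseteq> (\<Union>i. S i)"
    proof
      fix q assume "q \<in> B"
      then obtain y where y: "y \<in> A" and q: "q \<in> thick_cone {y}"
        using B(2) unfolding thick_cone_def by blast
      then obtain i where "y \<in> U i" using U(1) by blast
      then have "q \<in> thick_cone (U i \<inter> A)" using y q unfolding thick_cone_def by blast
      then show "q \<in> (\<Union>i. S i)" using S(2) by blast
    qed
    then have "ennreal \<beta> \<le> emeasure lborel (\<Union>i. S i)"
      unfolding \<beta>(1)[symmetric] using S(1) by (intro emeasure_mono) auto
    also have "\<dots> \<le> (\<Sum>i. emeasure lborel (S i))"
      using S(1) by (intro emeasure_subadditive_countably) auto
    also have "\<dots> \<le> (\<Sum>i. ennreal (2 ^ d * cone_const / v) * ennreal (v * (diameter (U i) / 2) ^ d))"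
    proof (intro suminf_le summableI)
      fix i
      have "ennreal (2 ^ d * cone_const / v) * ennreal (v * (diameter (U i) / 2) ^ d)
          = ennreal (2 ^ d * cone_const / v * (v * (diameter (U i) / 2) ^ d))"
        using v cone_const_pos by (intro ennreal_mult'[symmetric]) auto
      also have "2 ^ d * cone_const / v * (v * (diameter (U i) / 2) ^ d) = cone_const * diameter (U i) ^ d"
        using v by (simp add: power_divide)
      finally show "emeasure lborel (S i) \<le> ennreal (2 ^ d * cone_const / v) * ennreal (v * (diameter (U i) / 2) ^ d)"
        using S(3)[of i] by simp
    qed
    also have "\<dots> = ennreal (2 ^ d * cone_const / v) * (\<Sum>i. ennreal (v * (diameter (U i) / 2) ^ d))"
      by (rule ennreal_suminf_cmult)
    finally have "ennreal \<beta> / ennreal (2 ^ d * cone_const / v) \<le> (\<Sum>i. ennreal (v * (diameter (U i) / 2) ^ d))"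
      using v cone_const_pos by (intro divide_le_posI_ennreal) auto
    moreover have "ennreal \<beta> / ennreal (2 ^ d * cone_const / v) = ennreal (\<beta> * v / (2 ^ d * cone_const))"
      using v cone_const_pos \<beta>(2) by (subst divide_ennreal) auto
    ultimately show "ennreal (\<beta> * v / (2 ^ d * cone_const)) \<le> (\<Sum>i. ennreal (unit_ball_vol (real d) * (diameter (U i) / 2) ^ d))"
      by (simp add: v_def)
  qed
  also have "\<dots> \<le> hausdorff_outer d A" by (rule hausdorff_content_le_outer) simp
  finally show ?thesis by (simp add: v_def)
qed

text \<open>Radial projection in W is well controlled around three quarters of the radius: a
  displacement by s \<le> r / 4 keeps the projected norm between r / 2 and r. Hence t \<in>
  [1/2, 1], and t |y' - y| \<le> 2 s yields the radius 4 s.\<close>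

lemma ball_subset_thick_cone:
  assumes y: "y \<in> M" and s: "0 < s" "s \<le> r / 4" "s \<le> 1"
  shows "ball (c + (3 / 4) *\<^sub>R (y - c)) s \<subseteq> thick_cone (M \<inter> cball y (4 * s))"
proof
  fix q assume q: "q \<in> ball (c + (3 / 4) *\<^sub>R (y - c)) s"
  define \<eta> where "\<eta> = q - c - (3 / 4) *\<^sub>R (y - c)"
  have \<eta>: "norm \<eta> < s" using q by (simp add: \<eta>_def dist_norm norm_minus_commute algebra_simps)
  have qc: "q - c = (3 / 4) *\<^sub>R (y - c) + \<eta>" by (simp add: \<eta>_def)
  have yM: "y - c \<in> W" "norm (y - c) = r" using y by (auto simp: M_def)
  define \<eta>W where "\<eta>W = (\<Sum>b\<in>Basis. (if b \<in> I then \<eta> \<bullet> b else 0) *\<^sub>R b)"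
  have \<eta>b: "\<eta>W \<bullet> b = (if b \<in> I then \<eta> \<bullet> b else 0)" if "b \<in> Basis" for b
    using that by (simp add: \<eta>W_def)
  have \<eta>WW: "\<eta>W \<in> W" by (simp add: W_def \<eta>b)
  have "norm \<eta>W \<le> norm \<eta>" by (rule norm_le_componentwise) (simp add: \<eta>b)
  then have \<eta>W: "norm \<eta>W \<le> s" using \<eta> by simp
  define u where "u = (3 / 4) *\<^sub>R (y - c) + \<eta>W"
  have uW: "u \<in> W" unfolding u_def
    using subspace_W yM(1) \<eta>WW by (intro subspace_add subspace_scale)
  define t where "t = norm u / r"
  have "\<bar>norm u - norm ((3 / 4) *\<^sub>R (y - c))\<bar> \<le> norm \<eta>W"
    unfolding u_def by (rule norm_triangle_ineq3[THEN order_trans]) simp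
  then have nu: "\<bar>norm u - 3 / 4 * r\<bar> \<le> s" using \<eta>W yM by simp
  have t: "1 / 2 \<le> t" "t \<le> 1" using nu s r by (auto simp: t_def field_simps abs_le_iff)
  define y' where "y' = c + (1 / t) *\<^sub>R u"
  have "norm (y' - c) = r" using t r by (auto simp: y'_def t_def)
  moreover have "y' - c \<in> W" using subspace_scale[OF subspace_W uW] by (simp add: y'_def)
  ultimately have y'M: "y' \<in> M" by (simp add: M_def)
  have "t *\<^sub>R (y' - y) = (3 / 4 - t) *\<^sub>R (y - c) + \<eta>W"
    using t by (simp add: y'_def u_def algebra_simps scaleR_add_left[symmetric])
  then have "norm (t *\<^sub>R (y' - y)) \<le> \<bar>3 / 4 - t\<bar> * r + s"
    using norm_triangle_ineq[of "(3 / 4 - t) *\<^sub>R (y - c)" \<eta>W] \<eta>W yM(2) by simp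
  also have "\<bar>3 / 4 - t\<bar> * r = \<bar>norm u - 3 / 4 * r\<bar>"
    using r by (simp add: t_def abs_if field_simps)
  finally have "t * norm (y' - y) \<le> 2 * s" using nu t by simp
  moreover have "1 / 2 * norm (y' - y) \<le> t * norm (y' - y)" using t by (intro mult_right_mono) auto
  ultimately have "y' \<in> cball y (4 * s)" by (simp add: dist_norm norm_minus_commute)
  moreover have "(q - c) \<bullet> b = t * ((y' - c) \<bullet> b)" if "b \<in> I" for b
    using that I_Basis t by (auto simp: qc y'_def u_def inner_add_left \<eta>b)
  moreover have "\<bar>(q - c) \<bullet> b\<bar> \<le> 1" if b: "b \<in> Basis - I" for b
  proof -
    have "(q - c) \<bullet> b = \<eta> \<bullet> b" using yM(1) b by (auto simp: qc inner_add_left W_def)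
    then show ?thesis using Basis_le_norm[of b \<eta>] b \<eta> s by simp
  qed
  ultimately show "q \<in> thick_cone (M \<inter> cball y (4 * s))"
    unfolding thick_cone_def using y'M t by (intro CollectI bexI[of _ y'] bexI[of _ t]) auto
qed

text \<open>The power of s is the full dimension instead of the sharp d. This serves its two
  purposes, the mass of the sphere with s = 1 and the positivity of all small balls.\<close>

lemma hausdorff_outer_ball_ge:
  assumes y: "y \<in> M" and s: "0 < s" "s \<le> r / 4" "s \<le> 1"
  shows "ennreal (unit_ball_vol (real DIM('a)) * s ^ DIM('a) * unit_ball_vol (real d) / (2 ^ d * cone_const))
    \<le> hausdorff_outer d (M \<inter> cball y (4 * s))"
  using s by (intro thick_cone_le_hausdorff[OF _ _ ball_subset_thick_cone[OF y s]])
    (auto simp: emeasure_ball)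

end

section \<open>The two-point method\<close>

text \<open>The hypothesis is a bound on the chi-square divergence of \<open>Q\<close> from \<open>P\<close>, in a form which
  tensorises by integrating one coordinate at a time.\<close>

lemma chi_square_tensorization:
  fixes P Q :: "'a measure" and h :: "('i \<Rightarrow> 'a) \<Rightarrow> ennreal"
  assumes P: "prob_space P" and Q: "prob_space Q" and sets: "sets Q = sets P"
    and one: "\<And>h. h \<in> borel_measurable P \<Longrightarrow> (\<integral>\<^sup>+x. h x \<partial>Q)\<^sup>2 \<le> \<kappa> * (\<integral>\<^sup>+x. (h x)\<^sup>2 \<partial>P)"
    and "finite J" and "h \<in> borel_measurable (\<Pi>\<^sub>M i\<in>J. P)"
  shows "(\<integral>\<^sup>+x. h x \<partial>(\<Pi>\<^sub>M i\<in>J. Q))\<^sup>2 \<le> \<kappa> ^ card J * (\<integral>\<^sup>+x. (h x)\<^sup>2 \<partial>(\<Pi>\<^sub>M i\<in>J. P))"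
  using assms(5,6)
proof (induction J arbitrary: h rule: finite_induct)
  case empty
  show ?case by (simp add: PiM_empty nn_integral_count_space_finite)
next
  case (insert i J)
  interpret P: product_prob_space "\<lambda>_::'i. P" J
    using P by (simp add: product_prob_space_def product_prob_space_axioms_def product_sigma_finite_def prob_space_imp_sigma_finite)
  interpret Q: product_prob_space "\<lambda>_::'i. Q" J
    using Q by (simp add: product_prob_space_def product_prob_space_axioms_def product_sigma_finite_def prob_space_imp_sigma_finite)
  have setsJ: "sets (\<Pi>\<^sub>M i\<in>J. Q) = sets (\<Pi>\<^sub>M i\<in>J. P)" for J :: "'i set"
    by (rule sets_PiM_cong) (simp_all add: sets)
  note hP [measurable] = insert.prems
  have hQ [measurable]: "h \<in> borel_measurable (\<Pi>\<^sub>M i\<in>insert i J. Q)"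
    using insert.prems by (simp cong: measurable_cong_sets add: setsJ)
  have upd: "(\<lambda>(x, y). h (x(i := y))) \<in> borel_measurable ((\<Pi>\<^sub>M i\<in>J. P) \<Otimes>\<^sub>M P)"
    using measurable_compose[OF measurable_add_dim[of i J "\<lambda>_. P"] hP] by (simp add: case_prod_beta')
  then have upd': "(\<lambda>(x, y). h (x(i := y))) \<in> borel_measurable ((\<Pi>\<^sub>M i\<in>J. P) \<Otimes>\<^sub>M Q)"
    by (subst measurable_cong_sets[OF sets_pair_measure_cong[OF refl sets] refl])
  have inner: "(\<lambda>x. \<integral>\<^sup>+y. h (x(i := y)) \<partial>Q) \<in> borel_measurable (\<Pi>\<^sub>M i\<in>J. P)"
    using sigma_finite_measure.borel_measurable_nn_integral[OF prob_space_imp_sigma_finite[OF Q] upd'] .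
  have "(\<integral>\<^sup>+x. h x \<partial>(\<Pi>\<^sub>M i\<in>insert i J. Q))\<^sup>2
      = (\<integral>\<^sup>+x. (\<integral>\<^sup>+y. h (x(i := y)) \<partial>Q) \<partial>(\<Pi>\<^sub>M i\<in>J. Q))\<^sup>2"
    using Q.product_nn_integral_insert[OF insert.hyps hQ] by simp
  also have "\<dots> \<le> \<kappa> ^ card J * (\<integral>\<^sup>+x. (\<integral>\<^sup>+y. h (x(i := y)) \<partial>Q)\<^sup>2 \<partial>(\<Pi>\<^sub>M i\<in>J. P))"
    by (rule insert.IH[OF inner])
  also have "\<dots> \<le> \<kappa> ^ card J * (\<integral>\<^sup>+x. \<kappa> * (\<integral>\<^sup>+y. (h (x(i := y)))\<^sup>2 \<partial>P) \<partial>(\<Pi>\<^sub>M i\<in>J. P))"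
  proof (intro mult_left_mono nn_integral_mono one)
    fix x assume "x \<in> space (\<Pi>\<^sub>M i\<in>J. P)"
    from measurable_compose[OF measurable_Pair1'[OF this] upd]
    show "(\<lambda>y. h (x(i := y))) \<in> borel_measurable P" by simp
  qed simp
  also have "\<dots> = \<kappa> ^ card J * (\<kappa> * (\<integral>\<^sup>+x. (\<integral>\<^sup>+y. (h (x(i := y)))\<^sup>2 \<partial>P) \<partial>(\<Pi>\<^sub>M i\<in>J. P)))"
  proof -
    have "(\<lambda>(x, y). (h (x(i := y)))\<^sup>2) \<in> borel_measurable ((\<Pi>\<^sub>M i\<in>J. P) \<Otimes>\<^sub>M P)"
      using borel_measurable_power_ennreal[OF upd, of 2] by (simp add: case_prod_beta')
    from sigma_finite_measure.borel_measurable_nn_integral[OF prob_space_imp_sigma_finite[OF P] this]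
    have "(\<lambda>x. \<integral>\<^sup>+y. (h (x(i := y)))\<^sup>2 \<partial>P) \<in> borel_measurable (\<Pi>\<^sub>M i\<in>J. P)" .
    then show ?thesis by (subst nn_integral_cmult) auto
  qed
  also have "(\<integral>\<^sup>+x. (\<integral>\<^sup>+y. (h (x(i := y)))\<^sup>2 \<partial>P) \<partial>(\<Pi>\<^sub>M i\<in>J. P)) = (\<integral>\<^sup>+x. (h x)\<^sup>2 \<partial>(\<Pi>\<^sub>M i\<in>insert i J. P))"
    by (subst P.product_nn_integral_insert[OF insert.hyps]) auto
  finally show ?case using insert.hyps by (simp add: mult.assoc mult.left_commute mult.commute)
qed

text \<open>Markov's inequality gives s times \<open>a powr (1 / p)\<close>; since a \<le> 1 and p
  \<ge> 1 the root is at least a, which makes the bound independent of p.\<close>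

lemma pointwise_loss_ge:
  fixes P :: "'a::euclidean_space measure"
  assumes P: "prob_space P" "sets P = sets borel" and p: "1 \<le> p" and s: "0 \<le> s" and a: "0 \<le> a" "a \<le> 1"
    and f [measurable]: "f \<in> borel_measurable (\<Pi>\<^sub>M i\<in>{..<n}. borel)"
    and E: "ennreal a \<le> emeasure (\<Pi>\<^sub>M i\<in>{..<n}. P) {X \<in> space (\<Pi>\<^sub>M i\<in>{..<n}. P). s \<le> \<bar>f X - y\<bar>}"
  shows "ennreal (s * a) \<le> pointwise_loss n p P f y"
proof -
  let ?Pn = "\<Pi>\<^sub>M i\<in>{..<n}. P" and ?E = "{X \<in> space (\<Pi>\<^sub>M i\<in>{..<n}. P). s \<le> \<bar>f X - y\<bar>}"
  have setsn: "sets ?Pn = sets (\<Pi>\<^sub>M i\<in>{..<n}. borel :: 'a measure)"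
    by (rule sets_PiM_cong) (simp_all add: P)
  have fP [measurable]: "f \<in> borel_measurable ?Pn"
    using f by (simp cong: measurable_cong_sets add: setsn)
  define Q where "Q = (\<integral>\<^sup>+ X. ennreal (\<bar>f X - y\<bar> powr p) \<partial>?Pn)"
  have "ennreal (s powr p * a) \<le> ennreal (s powr p) * emeasure ?Pn ?E"
    using E a s by (simp add: ennreal_mult mult_left_mono)
  also have "\<dots> = (\<integral>\<^sup>+ X. ennreal (s powr p) * indicator ?E X \<partial>?Pn)"
    by (subst nn_integral_cmult_indicator) auto
  also have "\<dots> \<le> Q" unfolding Q_def
    using s p by (intro nn_integral_mono) (auto simp: indicator_def intro!: ennreal_leI powr_mono2)
  finally have Q: "ennreal (s powr p * a) \<le> Q" .
  show ?thesis
  proof (cases "Q = \<infinity>")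
    case True
    then show ?thesis by (simp add: pointwise_loss_def ennreal_powr_def Q_def[symmetric])
  next
    case False
    then have q: "s powr p * a \<le> enn2real Q"
      using Q a s by (metis enn2real_ennreal enn2real_mono mult_nonneg_nonneg powr_ge_zero top.not_eq_extremum infinity_ennreal_def)
    have "s * a \<le> s * a powr (1 / p)"
      using a s p powr_mono'[of "1 / p" 1 a] by (intro mult_left_mono) (cases "a = 0", auto)
    also have "\<dots> = (s powr p * a) powr (1 / p)"
      using s a p by (simp add: powr_mult powr_powr)
    also have "\<dots> \<le> enn2real Q powr (1 / p)" using q a s p by (intro powr_mono2) auto
    finally show ?thesis
      using False by (simp add: pointwise_loss_def ennreal_powr_def Q_def[symmetric] ennreal_leI)
  qed
qed

text \<open>Let A be the event that f misses y by s. If it has probability at least 1/12 under the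
  product of P, the loss at y is large. Otherwise its probability under the product of Q has square
  below 3/12 = 1/4, since (1 + 1 / n) ^ n \<le> 3. So the complement, on which f misses z by s, has
  probability at least 1/2.\<close>

lemma le_cam_two_points:
  fixes P Q :: "'a::euclidean_space measure"
  assumes P: "prob_space P" "sets P = sets borel" and Q: "prob_space Q" "sets Q = sets borel"
    and p: "1 \<le> p" and s: "0 \<le> s" "2 * s \<le> \<bar>y - z\<bar>" and n: "0 < n"
    and f [measurable]: "f \<in> borel_measurable (\<Pi>\<^sub>M i\<in>{..<n}. borel)"
    and one: "\<And>h. h \<in> borel_measurable P \<Longrightarrow>
      (\<integral>\<^sup>+x. h x \<partial>Q)\<^sup>2 \<le> ennreal (1 + 1 / real n) * (\<integral>\<^sup>+x. (h x)\<^sup>2 \<partial>P)"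
  shows "ennreal (s / 12) \<le> max (pointwise_loss n p P f y) (pointwise_loss n p Q f z)"
proof -
  let ?Pn = "\<Pi>\<^sub>M i\<in>{..<n}. P" and ?Qn = "\<Pi>\<^sub>M i\<in>{..<n}. Q"
  have setsP: "sets ?Pn = sets (\<Pi>\<^sub>M i\<in>{..<n}. borel :: 'a measure)"
    by (rule sets_PiM_cong) (simp_all add: P)
  have setsQ: "sets ?Qn = sets (\<Pi>\<^sub>M i\<in>{..<n}. borel :: 'a measure)"
    by (rule sets_PiM_cong) (simp_all add: Q)
  have space: "space ?Qn = space ?Pn" using setsP setsQ sets_eq_imp_space_eq by metis
  have fP [measurable]: "f \<in> borel_measurable ?Pn"
    using f by (simp cong: measurable_cong_sets add: setsP)
  have fQ [measurable]: "f \<in> borel_measurable ?Qn"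
    using f by (simp cong: measurable_cong_sets add: setsQ)
  interpret Pn: prob_space ?Pn using P by (intro prob_space_PiM) auto
  interpret Qn: prob_space ?Qn using Q by (intro prob_space_PiM) auto
  define A where "A = {X \<in> space ?Pn. s \<le> \<bar>f X - y\<bar>}"
  have AP [measurable]: "A \<in> sets ?Pn" unfolding A_def by measurable
  have AQ [measurable]: "A \<in> sets ?Qn" using AP setsP setsQ by simp
  show ?thesis
  proof (cases "1 / 12 \<le> Pn.prob A")
    case True
    then have "ennreal (1 / 12) \<le> emeasure ?Pn A" by (simp add: Pn.emeasure_eq_measure ennreal_leI)
    then have "ennreal (s * (1 / 12)) \<le> pointwise_loss n p P f y"
      unfolding A_def using P p s f by (intro pointwise_loss_ge) auto
    then show ?thesis by (simp add: le_max_iff_disj)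
  next
    case False
    have "(\<integral>\<^sup>+X. indicator A X \<partial>?Qn)\<^sup>2 \<le> ennreal (1 + 1 / real n) ^ card {..<n} * (\<integral>\<^sup>+X. (indicator A X)\<^sup>2 \<partial>?Pn)"
      using P Q one by (intro chi_square_tensorization) auto
    also have "(\<integral>\<^sup>+X. (indicator A X)\<^sup>2 \<partial>?Pn) = (\<integral>\<^sup>+X. indicator A X \<partial>?Pn)"
      by (intro nn_integral_cong) (auto simp: indicator_def)
    finally have "ennreal ((Qn.prob A)\<^sup>2) \<le> ennreal ((1 + 1 / real n) ^ n * Pn.prob A)"
      by (simp add: Qn.emeasure_eq_measure Pn.emeasure_eq_measure ennreal_power ennreal_mult
          del: ennreal_plus)
    then have "(Qn.prob A)\<^sup>2 \<le> (1 + 1 / real n) ^ n * Pn.prob A"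
      by (subst (asm) ennreal_le_iff) auto
    also have "\<dots> \<le> 3 * Pn.prob A"
    proof (intro mult_right_mono)
      have "(1 + 1 / real n) ^ n \<le> exp (1 / real n) ^ n"
        by (intro power_mono) auto
      also have "\<dots> = exp 1" using n by (simp add: exp_of_nat_mult[symmetric])
      finally show "(1 + 1 / real n) ^ n \<le> 3" using exp_le by linarith
    qed simp
    also have "\<dots> < (1 / 2)\<^sup>2" using False by (simp add: power2_eq_square)
    finally have "Qn.prob A < 1 / 2" by (rule power_less_imp_less_base) simp
    then have "1 / 2 \<le> Qn.prob (space ?Qn - A)" using AQ by (subst Qn.prob_compl) auto
    then have "ennreal (1 / 2) \<le> emeasure ?Qn (space ?Qn - A)"
      unfolding Qn.emeasure_eq_measure by (rule ennreal_leI)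
    also have "\<dots> \<le> emeasure ?Qn {X \<in> space ?Qn. s \<le> \<bar>f X - z\<bar>}"
    proof (rule emeasure_mono)
      show "space ?Qn - A \<subseteq> {X \<in> space ?Qn. s \<le> \<bar>f X - z\<bar>}"
        using s(2) space unfolding A_def by auto
    qed measurable
    finally have "ennreal (s * (1 / 2)) \<le> pointwise_loss n p Q f z"
      using Q p s f by (intro pointwise_loss_ge) auto
    moreover have "ennreal (s / 12) \<le> ennreal (s * (1 / 2))" using s by (intro ennreal_leI) simp
    ultimately show ?thesis by (simp add: le_max_iff_disj order_trans[of _ "ennreal (s * (1 / 2))"])
  qed
qed

section \<open>Perturbations of the uniform law\<close>

locale perturbed_density = finite_measure V for V :: "'a measure" +
  fixes g :: "'a \<Rightarrow> real" and A :: real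
  assumes g [measurable]: "g \<in> borel_measurable V" and g_bounds: "\<And>y. 0 \<le> g y" "\<And>y. g y \<le> 1"
    and V_pos: "0 < measure V (space V)" and A: "0 \<le> A" "2 * A * measure V (space V) \<le> 1"
begin

definition mass :: real where "mass = measure V (space V)"
definition mean :: real where "mean = (\<integral>y. g y \<partial>V) / mass"
definition perturbed :: "'a \<Rightarrow> real" where "perturbed y = 1 / mass + A * (g y - mean)"

lemma mass_pos: "0 < mass" using V_pos by (simp add: mass_def)

lemma integrable_g: "integrable V g"
  by (rule integrable_const_bound[where B = 1]) (auto simp: g_bounds)

lemma integrable_g2: "integrable V (\<lambda>y. (g y)\<^sup>2)"
  by (rule integrable_const_bound[where B = 1]) (auto simp: g_bounds power_le_one)

lemma mean_bounds: "0 \<le> mean" "mean \<le> 1"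
proof -
  show "0 \<le> mean" using mass_pos g_bounds by (simp add: mean_def)
  have "(\<integral>y. g y \<partial>V) \<le> (\<integral>y. 1 \<partial>V)"
    using integrable_g g_bounds by (intro integral_mono) auto
  then show "mean \<le> 1" using mass_pos by (simp add: mean_def mass_def)
qed

lemma A_le: "A \<le> 1 / (2 * mass)"
  using A(2) mass_pos by (simp add: mass_def field_simps)

text \<open>The deviation from the uniform density is at most A, because g and its mean lie in
  [0, 1], and A is at most half the uniform density.\<close>

lemma perturbed_bounds: "1 / (2 * mass) \<le> perturbed y" "perturbed y \<le> 2 / mass"
proof -
  have "\<bar>A * (g y - mean)\<bar> \<le> A * 1"
    unfolding abs_mult using A(1) g_bounds[of y] mean_bounds by (intro mult_mono) auto
  then have "\<bar>A * (g y - mean)\<bar> \<le> 1 / (2 * mass)" using A_le by simp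
  moreover have "1 / mass = 1 / (2 * mass) + 1 / (2 * mass)" "2 / mass = 4 * (1 / (2 * mass))"
    "0 < 1 / (2 * mass)" using mass_pos by auto
  ultimately show "1 / (2 * mass) \<le> perturbed y" "perturbed y \<le> 2 / mass" unfolding perturbed_def by linarith+
qed

lemma perturbed_pos: "0 < perturbed y"
  using perturbed_bounds(1)[of y] mass_pos by (smt (verit) zero_less_divide_1_iff)

lemma perturbed_measurable [measurable]: "perturbed \<in> borel_measurable V"
  unfolding perturbed_def[abs_def] by measurable

lemma integrable_perturbed: "integrable V perturbed"
  unfolding perturbed_def[abs_def] using integrable_g by simp

lemma integral_perturbed: "(\<integral>y. perturbed y \<partial>V) = 1"
  unfolding perturbed_def[abs_def] using integrable_g mass_pos
  by (simp add: mean_def mass_def[symmetric] right_diff_distrib)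

lemma prob_space_perturbed: "prob_space (density V (\<lambda>y. ennreal (perturbed y)))"
  by (rule prob_spaceI)
     (simp add: emeasure_density nn_integral_eq_integral integrable_perturbed perturbed_pos[THEN less_imp_le] integral_perturbed
       cong: nn_integral_cong)

lemma prob_space_uniform: "prob_space (density V (\<lambda>y. ennreal (1 / mass)))"
  by (rule prob_spaceI)
     (use mass_pos in \<open>simp add: emeasure_density emeasure_eq_measure mass_def[symmetric] ennreal_mult'[symmetric]\<close>)

text \<open>The variance is nonnegative. This shows that a bump of small square integral has a small
  mean.\<close>

lemma mean_square_le: "mean\<^sup>2 * mass \<le> (\<integral>y. (g y)\<^sup>2 \<partial>V)"
proof -
  have "0 \<le> (\<integral>y. (g y - mean)\<^sup>2 \<partial>V)" by (intro integral_nonneg_AE) auto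
  also have "(\<integral>y. (g y - mean)\<^sup>2 \<partial>V) = (\<integral>y. (g y)\<^sup>2 \<partial>V) - 2 * mean * (\<integral>y. g y \<partial>V) + mean\<^sup>2 * mass"
    unfolding power2_diff using integrable_g integrable_g2
    by (simp add: mass_def mult.commute mult.left_commute)
  also have "(\<integral>y. g y \<partial>V) = mean * mass" using mass_pos by (simp add: mean_def)
  finally show ?thesis by (simp add: power2_eq_square algebra_simps)
qed

lemma integral_perturbed_square_le:
  "(\<integral>\<^sup>+y. ennreal ((perturbed y)\<^sup>2 * mass) \<partial>V) \<le> ennreal (1 + A\<^sup>2 * mass * (\<integral>y. (g y)\<^sup>2 \<partial>V))"
proof -
  have eq: "(perturbed y)\<^sup>2 * mass = 1 / mass + 2 * A * (g y - mean) + A\<^sup>2 * mass * ((g y)\<^sup>2 - 2 * mean * g y + mean\<^sup>2)" for y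
    unfolding perturbed_def using mass_pos by (simp add: power2_eq_square field_simps)
  have int: "integrable V (\<lambda>y. (perturbed y)\<^sup>2 * mass)"
    unfolding eq using integrable_g integrable_g2 by simp
  have "(\<integral>y. (perturbed y)\<^sup>2 * mass \<partial>V) = 1 + 2 * A * ((\<integral>y. g y \<partial>V) - mean * mass)
      + A\<^sup>2 * mass * ((\<integral>y. (g y)\<^sup>2 \<partial>V) - 2 * mean * (\<integral>y. g y \<partial>V) + mean\<^sup>2 * mass)"
    unfolding eq using integrable_g integrable_g2 mass_pos by (simp add: mass_def[symmetric] mult.commute)
  also have "(\<integral>y. g y \<partial>V) = mean * mass" using mass_pos by (simp add: mean_def)
  also have "1 + 2 * A * (mean * mass - mean * mass)
      + A\<^sup>2 * mass * ((\<integral>y. (g y)\<^sup>2 \<partial>V) - 2 * mean * (mean * mass) + mean\<^sup>2 * mass)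
      = 1 + A\<^sup>2 * mass * ((\<integral>y. (g y)\<^sup>2 \<partial>V) - mean\<^sup>2 * mass)"
    by (simp add: power2_eq_square)
  also have "\<dots> \<le> 1 + A\<^sup>2 * mass * (\<integral>y. (g y)\<^sup>2 \<partial>V)"
    using mass_pos by (intro add_left_mono mult_left_mono) auto
  finally have "(\<integral>y. (perturbed y)\<^sup>2 * mass \<partial>V) \<le> 1 + A\<^sup>2 * mass * (\<integral>y. (g y)\<^sup>2 \<partial>V)" .
  then show ?thesis
    using int mass_pos by (subst nn_integral_eq_integral) (auto intro!: ennreal_leI simp del: ennreal_plus)
qed

lemma chi_square_perturbed:
  assumes h: "h \<in> borel_measurable V"
  shows "(\<integral>\<^sup>+y. h y \<partial>(density V (\<lambda>y. ennreal (perturbed y))))\<^sup>2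
    \<le> ennreal (1 + A\<^sup>2 * mass * (\<integral>y. (g y)\<^sup>2 \<partial>V)) * (\<integral>\<^sup>+y. (h y)\<^sup>2 \<partial>(density V (\<lambda>y. ennreal (1 / mass))))"
proof -
  note h [measurable]
  \<comment> \<open>The factor c distributes the uniform density over the two factors of the
    Cauchy-Schwarz inequality: the square of 1 / c is 1 / mass, so the second integral is one
    against the uniform law.\<close>
  define c where "c = sqrt mass"
  have c: "0 < c" "c\<^sup>2 = mass" using mass_pos by (auto simp: c_def)
  have "(\<integral>\<^sup>+y. h y \<partial>(density V (\<lambda>y. ennreal (perturbed y)))) = (\<integral>\<^sup>+y. ennreal (perturbed y * c) * (ennreal (1 / c) * h y) \<partial>V)"
  proof (subst nn_integral_density)
    have "ennreal (perturbed y) = ennreal (perturbed y * c) * ennreal (1 / c)" for y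
      using c perturbed_pos[of y] by (subst ennreal_mult[symmetric]) auto
    then show "(\<integral>\<^sup>+y. ennreal (perturbed y) * h y \<partial>V) = (\<integral>\<^sup>+y. ennreal (perturbed y * c) * (ennreal (1 / c) * h y) \<partial>V)"
      by (simp add: mult.assoc)
  qed auto
  also have "\<dots>\<^sup>2 \<le> (\<integral>\<^sup>+y. (ennreal (perturbed y * c))\<^sup>2 \<partial>V) * (\<integral>\<^sup>+y. (ennreal (1 / c) * h y)\<^sup>2 \<partial>V)"
    by (rule Cauchy_Schwarz_nn_integral) measurable
  also have "(\<integral>\<^sup>+y. (ennreal (perturbed y * c))\<^sup>2 \<partial>V) = (\<integral>\<^sup>+y. ennreal ((perturbed y)\<^sup>2 * mass) \<partial>V)"
    using c perturbed_pos by (simp add: ennreal_power less_imp_le power_mult_distrib)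
  also have "(\<integral>\<^sup>+y. (ennreal (1 / c) * h y)\<^sup>2 \<partial>V) = (\<integral>\<^sup>+y. (h y)\<^sup>2 \<partial>(density V (\<lambda>y. ennreal (1 / mass))))"
  proof -
    have "(ennreal (1 / c) * h y)\<^sup>2 = ennreal (1 / mass) * (h y)\<^sup>2" for y
      using c by (simp add: power_mult_distrib ennreal_power power_divide)
    then show ?thesis by (subst nn_integral_density) auto
  qed
  finally show ?thesis
    by (rule order_trans[OF _ mult_right_mono[OF integral_perturbed_square_le]]) simp
qed

end

section \<open>The perturbed densities\<close>

lemma has_derivative_add_const_iff:
  "((\<lambda>x. f x + k) has_derivative D) F \<longleftrightarrow> (f has_derivative D) F"
  using has_derivative_add[of f D F "\<lambda>_. k" "\<lambda>_. 0"]
    has_derivative_add[of "\<lambda>x. f x + k" D F "\<lambda>_. - k" "\<lambda>_. 0"] by auto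

lemma frechet_derivative_add_const:
  "frechet_derivative (\<lambda>x. f x + k) F = frechet_derivative f F"
  unfolding frechet_derivative_def has_derivative_add_const_iff ..

lemma times_differentiable_on_add_const:
  "times_differentiable_on n H U (\<lambda>x. f x + k) \<longleftrightarrow> times_differentiable_on n H U f"
  by (cases n) (simp_all add: frechet_derivative_add_const differentiable_on_def differentiable_def
      has_derivative_add_const_iff)

lemma iter_deriv_add_const:
  "iter_deriv U us (\<lambda>x. f x + k) v - iter_deriv U us (\<lambda>x. f x + k) w
    = iter_deriv U us f v - iter_deriv U us f w"
  by (cases us) (simp_all add: frechet_derivative_add_const)

text \<open>Derivatives annihilate constants, and at order 0 they cancel in the difference. This
  removes the normalising constant of a density and allows the inclusion to be shifted to the centre
  of the sphere.\<close>

lemma local_holder_norm_add_const: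
  "local_holder_norm \<gamma> M (\<lambda>y. f y + k) z = local_holder_norm \<gamma> M f z"
  by (simp add: local_holder_norm_def Let_def o_def iter_deriv_add_const)

lemma holder_on_add_const: "holder_on \<gamma> M (\<lambda>y. f y + k) \<longleftrightarrow> holder_on \<gamma> M f"
  by (simp add: holder_on_def o_def times_differentiable_on_add_const local_holder_norm_add_const)

lemma holder_norm_add_const: "holder_norm \<gamma> M (\<lambda>y. f y + k) = holder_norm \<gamma> M f"
  unfolding holder_norm_def by (simp add: local_holder_norm_add_const)

lemma sinc_bounds:
  fixes s :: real
  shows "\<bar>sinc s\<bar> \<le> 1" and "0 < s \<Longrightarrow> \<bar>sinc s\<bar> \<le> 1 / s"
proof -
  show "\<bar>sinc s\<bar> \<le> 1" using abs_sin_x_le_abs_x[of s] by (simp add: divide_le_eq_1)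
  show "\<bar>sinc s\<bar> \<le> 1 / s" if "0 < s" using that by (simp add: divide_right_mono)
qed

definition sinc_bump :: "nat \<Rightarrow> real \<Rightarrow> 'a::euclidean_space \<Rightarrow> 'a \<Rightarrow> real" where
  "sinc_bump m N x y = sinc (N * norm (y - x)) ^ (2 * m)"

lemma sinc_bump_bounds: "0 \<le> sinc_bump m N x y" "sinc_bump m N x y \<le> 1"
proof -
  show "0 \<le> sinc_bump m N x y" by (simp add: sinc_bump_def power_mult)
  have "sinc_bump m N x y = \<bar>sinc (N * norm (y - x))\<bar> ^ (2 * m)"
    unfolding sinc_bump_def by (simp only: power_mult power2_abs)
  also have "\<dots> \<le> 1" by (intro power_le_one sinc_bounds abs_ge_zero)
  finally show "sinc_bump m N x y \<le> 1" .
qed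

lemma sinc_bump_center: "sinc_bump m N x x = 1"
  by (simp add: sinc_bump_def)

lemma sinc_bump_measurable [measurable]: "sinc_bump m N x \<in> borel_measurable borel"
  unfolding sinc_bump_def[abs_def] by measurable

lemma sinc_bump_decay:
  assumes "0 < N * norm (y - x)"
  shows "(sinc_bump m N x y)\<^sup>2 \<le> (1 / (N * norm (y - x))) ^ (4 * m)"
proof -
  have "(sinc_bump m N x y)\<^sup>2 = \<bar>sinc (N * norm (y - x))\<bar> ^ (4 * m)"
  proof -
    have "4 * m = 2 * (2 * m)" by simp
    then show ?thesis unfolding sinc_bump_def by (simp only: power_mult power2_abs mult.commute)
      (simp only: power_mult[symmetric] mult.commute)
  qed
  also have "\<dots> \<le> (1 / (N * norm (y - x))) ^ (4 * m)"
    using sinc_bounds(2)[OF assms] by (intro power_mono) auto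
  finally show ?thesis .
qed

context subspace_sphere
begin

lemma M_borel [measurable]: "M \<in> sets borel"
  using compact_M by (simp add: borel_closed compact_imp_closed)

lemma tangent_space_perp: "z \<in> M \<Longrightarrow> v \<in> tangent_space M z \<Longrightarrow> v \<bullet> (z - c) = 0"
  by (simp add: tangent_space_M)

text \<open>Cauchy radius r per derivative, hence strip width k r, turns the exponential bound into
  2 r K ^ k with K = exp 2 / r. For r \<ge> 9 this K is at most 1, and
  \<open>K powr \<gamma>\<close> disappears for every \<gamma>.\<close>

lemma identity_holder:
  assumes \<gamma>: "0 < \<gamma>" and r9: "9 \<le> r"
  shows "holder_on \<gamma> M (\<lambda>y. y)" and "holder_norm \<gamma> M (\<lambda>y. y) \<le> ennreal (4 * r * real DIM('a))"
proof -
  define K where "K = exp 2 / r"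
  have K0: "0 < K" using r by (simp add: K_def)
  have "exp 2 = (exp 1)\<^sup>2" by (simp add: exp_double[of 1, simplified])
  also have "\<dots> \<le> (3::real)\<^sup>2" using exp_le by (intro power_mono) auto
  finally have K1: "K \<le> 1" using r9 r by (simp add: K_def)
  have main: "local_holder_norm \<gamma> M (\<lambda>y. y - c) z \<le> ennreal (real DIM('a) * (2 * (2 * r) * K powr \<gamma>))"
    "times_differentiable_on k (tangent_space M z) (normal_ball M z) ((\<lambda>y. y - c) \<circ> exp_map M z)"
    if z: "z \<in> M" for z k
  proof -
    let ?T = "tangent_space M z" and ?F = "cx_sphere_exp r (z - c)"
    have nz: "norm (z - c) = r" using z by (simp add: M_def)
    have H: "subspace ?T" by (rule subspace_tangent_space[OF z])
    have F: "cx_fun UNIV (?F b)" for b by (rule cx_fun_sphere_exp)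
    have f: "exp_map M z v - c = (\<Sum>b\<in>Basis. Re (?F b (v, 0)) *\<^sub>R b)" if "v \<in> ?T" for v
      by (simp add: exp_map_M[OF z that] cx_sphere_exp_real[OF r] euclidean_representation)
    have B: "norm (cx_iter UNIV us (?F b) (v, 0)) \<le> 2 * r * K ^ length us"
      if b: "b \<in> Basis" and us: "set us \<subseteq> ?T \<inter> cball 0 1" and v: "v \<in> ?T" for b us v
    proof -
      have "norm (cx_iter UNIV us (?F b) (v, 0)) \<le> 2 * r * exp (2 * real (length us)) / r ^ length us"
      proof (rule cx_iter_bound[OF F r H, where t = "real (length us) * r"])
        fix q assume q: "fst q \<in> ?T" "snd q \<in> ?T" "norm (snd q) \<le> real (length us) * r"
        have "cmod (?F b q) \<le> 2 * r * exp (2 * norm (snd q) / r)"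
          using q tangent_space_perp[OF z] by (intro cmod_sphere_exp_le[OF r nz _ _ b]) auto
        also have "\<dots> \<le> 2 * r * exp (2 * real (length us))"
          using q r by (simp add: field_simps)
        finally show "cmod (?F b q) \<le> 2 * r * exp (2 * real (length us))" .
      qed (use us v H in \<open>auto simp: subspace_0\<close>)
      also have "\<dots> = 2 * r * K ^ length us"
        by (simp add: K_def power_divide exp_of_nat_mult[symmetric] mult.commute)
      finally show ?thesis .
    qed
    show "local_holder_norm \<gamma> M (\<lambda>y. y - c) z \<le> ennreal (real DIM('a) * (2 * (2 * r) * K powr \<gamma>))"
      by (rule local_holder_norm_cx[OF \<gamma> K0 H F f B])
    show "times_differentiable_on k ?T (normal_ball M z) ((\<lambda>y. y - c) \<circ> exp_map M z)"
      by (rule times_differentiable_on_exp_map_cx[OF \<gamma> K0 H F f B])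
  qed
  have eq: "(\<lambda>y::'a. y) = (\<lambda>y. (y - c) + c)" by simp
  have "holder_on \<gamma> M (\<lambda>y. y - c)"
    unfolding holder_on_def using main by (auto intro!: le_less_trans[OF main(1)])
  then show "holder_on \<gamma> M (\<lambda>y. y)" by (subst eq) (simp only: holder_on_add_const)
  have "K powr \<gamma> \<le> 1" using K0 K1 \<gamma> by (simp add: powr_le1)
  then have "real DIM('a) * (2 * (2 * r) * K powr \<gamma>) \<le> real DIM('a) * (2 * (2 * r) * 1)"
    using r by (intro mult_left_mono) auto
  then have le: "ennreal (real DIM('a) * (2 * (2 * r) * K powr \<gamma>)) \<le> ennreal (4 * r * real DIM('a))"
    by (intro ennreal_leI) (simp add: mult.commute)
  have "holder_norm \<gamma> M (\<lambda>y. y - c) \<le> ennreal (4 * r * real DIM('a))"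
    unfolding holder_norm_def using main(1) le by (intro SUP_least) (rule order_trans)
  then show "holder_norm \<gamma> M (\<lambda>y. y) \<le> ennreal (4 * r * real DIM('a))"
    by (subst eq) (simp only: holder_norm_add_const)
qed

text \<open>Cauchy radius 1 / N per derivative, at a cost of N exp (4 m) each. The condition on N
  keeps the strip for all orders up to \<open>Suc (holder_order \<beta>)\<close> within the width r
  on which \<open>cmod_bump_le\<close> holds.\<close>

lemma sinc_bump_holder:
  fixes m :: nat
  assumes \<beta>: "0 < \<beta>" and N: "0 < N" "real (Suc (holder_order \<beta>)) \<le> N * r" and A: "0 \<le> A"
  defines "K \<equiv> N * exp (4 * real m)"
  shows "holder_on \<beta> M (\<lambda>y. A * sinc_bump m N x y)"
    and "holder_norm \<beta> M (\<lambda>y. A * sinc_bump m N x y) \<le> ennreal (2 * A * K powr \<beta>)"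
proof -
  have K0: "0 < K" using N by (simp add: K_def)
  have main: "local_holder_norm \<beta> M (\<lambda>y. A * sinc_bump m N x y) z \<le> ennreal (real DIM(real) * (2 * A * K powr \<beta>))"
    "times_differentiable_on k (tangent_space M z) (normal_ball M z) ((\<lambda>y. A * sinc_bump m N x y) \<circ> exp_map M z)"
    if z: "z \<in> M" for z k
  proof -
    let ?T = "tangent_space M z"
    define F :: "real \<Rightarrow> 'a \<times> 'a \<Rightarrow> complex" where "F = (\<lambda>_ p. of_real A * cx_bump N m r (z - c) (x - c) p)"
    have nz: "norm (z - c) = r" using z by (simp add: M_def)
    have H: "subspace ?T" by (rule subspace_tangent_space[OF z])
    have F: "cx_fun UNIV (F b)" for b
      unfolding F_def by (intro cx_mult cx_const cx_fun_bump)
    have f: "A * sinc_bump m N x (exp_map M z v) = (\<Sum>b\<in>Basis. Re (F b (v, 0)) *\<^sub>R b)" if "v \<in> ?T" for v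
    proof -
      have "exp_map M z v - x = sphere_exp r (z - c) v - (x - c)"
        by (simp add: exp_map_M[OF z that])
      then have "F 1 (v, 0) = of_real (A * sinc_bump m N x (exp_map M z v))"
        by (simp only: F_def cx_bump_real[OF r] sinc_bump_def of_real_mult)
      then show ?thesis by simp
    qed
    have B: "norm (cx_iter UNIV us (F b) (v, 0)) \<le> A * K ^ length us"
      if us: "set us \<subseteq> ?T \<inter> cball 0 1" and v: "v \<in> ?T" and len: "length us \<le> Suc (holder_order \<beta>)" for b us v
    proof -
      have small: "real (length us) * (1 / N) \<le> r"
      proof -
        have "real (length us) \<le> N * r" using len N(2) by linarith
        then show ?thesis using N by (simp add: field_simps)
      qed
      have "norm (cx_iter UNIV us (F b) (v, 0)) \<le> (A * exp (4 * real m * real (length us))) / (1 / N) ^ length us"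
      proof (rule cx_iter_bound[OF F _ H, where t = "real (length us) * (1 / N)"])
        fix q assume q: "fst q \<in> ?T" "snd q \<in> ?T" "norm (snd q) \<le> real (length us) * (1 / N)"
        have "cmod (cx_bump N m r (z - c) (x - c) q) \<le> exp (4 * real m * N * norm (snd q))"
          using q N small tangent_space_perp[OF z] by (intro cmod_bump_le[OF r nz]) auto
        also have "\<dots> \<le> exp (4 * real m * real (length us))"
        proof -
          have "N * norm (snd q) \<le> real (length us)" using q N by (simp add: field_simps)
          then have "4 * real m * (N * norm (snd q)) \<le> 4 * real m * real (length us)"
            by (intro mult_left_mono) auto
          then show ?thesis by (simp add: mult.assoc)
        qed
        finally show "cmod (F b q) \<le> A * exp (4 * real m * real (length us))"
          using A by (simp add: F_def norm_mult mult_left_mono)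
      qed (use us v H N in \<open>auto simp: subspace_0\<close>)
      also have "\<dots> = A * K ^ length us"
        using N by (simp add: K_def power_divide power_mult_distrib exp_of_nat_mult[symmetric] mult.commute)
      finally show ?thesis .
    qed
    show "local_holder_norm \<beta> M (\<lambda>y. A * sinc_bump m N x y) z \<le> ennreal (real DIM(real) * (2 * A * K powr \<beta>))"
      by (rule local_holder_norm_cx[OF \<beta> K0 H F f B])
    show "times_differentiable_on k ?T (normal_ball M z) ((\<lambda>y. A * sinc_bump m N x y) \<circ> exp_map M z)"
      by (rule times_differentiable_on_exp_map_cx[OF \<beta> K0 H F f B])
  qed
  show "holder_on \<beta> M (\<lambda>y. A * sinc_bump m N x y)"
    unfolding holder_on_def using main by (auto intro!: le_less_trans[OF main(1)])
  show "holder_norm \<beta> M (\<lambda>y. A * sinc_bump m N x y) \<le> ennreal (2 * A * K powr \<beta>)"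
    unfolding holder_norm_def using main(1) by (intro SUP_least) simp
qed

section \<open>Mass and support of measures on the sphere\<close>

definition ball_const :: real where
  "ball_const = 2 * real (d + 1) * unit_ball_vol (real d) * (3 * real d) ^ d"

definition mass_lower :: real where
  "mass_lower = unit_ball_vol (real DIM('a)) * unit_ball_vol (real d) / (2 ^ d * cone_const)"

definition mass_upper :: real where
  "mass_upper = ball_const * (2 * r) ^ d"

abbreviation V :: "'a measure" where "V \<equiv> volume_measure d M"

lemma ball_const_pos: "0 < ball_const" using d by (simp add: ball_const_def)

lemma mass_bounds_pos: "0 < mass_lower" "0 < mass_upper"
  using r cone_const_pos ball_const_pos by (simp_all add: mass_lower_def mass_upper_def)

lemma emeasure_V: "A \<in> sets borel \<Longrightarrow> emeasure V A = hausdorff_outer d (M \<inter> A)"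
  using emeasure_volume_measure[OF d M_borel] by (simp add: Int_commute)

lemma emeasure_V_cball_le: "0 < \<rho> \<Longrightarrow> emeasure V (cball y \<rho>) \<le> ennreal (ball_const * \<rho> ^ d)"
  using hausdorff_outer_ball_le[of \<rho> y] by (simp add: emeasure_V ball_const_def)

lemma emeasure_V_UNIV_le: "emeasure V UNIV \<le> ennreal mass_upper"
proof -
  have "M \<subseteq> cball c (2 * r)" using r by (auto simp: M_def dist_norm norm_minus_commute)
  then have "emeasure V UNIV = emeasure V (cball c (2 * r))"
    by (simp add: emeasure_V Int_absorb2)
  then show ?thesis using emeasure_V_cball_le[of "2 * r" c] r by (simp add: mass_upper_def)
qed

sublocale V: finite_measure V
  by (rule finite_measureI) (use emeasure_V_UNIV_le in \<open>auto simp: top_unique\<close>)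

lemma mass_le: "measure V (space V) \<le> mass_upper"
  using emeasure_V_UNIV_le mass_bounds_pos by (simp add: V.emeasure_eq_measure)

lemma mass_ge:
  assumes "9 \<le> r"
  shows "mass_lower \<le> measure V (space V)"
proof -
  have "ennreal mass_lower \<le> hausdorff_outer d (M \<inter> cball (c + r *\<^sub>R e0) (4 * 1))"
    using hausdorff_outer_ball_ge[OF pole_M, of 1] assms by (simp add: mass_lower_def)
  also have "\<dots> \<le> hausdorff_outer d (M \<inter> UNIV)" by (intro hausdorff.mono) auto
  also have "\<dots> = ennreal (measure V (space V))"
    by (subst emeasure_V[symmetric]) (auto simp: V.emeasure_eq_measure)
  finally show ?thesis by (simp add: ennreal_le_iff)
qed

lemma emeasure_V_open_pos:
  assumes "open U" "y \<in> U" "y \<in> M"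
  shows "0 < emeasure V U"
proof -
  obtain e where e: "0 < e" "cball y e \<subseteq> U" using assms(1,2) open_contains_cball by blast
  define s where "s = Min {e / 4, r / 4, 1}"
  have s: "0 < s" "s \<le> r / 4" "s \<le> 1" "4 * s \<le> e" using e r by (auto simp: s_def min_def)
  have "0 < ennreal (unit_ball_vol (real DIM('a)) * s ^ DIM('a) * unit_ball_vol (real d) / (2 ^ d * cone_const))"
    using s cone_const_pos by simp
  also have "\<dots> \<le> hausdorff_outer d (M \<inter> cball y (4 * s))"
    using s assms(3) by (intro hausdorff_outer_ball_ge)
  also have "\<dots> \<le> hausdorff_outer d (M \<inter> U)"
    using e s by (intro hausdorff.mono) auto
  also have "\<dots> = emeasure V U" using assms(1) by (simp add: emeasure_V)
  finally show ?thesis .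
qed

lemma measure_support_density:
  assumes f [measurable]: "f \<in> borel_measurable borel" and k: "0 < k" "\<And>y. k \<le> f y"
  shows "measure_support (density V (\<lambda>y. ennreal (f y))) = M"
proof (intro equalityI subsetI)
  fix y assume y: "y \<in> measure_support (density V (\<lambda>y. ennreal (f y)))"
  show "y \<in> M"
  proof (rule ccontr)
    assume "y \<notin> M"
    moreover have "open (- M)" using compact_M compact_imp_closed by blast
    ultimately have "emeasure (density V (\<lambda>y. ennreal (f y))) (- M) \<noteq> 0"
      using y by (simp add: measure_support_def)
    moreover have "- M \<in> null_sets V"
      by (auto simp: null_sets_def emeasure_V hausdorff.empty)
    then have "AE y in V. y \<notin> - M" by (rule AE_not_in)
    then have "(\<integral>\<^sup>+y. ennreal (f y) * indicator (- M) y \<partial>V) = (\<integral>\<^sup>+y. 0 \<partial>V)"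
      by (intro nn_integral_cong_AE) auto
    then have "emeasure (density V (\<lambda>y. ennreal (f y))) (- M) = 0"
      by (subst emeasure_density) auto
    ultimately show False by simp
  qed
next
  fix y assume y: "y \<in> M"
  show "y \<in> measure_support (density V (\<lambda>y. ennreal (f y)))"
    unfolding measure_support_def
  proof (intro CollectI allI impI)
    fix U assume U: "open U \<and> y \<in> U"
    have "0 < ennreal k * emeasure V U"
      using emeasure_V_open_pos[of U y] U y k by (simp add: ennreal_zero_less_mult_iff)
    also have "\<dots> = (\<integral>\<^sup>+y. ennreal k * indicator U y \<partial>V)"
      using U by (subst nn_integral_cmult_indicator) auto
    also have "\<dots> \<le> (\<integral>\<^sup>+y. ennreal (f y) * indicator U y \<partial>V)"
      using k by (intro nn_integral_mono mult_right_mono ennreal_leI) auto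
    also have "\<dots> = emeasure (density V (\<lambda>y. ennreal (f y))) U"
      using U by (subst emeasure_density) auto
    finally show "emeasure (density V (\<lambda>y. ennreal (f y))) U \<noteq> 0" by simp
  qed
qed

text \<open>Dyadic decomposition around x: at distance of order 2 ^ j / N the square is of order 2 ^
  (- j (d + 1)), against a volume of order (2 ^ j / N) ^ d. The products form a geometric series of
  ratio 1/2 with sum of order N ^ (- d).\<close>

lemma sinc_bump_square_integral_le:
  assumes N: "0 < N" and m: "d + 1 \<le> 4 * m"
  shows "(\<integral>y. (sinc_bump m N x y)\<^sup>2 \<partial>V) \<le> ball_const * 2 ^ (d + 2) / N ^ d"
proof -
  \<comment> \<open>The value 2 ^ (- (j - 1) (d + 1)), from the inner radius of the ring with index
    j; for j = 0 it exceeds the trivial bound 1.\<close>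
  define a where "a = (\<lambda>j::nat. 2 ^ (d + 1) / (2 ^ (d + 1)) ^ j :: real)"
  define B where "B = (\<lambda>j::nat. cball x (2 ^ j / N))"
  have pt: "ennreal ((sinc_bump m N x y)\<^sup>2) \<le> (\<Sum>j. ennreal (a j) * indicator (B j) y)" for y
  proof -
    let ?s = "N * norm (y - x)"
    obtain k :: nat where "?s < 2 ^ k" using real_arch_pow[of 2 ?s] by auto
    then have ex: "?s \<le> 2 ^ k" by simp
    define j where "j = (LEAST j. ?s \<le> 2 ^ j)"
    have j: "?s \<le> 2 ^ j" unfolding j_def using ex by (rule LeastI)
    have le: "(sinc_bump m N x y)\<^sup>2 \<le> a j"
    proof (cases j)
      case 0
      have "(sinc_bump m N x y)\<^sup>2 \<le> 1" by (intro power_le_one sinc_bump_bounds)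
      also have "(1::real) \<le> a 0" unfolding a_def by (simp add: one_le_power del: power_Suc)
      finally show ?thesis using 0 by simp
    next
      case (Suc i)
      have "\<not> ?s \<le> 2 ^ i"
        using not_less_Least[of i "\<lambda>j. ?s \<le> 2 ^ j"] Suc unfolding j_def[symmetric] by simp
      then have i: "2 ^ i < ?s" by simp
      then have s1: "1 < ?s" using one_le_power[of "2::real" i] by linarith
      have "(sinc_bump m N x y)\<^sup>2 \<le> (1 / ?s) ^ (4 * m)"
        using s1 by (intro sinc_bump_decay) simp
      also have "\<dots> \<le> (1 / ?s) ^ (d + 1)"
        using s1 m by (intro power_decreasing) auto
      also have "\<dots> \<le> (1 / 2 ^ i) ^ (d + 1)"
        using i s1 by (intro power_mono divide_left_mono) auto
      also have "\<dots> = a j"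
        unfolding a_def Suc by (simp add: power_divide power_mult[symmetric] power_add mult.commute)
      finally show ?thesis .
    qed
    have yB: "y \<in> B j" using j N by (simp add: B_def dist_norm norm_minus_commute field_simps)
    have "(\<Sum>j\<in>{j}. ennreal (a j) * indicator (B j) y) \<le> (\<Sum>j. ennreal (a j) * indicator (B j) y)"
      by (rule sum_le_suminf) (auto intro: summableI)
    then show ?thesis using le yB by (auto intro: order_trans[OF ennreal_leI])
  qed
  have "(\<integral>\<^sup>+y. ennreal ((sinc_bump m N x y)\<^sup>2) \<partial>V) \<le> (\<integral>\<^sup>+y. (\<Sum>j. ennreal (a j) * indicator (B j) y) \<partial>V)"
    by (intro nn_integral_mono pt)
  also have "\<dots> = (\<Sum>j. \<integral>\<^sup>+y. ennreal (a j) * indicator (B j) y \<partial>V)"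
  proof (rule nn_integral_suminf)
    fix j
    have "B j \<in> sets V" by (simp add: B_def)
    then show "(\<lambda>y. ennreal (a j) * indicator (B j) y) \<in> borel_measurable V" by measurable
  qed
  also have "\<dots> = (\<Sum>j. ennreal (a j) * emeasure V (B j))"
    by (subst nn_integral_cmult_indicator) (auto simp: B_def)
  also have "\<dots> \<le> (\<Sum>j. ennreal (ball_const * 2 ^ (d + 1) / N ^ d * (1 / 2) ^ j))"
  proof (intro suminf_le summableI)
    fix j
    have "ennreal (a j) * emeasure V (B j) \<le> ennreal (a j) * ennreal (ball_const * (2 ^ j / N) ^ d)"
      unfolding B_def using N by (intro mult_left_mono emeasure_V_cball_le) auto
    also have "\<dots> = ennreal (a j * (ball_const * (2 ^ j / N) ^ d))"
      using N ball_const_pos by (intro ennreal_mult[symmetric]) (auto simp: a_def)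
    also have "a j * (ball_const * (2 ^ j / N) ^ d) = ball_const * 2 ^ (d + 1) / N ^ d * (1 / 2) ^ j"
      unfolding a_def
      by (simp add: power_divide power_mult[symmetric] power_add power_mult_distrib mult.commute field_simps)
    finally show "ennreal (a j) * emeasure V (B j) \<le> ennreal (ball_const * 2 ^ (d + 1) / N ^ d * (1 / 2) ^ j)" .
  qed
  also have "\<dots> = ennreal (\<Sum>j. ball_const * 2 ^ (d + 1) / N ^ d * (1 / 2) ^ j)"
    using N ball_const_pos by (intro suminf_ennreal2) (auto intro!: summable_mult)
  also have "(\<Sum>j. ball_const * 2 ^ (d + 1) / N ^ d * (1 / 2) ^ j) = ball_const * 2 ^ (d + 2) / N ^ d"
    by (subst suminf_mult) (auto simp: suminf_geometric)
  finally have le: "(\<integral>\<^sup>+y. ennreal ((sinc_bump m N x y)\<^sup>2) \<partial>V) \<le> ennreal (ball_const * 2 ^ (d + 2) / N ^ d)" .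
  have "integrable V (\<lambda>y. (sinc_bump m N x y)\<^sup>2)"
    by (rule V.integrable_const_bound[where B = 1]) (auto simp: sinc_bump_bounds power_le_one)
  then have "(\<integral>\<^sup>+y. ennreal ((sinc_bump m N x y)\<^sup>2) \<partial>V) = ennreal (\<integral>y. (sinc_bump m N x y)\<^sup>2 \<partial>V)"
    by (rule nn_integral_eq_integral) simp
  with le show ?thesis
    using N ball_const_pos by (simp add: ennreal_le_iff)
qed

lemma perturbed_density_sinc_bump:
  assumes "9 \<le> r" "0 \<le> A" "2 * A * mass_upper \<le> 1"
  shows "perturbed_density V (sinc_bump m N x) A"
proof
  show "sinc_bump m N x \<in> borel_measurable V" by measurable
  show "0 < measure V (space V)" using mass_ge assms(1) mass_bounds_pos by linarith
  have "2 * A * measure V (space V) \<le> 2 * A * mass_upper"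
    using mass_le assms by (intro mult_left_mono) auto
  then show "2 * A * measure V (space V) \<le> 1" using assms(3) by linarith
qed (use assms sinc_bump_bounds in auto)

section \<open>The two hypotheses and the risk bound\<close>

definition bumped :: "nat \<Rightarrow> real \<Rightarrow> 'a \<Rightarrow> real \<Rightarrow> 'a \<Rightarrow> real" where
  "bumped m N x A = perturbed_density.perturbed V (sinc_bump m N x) A"

text \<open>Serves for both hypotheses, since A = 0 yields the uniform density.\<close>

lemma bumped_in_model:
  assumes r9: "9 \<le> r" and \<tau>: "0 \<le> \<tau>" "\<tau> < r" and x: "x \<in> M" and \<alpha>: "0 \<le> \<alpha>" and \<beta>: "0 < \<beta>"
    and L: "4 * r * real DIM('a) \<le> L" and fmin: "fmin \<le> 1 / (2 * mass_upper)" and fmax: "2 / mass_lower \<le> fmax"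
    and N: "0 < N" "real (Suc (holder_order \<beta>)) \<le> N * r"
    and A: "0 \<le> A" "2 * A * mass_upper \<le> 1" "2 * A * (N * exp (4 * real m)) powr \<beta> \<le> R"
  shows "density V (\<lambda>y. ennreal (bumped m N x A y)) \<in> statistical_model d \<alpha> \<beta> x \<tau> L fmin fmax R"
    and "bumped m N x A \<in> admissible_densities d \<beta> fmin fmax R (density V (\<lambda>y. ennreal (bumped m N x A y)))"
proof -
  interpret P: perturbed_density V "sinc_bump m N x" A
    by (rule perturbed_density_sinc_bump[OF r9 A(1,2)])
  define f where "f = bumped m N x A"
  have f: "f = P.perturbed" by (simp add: f_def bumped_def)
  define k where "k = 1 / P.mass - A * P.mean"
  have fk: "f = (\<lambda>y. A * sinc_bump m N x y + k)"
    by (simp add: f P.perturbed_def fun_eq_iff k_def algebra_simps)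
  have f_meas: "f \<in> borel_measurable borel" unfolding fk by measurable
  have low: "1 / (2 * P.mass) \<le> f y" and up: "f y \<le> 2 / P.mass" for y
    unfolding f by (rule P.perturbed_bounds)+
  have mass: "mass_lower \<le> P.mass" "P.mass \<le> mass_upper"
    unfolding P.mass_def using mass_ge[OF r9] mass_le by auto
  have "1 / (2 * mass_upper) \<le> 1 / (2 * P.mass)"
    using mass P.mass_pos by (intro divide_left_mono) auto
  then have fmin': "fmin \<le> f y" for y using low[of y] fmin by linarith
  have "2 / P.mass \<le> 2 / mass_lower"
    using mass mass_bounds_pos by (intro divide_left_mono) auto
  then have fmax': "f y \<le> fmax" for y using up[of y] fmax by linarith
  have supp: "measure_support (density V (\<lambda>y. ennreal (f y))) = M"
    using f_meas low P.mass_pos by (intro measure_support_density[of f "1 / (2 * P.mass)"]) auto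
  have "holder_norm \<beta> M f \<le> ennreal R"
    unfolding fk holder_norm_add_const using A(3)
    by (intro order_trans[OF sinc_bump_holder(2)[OF \<beta> N A(1)] ennreal_leI])
  moreover have "holder_on \<beta> M f"
    unfolding fk holder_on_add_const by (rule sinc_bump_holder(1)[OF \<beta> N A(1)])
  ultimately show adm: "bumped m N x A \<in> admissible_densities d \<beta> fmin fmax R (density V (\<lambda>y. ennreal (bumped m N x A y)))"
    unfolding admissible_densities_def Let_def f_def[symmetric] supp
    using f_meas fmin' fmax' by auto
  have "M \<in> manifold_class d x \<tau>"
    using compact_M smooth_submanifold_M x reach_M[OF \<tau>] by (simp add: manifold_class_def)
  moreover have "0 < \<alpha> + 1" using \<alpha> by simp
  ultimately have "M \<in> holder_manifold_class d \<alpha> x \<tau> L"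
    using identity_holder[OF \<open>0 < \<alpha> + 1\<close> r9] order_trans[OF identity_holder(2)[OF \<open>0 < \<alpha> + 1\<close> r9] ennreal_leI[OF L]]
    by (simp add: holder_manifold_class_def)
  then show "density V (\<lambda>y. ennreal (bumped m N x A y)) \<in> statistical_model d \<alpha> \<beta> x \<tau> L fmin fmax R"
    using adm supp P.prob_space_perturbed unfolding statistical_model_def f_def[symmetric]
    by (auto simp: f)
qed

text \<open>The values of the two densities at x differ by at least A / 2, so s = A / 4 in Le Cam's
  bound, and 4 * 12 = 48. The last condition on n makes the chi-square divergence at most 1 /
  n.\<close>

lemma minimax_risk_ge:
  assumes r9: "9 \<le> r" and \<tau>: "0 \<le> \<tau>" "\<tau> < r" and x: "x \<in> M" and \<alpha>: "0 \<le> \<alpha>" and \<beta>: "0 < \<beta>" and p: "1 \<le> p"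
    and L: "4 * r * real DIM('a) \<le> L" and fmin: "fmin \<le> 1 / (2 * mass_upper)" and fmax: "2 / mass_lower \<le> fmax"
    and N: "0 < N" "real (Suc (holder_order \<beta>)) \<le> N * r" "4 * (ball_const * 2 ^ (d + 2)) \<le> mass_lower * N ^ d"
    and A: "0 \<le> A" "2 * A * mass_upper \<le> 1" "2 * A * (N * exp (4 * real d)) powr \<beta> \<le> R"
    and n: "0 < n" "real n * A\<^sup>2 * (mass_upper * (ball_const * 2 ^ (d + 2))) \<le> N ^ d"
  shows "ennreal (A / 48) \<le> minimax_risk n p d \<alpha> \<beta> x \<tau> L fmin fmax R"
proof -
  interpret P: perturbed_density V "sinc_bump d N x" A
    by (rule perturbed_density_sinc_bump[OF r9 A(1,2)])
  let ?P0 = "density V (\<lambda>y. ennreal (bumped d N x 0 y))" and ?P1 = "density V (\<lambda>y. ennreal (bumped d N x A y))"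
  interpret P0: perturbed_density V "sinc_bump d N x" 0
    by (rule perturbed_density_sinc_bump[OF r9]) auto
  have R0: "0 \<le> R" using A(1,3) by (smt (verit) mult_nonneg_nonneg powr_ge_zero)
  have f0: "bumped d N x 0 y = 1 / P.mass" for y
    by (simp add: bumped_def P0.perturbed_def)
  have perturbed: "bumped d N x A = P.perturbed" by (simp add: bumped_def)
  define J where "J = (\<integral>y. (sinc_bump d N x y)\<^sup>2 \<partial>V)"
  have Nd: "0 < N ^ d" using N(1) by simp
  have J: "J \<le> ball_const * 2 ^ (d + 2) / N ^ d"
    unfolding J_def using N(1) d by (intro sinc_bump_square_integral_le) auto
  have mass: "mass_lower \<le> P.mass" "P.mass \<le> mass_upper"
    unfolding P.mass_def using mass_ge[OF r9] mass_le by auto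
  have J0: "0 \<le> J" unfolding J_def by (intro integral_nonneg_AE) auto
  \<comment> \<open>Centering must not undo the bump at x, where it has height 1; a mean of at most
    1/2 preserves half of it.\<close>
  have mean: "P.mean \<le> 1 / 2"
  proof -
    have "P.mean\<^sup>2 * P.mass \<le> J" unfolding J_def by (rule P.mean_square_le)
    also have "\<dots> \<le> mass_lower / 4"
    proof -
      have "ball_const * 2 ^ (d + 2) / N ^ d \<le> mass_lower / 4"
        using N(3) Nd by (simp add: field_simps)
      then show ?thesis using J by linarith
    qed
    also have "\<dots> \<le> (1 / 2)\<^sup>2 * P.mass" using mass by (simp add: power2_eq_square)
    finally have "P.mean\<^sup>2 \<le> (1 / 2)\<^sup>2" using P.mass_pos by (simp only: mult_le_cancel_right_pos)
    then show ?thesis by (rule power2_le_imp_le) simp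
  qed
  have one: "(\<integral>\<^sup>+y. h y \<partial>?P1)\<^sup>2 \<le> ennreal (1 + 1 / real n) * (\<integral>\<^sup>+y. (h y)\<^sup>2 \<partial>?P0)"
    if h: "h \<in> borel_measurable ?P0" for h
  proof -
    have "h \<in> borel_measurable V" using h by simp
    from P.chi_square_perturbed[OF this]
    have "(\<integral>\<^sup>+y. h y \<partial>?P1)\<^sup>2 \<le> ennreal (1 + A\<^sup>2 * P.mass * J) * (\<integral>\<^sup>+y. (h y)\<^sup>2 \<partial>?P0)"
      by (simp only: f0 perturbed J_def)
    also have "\<dots> \<le> ennreal (1 + 1 / real n) * (\<integral>\<^sup>+y. (h y)\<^sup>2 \<partial>?P0)"
    proof (intro mult_right_mono ennreal_leI add_left_mono)
      have "A\<^sup>2 * P.mass * J \<le> A\<^sup>2 * mass_upper * (ball_const * 2 ^ (d + 2) / N ^ d)"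
        using mass J J0 mass_bounds_pos by (intro mult_mono mult_nonneg_nonneg) auto
      also have "\<dots> \<le> 1 / real n" using n Nd by (simp add: field_simps)
      finally show "A\<^sup>2 * P.mass * J \<le> 1 / real n" .
    qed simp
    finally show ?thesis .
  qed
  have prob: "prob_space ?P0" "prob_space ?P1"
    using P.prob_space_uniform P.prob_space_perturbed by (simp_all only: f0 perturbed)
  have gap: "2 * (A / 4) \<le> \<bar>bumped d N x 0 x - bumped d N x A x\<bar>"
  proof -
    have "bumped d N x A x - bumped d N x 0 x = A * (1 - P.mean)"
      by (simp add: f0 perturbed P.perturbed_def sinc_bump_center)
    moreover have "A * (1 / 2) \<le> A * (1 - P.mean)" using A(1) mean by (intro mult_left_mono) auto
    ultimately show ?thesis by linarith
  qed
  note model0 = bumped_in_model[OF r9 \<tau> x \<alpha> \<beta> L fmin fmax N(1,2), of 0 d R]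
  note model1 = bumped_in_model[OF r9 \<tau> x \<alpha> \<beta> L fmin fmax N(1,2) A]
  show ?thesis
    unfolding minimax_risk_def
  proof (rule INF_greatest)
    fix fhat :: "(nat \<Rightarrow> 'a) \<Rightarrow> real"
    assume fhat: "fhat \<in> borel_measurable (\<Pi>\<^sub>M i\<in>{..<n}. borel)"
    define S where "S = (SUP P\<in>statistical_model d \<alpha> \<beta> x \<tau> L fmin fmax R.
          SUP f\<in>admissible_densities d \<beta> fmin fmax R P. pointwise_loss n p P fhat (f x))"
    have S: "pointwise_loss n p P fhat (f x) \<le> S"
      if "P \<in> statistical_model d \<alpha> \<beta> x \<tau> L fmin fmax R" "f \<in> admissible_densities d \<beta> fmin fmax R P" for P f
      unfolding S_def using that by (intro SUP_upper2[OF that(1)] SUP_upper2[OF that(2)]) auto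
    have "ennreal (A / 4 / 12) \<le> max (pointwise_loss n p ?P0 fhat (bumped d N x 0 x)) (pointwise_loss n p ?P1 fhat (bumped d N x A x))"
      using prob p A(1) gap n(1) fhat one by (intro le_cam_two_points) auto
    also have "\<dots> \<le> S"
      using S[OF model0] S[OF model1] R0 by simp
    finally show "ennreal (A / 48) \<le> S" by simp
  qed
qed

end

text \<open>A is the largest amplitude that the Hoelder bound admits, and N solves the chi-square
  condition with equality: N ^ q = n B exp (- 2 E \<beta>). With \<theta> = \<beta> / q this leaves
  exp (- \<theta> ln B - E d \<theta>) in the rescaled amplitude, and \<theta> \<le> 1/2 bounds it
  below uniformly in \<beta>.\<close>

lemma rate_computation:
  fixes \<beta> d n B E R :: real
  assumes \<beta>: "0 < \<beta>" and d: "0 < d" and n: "0 < n" and B: "0 < B" and R: "0 < R" and E: "0 < E"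
  defines "q \<equiv> 2 * \<beta> + d"
  defines "N \<equiv> (n * B) powr (1 / q) * exp (- 2 * E * \<beta> / q)"
  defines "A \<equiv> R / 2 * (N * exp E) powr - \<beta>"
  shows "0 < N" and "A\<^sup>2 * n * (4 * B / R\<^sup>2) = N powr d"
    and "R / 2 / max 1 B * exp (- E * d / 2) \<le> n powr (\<beta> / q) * A"
proof -
  have q: "0 < q" using \<beta> d by (simp add: q_def)
  show N: "0 < N" using n B by (simp add: N_def)
  have lnN: "ln N = ln (n * B) / q - 2 * E * \<beta> / q"
    using n B by (simp add: N_def ln_mult ln_powr)
  have A: "A = R / 2 * exp (- \<beta> * (ln N + E))"
    using N by (simp add: A_def powr_def ln_mult)
  have "A\<^sup>2 = R\<^sup>2 / 4 * exp (- 2 * \<beta> * (ln N + E))"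
    unfolding A by (simp add: power2_eq_square exp_add[symmetric] algebra_simps)
  then have "A\<^sup>2 * n * (4 * B / R\<^sup>2) = n * B * exp (- 2 * \<beta> * (ln N + E))"
    using R by (simp add: field_simps)
  also have "\<dots> = exp (ln (n * B) - 2 * \<beta> * (ln N + E))"
    using n B by (simp add: exp_diff exp_minus divide_inverse)
  also have "ln (n * B) - 2 * \<beta> * (ln N + E) = d * ln N"
  proof -
    have "q * ln N = ln (n * B) - 2 * E * \<beta>" unfolding lnN using q by (simp add: field_simps)
    then show ?thesis by (simp add: q_def algebra_simps)
  qed
  also have "exp (d * ln N) = N powr d" using N by (simp add: powr_def)
  finally show "A\<^sup>2 * n * (4 * B / R\<^sup>2) = N powr d" .
  define \<theta> where "\<theta> = \<beta> / q"
  have \<theta>: "0 \<le> \<theta>" "\<theta> \<le> 1 / 2" using \<beta> d q by (auto simp: \<theta>_def q_def field_simps)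
  have "n powr \<theta> * A = R / 2 * (exp (- \<theta> * ln B) * exp (- (E * d * \<theta>)))"
  proof -
    have "\<theta> * ln n + - \<beta> * (ln N + E) = - \<theta> * ln B + - (E * d * \<theta>)"
    proof -
      have 1: "\<beta> * ln N = \<theta> * (ln n + ln B) - 2 * E * \<beta> * \<theta>"
        unfolding lnN \<theta>_def using n B by (simp add: ln_mult field_simps)
      have 2: "\<beta> = 2 * \<beta> * \<theta> + d * \<theta>"
        proof -
          have "\<beta> = q * \<theta>" unfolding \<theta>_def using q by simp
          then show ?thesis by (simp add: q_def algebra_simps)
        qed
      have "\<beta> * E = 2 * E * \<beta> * \<theta> + E * d * \<theta>" by (subst 2) (simp add: algebra_simps)
      with 1 show ?thesis by (simp add: algebra_simps)
    qed
    then have "exp (\<theta> * ln n) * exp (- \<beta> * (ln N + E)) = exp (- \<theta> * ln B) * exp (- (E * d * \<theta>))"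
      by (simp only: exp_add[symmetric])
    then show ?thesis using n by (simp add: A powr_def)
  qed
  also have "\<dots> \<ge> R / 2 * (1 / max 1 B * exp (- E * d / 2))"
  proof (intro mult_left_mono mult_mono)
    have "\<theta> * ln B \<le> ln (max 1 B)"
    proof (cases "1 \<le> B")
      case True
      then have "\<theta> * ln B \<le> 1 * ln B" using \<theta> by (intro mult_right_mono) auto
      then show ?thesis using True by (simp add: max_def)
    next
      case False
      then have "ln B \<le> 0" using B by simp
      then have "\<theta> * ln B \<le> 0" using \<theta> by (simp add: mult_nonneg_nonpos)
      then show ?thesis using False by (simp add: max_def)
    qed
    then have "exp (- ln (max 1 B)) \<le> exp (- \<theta> * ln B)" by simp
    then show "1 / max 1 B \<le> exp (- \<theta> * ln B)" by (simp add: exp_minus inverse_eq_divide)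
    have "E * d * \<theta> \<le> E * d * (1 / 2)" using \<theta> E d by (intro mult_left_mono) auto
    then show "exp (- E * d / 2) \<le> exp (- (E * d * \<theta>))" by simp
  qed (use R in auto)
  finally show "R / 2 / max 1 B * exp (- E * d / 2) \<le> n powr (\<beta> / q) * A"
    by (simp add: \<theta>_def)
qed

section \<open>Choice of the constants and conclusion\<close>

lemma liminf_minimax_risk_fixed_dimension:
  assumes \<tau>: "0 < \<tau>" and d: "1 \<le> d" "d + 1 \<le> DIM('a::euclidean_space)"
  shows "\<exists>L0>0. \<exists>fmax0>0. \<exists>fmin0>0. \<forall>R>0. \<exists>C>0. \<forall>(x::'a) p \<alpha> \<beta> L fmin fmax.
    p \<ge> 1 \<and> \<alpha> \<ge> 0 \<and> \<beta> > 0 \<and> L \<ge> L0 \<and> fmax \<ge> fmax0 \<and> fmin \<le> fmin0 \<longrightarrow>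
    ennreal C \<le> liminf (\<lambda>n. ennreal (real n powr (\<beta> / (2 * \<beta> + real d))) *
                  minimax_risk n p d \<alpha> \<beta> x \<tau> L fmin fmax R)"
proof -
  \<comment> \<open>The radius must exceed \<tau> for the reach and be at least 9 for the
    inclusion.\<close>
  define r where "r = max \<tau> 8 + 1"
  have r: "9 \<le> r" "\<tau> < r" "0 < r" by (auto simp: r_def)
  obtain I :: "'a set" where I: "I \<subseteq> Basis" "card I = Suc d"
    using obtain_subset_with_card_n[of "Suc d" "Basis :: 'a set"] d by auto
  then obtain e0 where e0: "e0 \<in> I" by (metis card.empty equals0I nat.distinct(1))
  \<comment> \<open>The volume constants do not mention the centre. Those of the sphere about 0 are
    therefore also those of the sphere through x, which makes all thresholds independent of
    x.\<close>
  interpret Z: subspace_sphere I e0 0 r d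
    by unfold_locales (use I e0 d r in auto)
  define G where "G = Z.mass_upper * (Z.ball_const * 2 ^ (d + 2))"
  have G: "0 < G" using Z.mass_bounds_pos Z.ball_const_pos by (simp add: G_def)
  define E where "E = 4 * real d"
  have E: "0 < E" using d by (simp add: E_def)
  \<comment> \<open>Chosen so that the factor 4 B / R^2 in the rate computation becomes G, the
    constant in the chi-square condition.\<close>
  define B where "B = (\<lambda>R::real. R\<^sup>2 / 4 * G)"
  define C where "C = (\<lambda>R. R / 2 / max 1 (B R) * exp (- E * real d / 2) / 48)"
  have main: "ennreal (C R) \<le> liminf (\<lambda>n. ennreal (real n powr (\<beta> / (2 * \<beta> + real d))) *
                  minimax_risk n p d \<alpha> \<beta> x \<tau> L fmin fmax R)"
    if R: "0 < R" and p: "1 \<le> p" and \<alpha>: "0 \<le> \<alpha>" and \<beta>: "0 < \<beta>" and L: "4 * r * real DIM('a) \<le> L"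
      and fmax: "2 / Z.mass_lower \<le> fmax" and fmin: "fmin \<le> 1 / (2 * Z.mass_upper)"
    for R p \<alpha> \<beta> L fmin fmax and x :: 'a
  proof -
    interpret X: subspace_sphere I e0 "x - r *\<^sub>R e0" r d
      by unfold_locales (use I e0 d r in auto)
    have x: "x \<in> X.M" using X.pole_M by simp
    define q where "q = 2 * \<beta> + real d"
    have q: "0 < q" using \<beta> by (simp add: q_def)
    have B: "0 < B R" using R G by (simp add: B_def)
    define N where "N = (\<lambda>n. (real n * B R) powr (1 / q) * exp (- 2 * E * \<beta> / q))"
    define A where "A = (\<lambda>n. R / 2 * (N n * exp E) powr - \<beta>)"
    \<comment> \<open>Lower bounds on N for four purposes: to have N \<le> N ^ d, the strip width
      for the derivatives, the mean at most 1/2, and the positivity margin 2 A mass \<le> 1. They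
      may depend on \<beta> and R, since they affect only the sample size from which the bound
      holds.\<close>
    define Z0 where "Z0 = Max {1, real (Suc (holder_order \<beta>)) / r,
      4 * (Z.ball_const * 2 ^ (d + 2)) / Z.mass_lower, (R * Z.mass_upper) powr (1 / \<beta>)}"
    have Z0: "1 \<le> Z0" "real (Suc (holder_order \<beta>)) / r \<le> Z0"
        "4 * (Z.ball_const * 2 ^ (d + 2)) / Z.mass_lower \<le> Z0" "(R * Z.mass_upper) powr (1 / \<beta>) \<le> Z0"
      unfolding Z0_def by (rule Max_ge; simp)+
    \<comment> \<open>Obtained by solving N n \<ge> Z0 for n; the summand 1 ensures n > 0.\<close>
    define n0 where "n0 = nat \<lceil>(Z0 / exp (- 2 * E * \<beta> / q)) powr q / B R\<rceil> + 1"
    have bound: "ennreal (C R) \<le> ennreal (real n powr (\<beta> / q)) * minimax_risk n p d \<alpha> \<beta> x \<tau> L fmin fmax R"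
      if n: "n0 \<le> n" for n
    proof -
      have n1: "0 < n" using n by (simp add: n0_def)
      note rate = rate_computation[OF \<beta> _ _ B R E, of "real d" "real n", folded q_def]
      have Npos: "0 < N n" unfolding N_def by (rule rate(1)) (use n1 d in auto)
      have "(Z0 / exp (- 2 * E * \<beta> / q)) powr q / B R \<le> real n"
        using n unfolding n0_def by linarith
      then have "(Z0 / exp (- 2 * E * \<beta> / q)) powr q \<le> real n * B R"
        using B by (simp add: pos_divide_le_eq)
      then have "((Z0 / exp (- 2 * E * \<beta> / q)) powr q) powr (1 / q) \<le> (real n * B R) powr (1 / q)"
        using q by (intro powr_mono2) auto
      moreover have "((Z0 / exp (- 2 * E * \<beta> / q)) powr q) powr (1 / q) = Z0 / exp (- 2 * E * \<beta> / q)"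
        using q Z0(1) by (simp add: powr_powr)
      ultimately have "Z0 / exp (- 2 * E * \<beta> / q) \<le> (real n * B R) powr (1 / q)" by linarith
      then have NZ: "Z0 \<le> N n" unfolding N_def by (simp add: pos_divide_le_eq)
      have N1: "1 \<le> N n" using NZ Z0(1) by linarith
      have A0: "0 \<le> A n" using R by (simp add: A_def)
      have NE: "0 < N n * exp E" using Npos by simp
      have "R * Z.mass_upper = ((R * Z.mass_upper) powr (1 / \<beta>)) powr \<beta>"
        using \<beta> R Z.mass_bounds_pos by (simp add: powr_powr)
      also have "\<dots> \<le> (N n * exp E) powr \<beta>"
      proof (intro powr_mono2)
        have "N n * 1 \<le> N n * exp E" using Npos E by (intro mult_left_mono) auto
        then show "(R * Z.mass_upper) powr (1 / \<beta>) \<le> N n * exp E" using NZ Z0(4) by linarith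
      qed (use \<beta> in auto)
      finally have "R * Z.mass_upper / (N n * exp E) powr \<beta> \<le> 1"
        using NE by (subst divide_le_eq_1_pos) auto
      moreover have "2 * A n * Z.mass_upper = R * Z.mass_upper / (N n * exp E) powr \<beta>"
        unfolding A_def powr_minus_divide by simp
      ultimately have Asmall: "2 * A n * Z.mass_upper \<le> 1" by linarith
      have "ennreal (A n / 48) \<le> minimax_risk n p d \<alpha> \<beta> x \<tau> L fmin fmax R"
      proof (rule X.minimax_risk_ge[OF r(1) less_imp_le[OF \<tau>] r(2) x \<alpha> \<beta> p L fmin fmax Npos])
        show "real (Suc (holder_order \<beta>)) \<le> N n * r"
          using NZ Z0(2) r(3) by (simp add: pos_divide_le_eq[symmetric] order_trans[of _ Z0])
        have "4 * (Z.ball_const * 2 ^ (d + 2)) \<le> Z.mass_lower * N n"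
          using NZ Z0(3) Z.mass_bounds_pos
          by (simp add: pos_divide_le_eq[symmetric] mult.commute[of Z.mass_lower] order_trans[of _ Z0])
        also have "\<dots> \<le> Z.mass_lower * N n ^ d"
          using N1 d Z.mass_bounds_pos power_increasing[of 1 d "N n"] by (intro mult_left_mono) auto
        finally show "4 * (Z.ball_const * 2 ^ (d + 2)) \<le> Z.mass_lower * N n ^ d" .
        show "2 * A n * (N n * exp (4 * real d)) powr \<beta> \<le> R"
          unfolding A_def powr_minus_divide E_def[symmetric] using NE R by simp
        have "(A n)\<^sup>2 * real n * (4 * B R / R\<^sup>2) = N n powr real d"
          unfolding A_def N_def by (rule rate(2)) (use n1 d in auto)
        moreover have "4 * B R / R\<^sup>2 = G" using R by (simp add: B_def)
        moreover have "N n powr real d = N n ^ d" using Npos by (simp add: powr_realpow)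
        ultimately have "(A n)\<^sup>2 * real n * G = N n ^ d" by (simp only:)
        then show "real n * (A n)\<^sup>2 * (Z.mass_upper * (Z.ball_const * 2 ^ (d + 2))) \<le> N n ^ d"
          unfolding G_def[symmetric] by (simp add: mult.commute)
      qed (use A0 Asmall n1 in auto)
      then have "ennreal (real n powr (\<beta> / q)) * ennreal (A n / 48)
          \<le> ennreal (real n powr (\<beta> / q)) * minimax_risk n p d \<alpha> \<beta> x \<tau> L fmin fmax R"
        by (rule mult_left_mono) simp
      moreover have "ennreal (C R) \<le> ennreal (real n powr (\<beta> / q)) * ennreal (A n / 48)"
      proof -
        have "R / 2 / max 1 (B R) * exp (- E * real d / 2) \<le> real n powr (\<beta> / q) * A n"
          unfolding A_def N_def by (rule rate(3)) (use n1 d in auto)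
        then have "C R \<le> real n powr (\<beta> / q) * (A n / 48)" by (simp add: C_def)
        then show ?thesis using A0 by (simp add: ennreal_mult'[symmetric] ennreal_leI)
      qed
      ultimately show ?thesis by (rule order_trans[rotated])
    qed
    show ?thesis
      unfolding q_def[symmetric]
      by (rule Liminf_bounded, rule eventually_sequentiallyI[of n0], rule bound)
  qed
  have C: "0 < C R" if "0 < R" for R
    using that by (simp add: C_def)
  have pos: "0 < 4 * r * real DIM('a)" "0 < 2 / Z.mass_lower" "0 < 1 / (2 * Z.mass_upper)"
    using r Z.mass_bounds_pos by auto
  show ?thesis
    by (rule exI, rule conjI, rule pos(1), rule exI, rule conjI, rule pos(2), rule exI, rule conjI,
        rule pos(3), intro allI impI, rule exI, rule conjI, rule C, assumption, intro allI impI,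
        elim conjE, rule main) assumption+
qed

theorem theorem3p2:
  assumes "CARD('n::finite) \<ge> 2"
  shows "\<forall>\<tau>>0::real. \<exists>L0>0::real. \<exists>fmax0>0::real. \<exists>fmin0>0::real. \<forall>R>0::real. \<exists>C>0::real.
    \<forall>(x::real^'n) (p::real) (d::nat) (\<alpha>::real) (\<beta>::real) (L::real) (fmin::real) (fmax::real).
      p \<ge> 1 \<and> 1 \<le> d \<and> d \<le> CARD('n) - 1 \<and> \<alpha> \<ge> 0 \<and> \<beta> > 0 \<and>
      L \<ge> L0 \<and> fmax \<ge> fmax0 \<and> 0 \<le> fmin \<and> fmin \<le> fmin0 \<and> fmin < fmax \<longrightarrow>
      liminf (\<lambda>n. ennreal (real n powr (\<beta> / (2 * \<beta> + real d))) *
                  minimax_risk n p d \<alpha> \<beta> x \<tau> L fmin fmax R) \<ge> ennreal C"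
proof (intro allI impI)
  fix \<tau> :: real assume \<tau>: "0 < \<tau>"
  \<comment> \<open>The constants for fixed d depend on d, but the statement asks for common ones.
    As d has finitely many values, maxima of the thresholds for L and fmax and minima of those for
    fmin and of C will do.\<close>
  define T where "T = {1..CARD('n) - 1}"
  have T: "finite T" "T \<noteq> {}" using assms by (auto simp: T_def)
  define Q where "Q = (\<lambda>d R L0 fmax0 fmin0 C. \<forall>(x::real^'n) (p::real) (\<alpha>::real) (\<beta>::real) (L::real) (fmin::real) (fmax::real).
      p \<ge> 1 \<and> \<alpha> \<ge> 0 \<and> \<beta> > 0 \<and> L \<ge> L0 \<and> fmax \<ge> fmax0 \<and> fmin \<le> fmin0 \<longrightarrow>
      ennreal C \<le> liminf (\<lambda>n. ennreal (real n powr (\<beta> / (2 * \<beta> + real d))) *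
                  minimax_risk n p d \<alpha> \<beta> x \<tau> L fmin fmax R))"
  have "\<exists>L0>0. \<exists>fmax0>0. \<exists>fmin0>0. \<forall>R>0. \<exists>C>0. Q d R L0 fmax0 fmin0 C" if "d \<in> T" for d
    unfolding Q_def using that assms \<tau>
    by (intro liminf_minimax_risk_fixed_dimension) (auto simp: T_def)
  then obtain L0 fmax0 fmin0 where pos: "\<And>d. d \<in> T \<Longrightarrow> 0 < L0 d \<and> 0 < fmax0 d \<and> 0 < fmin0 d"
      and ex: "\<And>d R. d \<in> T \<Longrightarrow> 0 < R \<Longrightarrow> \<exists>C>0. Q d R (L0 d) (fmax0 d) (fmin0 d) C"
    by metis
  obtain C where C: "\<And>d R. d \<in> T \<Longrightarrow> 0 < R \<Longrightarrow> 0 < C d R \<and> Q d R (L0 d) (fmax0 d) (fmin0 d) (C d R)"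
    using ex by metis
  have Max: "0 < Max (h ` T)" "d \<in> T \<Longrightarrow> h d \<le> Max (h ` T)" if "\<And>d. d \<in> T \<Longrightarrow> 0 < h d" for h :: "nat \<Rightarrow> real" and d
    using T that by (auto simp: Max_gr_iff)
  have Min: "0 < Min (h ` T)" "d \<in> T \<Longrightarrow> Min (h ` T) \<le> h d" if "\<And>d. d \<in> T \<Longrightarrow> 0 < h d" for h :: "nat \<Rightarrow> real" and d
    using T that by auto
  have main: "\<exists>K>0::real. \<forall>(x::real^'n) (p::real) (d::nat) (\<alpha>::real) (\<beta>::real) (L::real) (fmin::real) (fmax::real).
      p \<ge> 1 \<and> 1 \<le> d \<and> d \<le> CARD('n) - 1 \<and> \<alpha> \<ge> 0 \<and> \<beta> > 0 \<and>
      L \<ge> Max (L0 ` T) \<and> fmax \<ge> Max (fmax0 ` T) \<and> 0 \<le> fmin \<and> fmin \<le> Min (fmin0 ` T) \<and> fmin < fmax \<longrightarrow>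
      liminf (\<lambda>n. ennreal (real n powr (\<beta> / (2 * \<beta> + real d))) *
                  minimax_risk n p d \<alpha> \<beta> x \<tau> L fmin fmax R) \<ge> ennreal K" if R: "0 < R" for R
  proof (rule exI[of _ "Min ((\<lambda>d. C d R) ` T)"], intro conjI allI impI)
      show "0 < Min ((\<lambda>d. C d R) ` T)" using C R by (intro Min) auto
      fix x :: "real^'n" and p :: real and d :: nat and \<alpha> \<beta> L fmin fmax :: real
      assume H: "p \<ge> 1 \<and> 1 \<le> d \<and> d \<le> CARD('n) - 1 \<and> \<alpha> \<ge> 0 \<and> \<beta> > 0 \<and>
        L \<ge> Max (L0 ` T) \<and> fmax \<ge> Max (fmax0 ` T) \<and> 0 \<le> fmin \<and> fmin \<le> Min (fmin0 ` T) \<and> fmin < fmax"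
      then have d: "d \<in> T" by (simp add: T_def)
      have "L0 d \<le> L" "fmax0 d \<le> fmax" "fmin \<le> fmin0 d"
        using H Max(2)[of L0 d] Max(2)[of fmax0 d] Min(2)[of fmin0 d] pos d by force+
      then have "ennreal (C d R) \<le> liminf (\<lambda>n. ennreal (real n powr (\<beta> / (2 * \<beta> + real d))) *
                  minimax_risk n p d \<alpha> \<beta> x \<tau> L fmin fmax R)"
        using C[OF d R] H unfolding Q_def by blast
      moreover have "ennreal (Min ((\<lambda>d. C d R) ` T)) \<le> ennreal (C d R)"
        using Min(2)[of "\<lambda>d. C d R" d] C R d by (intro ennreal_leI) auto
      ultimately show "ennreal (Min ((\<lambda>d. C d R) ` T)) \<le> liminf (\<lambda>n. ennreal (real n powr (\<beta> / (2 * \<beta> + real d))) *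
                  minimax_risk n p d \<alpha> \<beta> x \<tau> L fmin fmax R)" by (rule order_trans[rotated])
  qed
  have gt0: "0 < Max (L0 ` T)" "0 < Max (fmax0 ` T)" "0 < Min (fmin0 ` T)"
    using pos by (intro Max(1) Min(1); simp)+
  show "\<exists>L0>0::real. \<exists>fmax0>0::real. \<exists>fmin0>0::real. \<forall>R>0::real. \<exists>C>0::real.
    \<forall>(x::real^'n) (p::real) (d::nat) (\<alpha>::real) (\<beta>::real) (L::real) (fmin::real) (fmax::real).
      p \<ge> 1 \<and> 1 \<le> d \<and> d \<le> CARD('n) - 1 \<and> \<alpha> \<ge> 0 \<and> \<beta> > 0 \<and>
      L \<ge> L0 \<and> fmax \<ge> fmax0 \<and> 0 \<le> fmin \<and> fmin \<le> fmin0 \<and> fmin < fmax \<longrightarrow>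
      liminf (\<lambda>n. ennreal (real n powr (\<beta> / (2 * \<beta> + real d))) *
                  minimax_risk n p d \<alpha> \<beta> x \<tau> L fmin fmax R) \<ge> ennreal C"
    by (rule_tac x = "Max (L0 ` T)" in exI, rule conjI, rule gt0,
        rule_tac x = "Max (fmax0 ` T)" in exI, rule conjI, rule gt0,
        rule_tac x = "Min (fmin0 ` T)" in exI, rule conjI, rule gt0,
        intro allI impI, rule main)
qed

end
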